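(* Let $G$ be a finite graph. Then the associated operator system $\mathcal{S}_G$ is $(\min,\max)$-nuclear if and only if each (connected) component of $G$ is complete.
   Context: For a finite (undirected) graph $G$ with vertex set $\{1,\dots,n\}$, the graph operator system is $\mathcal{S}_G=\mathrm{span}\big(\{E_{i,j}:(i,j)\in G\}\cup\{E_{i,i}:1\le i\le n\}\big)\subseteq M_n(\mathbb{C})$, where $\{E_{i,j}\}$ are the standard matrix units and $(i,j)\in G$ means that $i$ and $j$ are joined by an (unordered) edge of $G$ (so both $E_{i,j}$ and $E_{j,i}$ belong to $\mathcal{S}_G$). An operator system is a unital self-adjoint subspace of $B(\mathcal{H})$ for a complex Hilbert space $\mathcal{H}$. Tensor products of operator systems $\mathcal{S},\mathcal{T}$ (operator system structures on the algebraic tensor product $\mathcal{S}\otimes\mathcal{T}$ with unit $1\otimes1$): $\mathcal{S}\otimes_{\min}\mathcal{T}$ is the structure inherited from $B(\mathcal{H}\otimes\mathcal{K})$ when $\mathcal{S}\subseteq B(\mathcal{H})$, $\mathcal{T}\subseteq B(\mathcal{K})$. $\mathcal{S}\otimes_{\max}\mathcal{T}$ has as positive cone in $M_n(\mathcal{S}\otimes\mathcal{T})$ the set of $x$ such that $r(1\otimes1)_n+x\in D_n$ for all $r>0$, where $(1\otimes1)_n$ is the diagonal matrix with diagonal entries $1\otimes1$ and $D_n=\{\alpha(P\otimes Q)\alpha^*: P\in M_k(\mathcal{S})^+, Q\in M_m(\mathcal{T})^+, \alpha\in M_{n,km}(\mathbb{C}), k,m\in\mathbb{N}\}$. $\mathcal{S}$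 is $(\min,\max)$-nuclear if for every operator system $\mathcal{T}$ the identity map $\mathcal{S}\otimes_{\min}\mathcal{T}\to\mathcal{S}\otimes_{\max}\mathcal{T}$ is a complete order isomorphism. *)

theory Defs
  imports
    "HOL-Analysis.Abstract_Metric_Spaces"
    "HOL-Library.Equipollence"
    "Jordan_Normal_Form.VS_Connect"
    "Graph_Theory.Kuratowski"
begin

hide_const (open) Multiset.mult Modules.module Polynomial.smult
  Real_Vector_Spaces.subspace

section \<open>Complex Hilbert spaces and bounded operators\<close>

text \<open>Spaces are carried by sets, as in HOL-Algebra, so that a definition can quantify over all
  Hilbert spaces inside a given type. Inner products are linear in the first argument.\<close>

record 'v cinner_space = "(complex, 'v) module" +
  ip :: "'v \<Rightarrow> 'v \<Rightarrow> complex"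

definition vnorm :: "'v cinner_space \<Rightarrow> 'v \<Rightarrow> real" where
  "vnorm V x = sqrt (Re (ip V x x))"

text \<open>The value off the carrier is a dummy: the locale \<^locale>\<open>Metric_space\<close> asks for
  nonnegativity and symmetry at all arguments.\<close>

definition vdist :: "'v cinner_space \<Rightarrow> 'v \<Rightarrow> 'v \<Rightarrow> real" where
  "vdist V x y = (if x \<in> carrier V \<and> y \<in> carrier V then vnorm V (x \<ominus>\<^bsub>V\<^esub> y) else 0)"

locale complex_hilbert = vectorspace "class_ring :: complex ring" V
  for V :: "'v cinner_space" (structure) +
  assumes ip_add: "\<lbrakk>x \<in> carrier V; y \<in> carrier V; z \<in> carrier V\<rbrakk>
      \<Longrightarrow> ip V (x \<oplus> y) z = ip V x z + ip V y z"
    and ip_smult: "\<lbrakk>x \<in> carrier V; y \<in> carrier V\<rbrakk> \<Longrightarrow> ip V (c \<odot> x) y = c * ip V x y"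
    and ip_cnj: "\<lbrakk>x \<in> carrier V; y \<in> carrier V\<rbrakk> \<Longrightarrow> ip V y x = cnj (ip V x y)"
    and ip_pos: "\<lbrakk>x \<in> carrier V; x \<noteq> \<zero>\<rbrakk> \<Longrightarrow> 0 < ip V x x"
    and complete: "Metric_space.mcomplete (carrier V) (vdist V)"

text \<open>Operators are extensional functions, so that equality of functions is equality of
  operators.\<close>

definition bounded_op :: "'v cinner_space \<Rightarrow> ('v \<Rightarrow> 'v) \<Rightarrow> bool" where
  "bounded_op V f \<longleftrightarrow> f \<in> extensional (carrier V) \<and> f \<in> module_hom class_ring V V \<and>
     (\<exists>C. \<forall>x\<in>carrier V. vnorm V (f x) \<le> C * vnorm V x)"

definition bop :: "'v cinner_space \<Rightarrow> (complex, 'v \<Rightarrow> 'v) module" where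
  "bop V = \<lparr>
     carrier = {f. bounded_op V f},
     mult = compose (carrier V),
     one = (\<lambda>x\<in>carrier V. x),
     zero = (\<lambda>x\<in>carrier V. \<zero>\<^bsub>V\<^esub>),
     add = (\<lambda>f g. \<lambda>x\<in>carrier V. f x \<oplus>\<^bsub>V\<^esub> g x),
     smult = (\<lambda>c f. \<lambda>x\<in>carrier V. c \<odot>\<^bsub>V\<^esub> f x)\<rparr>"

definition adjoint_op :: "'v cinner_space \<Rightarrow> ('v \<Rightarrow> 'v) \<Rightarrow> ('v \<Rightarrow> 'v) \<Rightarrow> bool" where
  "adjoint_op V f g \<longleftrightarrow> (\<forall>x\<in>carrier V. \<forall>y\<in>carrier V. ip V (f x) y = ip V x (g y))"


section \<open>Operator systems and their matrix cones\<close>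

definition operator_system :: "'v cinner_space \<Rightarrow> ('v \<Rightarrow> 'v) set \<Rightarrow> bool" where
  "operator_system V S \<longleftrightarrow> subspace class_ring S (bop V) \<and> \<one>\<^bsub>bop V\<^esub> \<in> S \<and>
     (\<forall>s\<in>S. \<exists>t\<in>S. adjoint_op V s t)"

definition sq_mats :: "nat \<Rightarrow> 'a set \<Rightarrow> 'a mat set" where
  "sq_mats n U = {X \<in> carrier_mat n n. \<forall>i<n. \<forall>j<n. X $$ (i, j) \<in> U}"

text \<open>Positivity of an \<open>n \<times> n\<close> operator matrix acting on the \<open>n\<close>-fold direct sum of \<open>V\<close>. The order
  on \<^typ>\<open>complex\<close> makes \<open>0 \<le> z\<close> say that \<open>z\<close> is real and nonnegative.\<close>

definition pos_op_mat :: "'v cinner_space \<Rightarrow> nat \<Rightarrow> ('v \<Rightarrow> 'v) mat \<Rightarrow> bool" where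
  "pos_op_mat V n X \<longleftrightarrow>
     (\<forall>v \<in> {..<n} \<rightarrow> carrier V. 0 \<le> (\<Sum>i<n. \<Sum>j<n. ip V ((X $$ (i, j)) (v j)) (v i)))"

definition pos_cone :: "'v cinner_space \<Rightarrow> ('v \<Rightarrow> 'v) set \<Rightarrow> nat \<Rightarrow> ('v \<Rightarrow> 'v) mat set" where
  "pos_cone V S n = {X \<in> sq_mats n S. pos_op_mat V n X}"


section \<open>Tensor products\<close>

text \<open>\<open>L\<close> with \<open>\<tau> x y = x \<otimes> y\<close> is a Hilbert space tensor product of \<open>H\<close> and \<open>K\<close>; this determines
  the pair up to a unitary compatible with elementary tensors.\<close>

definition hilbert_tensor :: "'u cinner_space \<Rightarrow> 'v cinner_space \<Rightarrow> 'w cinner_space \<Rightarrow>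
    ('u \<Rightarrow> 'v \<Rightarrow> 'w) \<Rightarrow> bool" where
  "hilbert_tensor H K L \<tau> \<longleftrightarrow> complex_hilbert L \<and>
     (\<forall>y\<in>carrier K. (\<lambda>x. \<tau> x y) \<in> module_hom class_ring H L) \<and>
     (\<forall>x\<in>carrier H. \<tau> x \<in> module_hom class_ring K L) \<and>
     (\<forall>x\<in>carrier H. \<forall>x'\<in>carrier H. \<forall>y\<in>carrier K. \<forall>y'\<in>carrier K.
        ip L (\<tau> x y) (\<tau> x' y') = ip H x x' * ip K y y') \<and>
     Metric_space.mtopology (carrier L) (vdist L) closure_of
       (LinearCombinations.module.span class_ring L {\<tau> x y | x y. x \<in> carrier H \<and> y \<in> carrier K})
       = carrier L"

definition op_tensor :: "'u cinner_space \<Rightarrow> 'v cinner_space \<Rightarrow> 'w cinner_space \<Rightarrow>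
    ('u \<Rightarrow> 'v \<Rightarrow> 'w) \<Rightarrow> ('u \<Rightarrow> 'u) \<Rightarrow> ('v \<Rightarrow> 'v) \<Rightarrow> 'w \<Rightarrow> 'w" where
  "op_tensor H K L \<tau> s t = (THE f. f \<in> carrier (bop L) \<and>
     (\<forall>x\<in>carrier H. \<forall>y\<in>carrier K. f (\<tau> x y) = \<tau> (s x) (t y)))"

text \<open>The algebraic tensor product of \<open>S\<close> and \<open>T\<close> embeds into the bounded operators on the Hilbert
  space tensor product, and is identified with its image.\<close>

definition alg_tensor :: "'u cinner_space \<Rightarrow> 'v cinner_space \<Rightarrow> 'w cinner_space \<Rightarrow>
    ('u \<Rightarrow> 'v \<Rightarrow> 'w) \<Rightarrow> ('u \<Rightarrow> 'u) set \<Rightarrow> ('v \<Rightarrow> 'v) set \<Rightarrow> ('w \<Rightarrow> 'w) set" where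
  "alg_tensor H K L \<tau> S T =
     LinearCombinations.module.span class_ring (bop L)
       {op_tensor H K L \<tau> s t | s t. s \<in> S \<and> t \<in> T}"

definition min_cone :: "'u cinner_space \<Rightarrow> 'v cinner_space \<Rightarrow> 'w cinner_space \<Rightarrow>
    ('u \<Rightarrow> 'v \<Rightarrow> 'w) \<Rightarrow> ('u \<Rightarrow> 'u) set \<Rightarrow> ('v \<Rightarrow> 'v) set \<Rightarrow> nat \<Rightarrow> ('w \<Rightarrow> 'w) mat set" where
  "min_cone H K L \<tau> S T n = pos_cone L (alg_tensor H K L \<tau> S T) n"

text \<open>Kronecker product of a \<open>k \<times> k\<close> and an \<open>m \<times> m\<close> operator matrix; the index pair \<open>(a, b)\<close> is
  encoded as \<open>a * m + b\<close>.\<close>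

definition mat_tensor :: "'u cinner_space \<Rightarrow> 'v cinner_space \<Rightarrow> 'w cinner_space \<Rightarrow>
    ('u \<Rightarrow> 'v \<Rightarrow> 'w) \<Rightarrow> nat \<Rightarrow> nat \<Rightarrow> ('u \<Rightarrow> 'u) mat \<Rightarrow> ('v \<Rightarrow> 'v) mat \<Rightarrow> ('w \<Rightarrow> 'w) mat" where
  "mat_tensor H K L \<tau> k m P Q = mat (k * m) (k * m) (\<lambda>(p, q).
     op_tensor H K L \<tau> (P $$ (p div m, q div m)) (Q $$ (p mod m, q mod m)))"

text \<open>\<open>\<alpha> X \<alpha>\<^sup>*\<close> for a scalar \<open>n \<times> N\<close> matrix \<open>\<alpha>\<close> and an \<open>N \<times> N\<close> operator matrix \<open>X\<close>.\<close>

definition mat_conj :: "'w cinner_space \<Rightarrow> nat \<Rightarrow> nat \<Rightarrow> complex mat \<Rightarrow> ('w \<Rightarrow> 'w) mat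
    \<Rightarrow> ('w \<Rightarrow> 'w) mat" where
  "mat_conj L n N \<alpha> X = mat n n (\<lambda>(i, j).
     \<Oplus>\<^bsub>bop L\<^esub>p\<in>{..<N}. \<Oplus>\<^bsub>bop L\<^esub>q\<in>{..<N}.
       (\<alpha> $$ (i, p) * cnj (\<alpha> $$ (j, q))) \<odot>\<^bsub>bop L\<^esub> (X $$ (p, q)))"

definition D_max :: "'u cinner_space \<Rightarrow> 'v cinner_space \<Rightarrow> 'w cinner_space \<Rightarrow>
    ('u \<Rightarrow> 'v \<Rightarrow> 'w) \<Rightarrow> ('u \<Rightarrow> 'u) set \<Rightarrow> ('v \<Rightarrow> 'v) set \<Rightarrow> nat \<Rightarrow> ('w \<Rightarrow> 'w) mat set" where
  "D_max H K L \<tau> S T n = {mat_conj L n (k * m) \<alpha> (mat_tensor H K L \<tau> k m P Q) | k m \<alpha> P Q.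
     P \<in> pos_cone H S k \<and> Q \<in> pos_cone K T m \<and> \<alpha> \<in> carrier_mat n (k * m)}"

definition max_cone :: "'u cinner_space \<Rightarrow> 'v cinner_space \<Rightarrow> 'w cinner_space \<Rightarrow>
    ('u \<Rightarrow> 'v \<Rightarrow> 'w) \<Rightarrow> ('u \<Rightarrow> 'u) set \<Rightarrow> ('v \<Rightarrow> 'v) set \<Rightarrow> nat \<Rightarrow> ('w \<Rightarrow> 'w) mat set" where
  "max_cone H K L \<tau> S T n = {X \<in> sq_mats n (alg_tensor H K L \<tau> S T).
     \<forall>r::real. r > 0 \<longrightarrow>
       mat n n (\<lambda>(i, j).
         (if i = j then complex_of_real r \<odot>\<^bsub>bop L\<^esub> op_tensor H K L \<tau> \<one>\<^bsub>bop H\<^esub> \<one>\<^bsub>bop K\<^esub>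
          else \<zero>\<^bsub>bop L\<^esub>) \<oplus>\<^bsub>bop L\<^esub> X $$ (i, j))
       \<in> D_max H K L \<tau> S T n}"

text \<open>The type \<open>'v\<close> is the universe from which the Hilbert space \<open>K\<close> of the second factor is taken:
  HOL cannot quantify over types inside a formula, so \<open>K\<close> ranges over all Hilbert spaces whose
  carrier is a subset of \<open>'v\<close>. If \<open>'v\<close> has fewer elements than \<^typ>\<open>complex\<close>, the only such space is the
  zero space; so the notion is meant for \<open>'v\<close> of at least that cardinality. Every Hilbert space tensor product of \<open>H\<close> and \<open>K\<close> has a copy with
  carrier in \<open>'u \<times> 'v\<close>, by cardinality, and the cones do not depend on the copy; hence the choice of
  the type of \<open>L\<close> and the universal quantifier over \<open>L\<close> and \<open>\<tau>\<close>. The identity is a complete order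
  isomorphism iff the two cones agree at every matrix level.\<close>

definition min_max_nuclear :: "'v itself \<Rightarrow> 'u cinner_space \<Rightarrow> ('u \<Rightarrow> 'u) set \<Rightarrow> bool" where
  "min_max_nuclear U H S \<longleftrightarrow>
     (\<forall>(K :: 'v cinner_space) T (L :: ('u \<times> 'v) cinner_space) \<tau>.
        complex_hilbert K \<and> operator_system K T \<and> hilbert_tensor H K L \<tau> \<longrightarrow>
        (\<forall>n. min_cone H K L \<tau> S T n = max_cone H K L \<tau> S T n))"


section \<open>Graph operator systems\<close>

definition cvec_space :: "nat \<Rightarrow> complex vec cinner_space" where
  "cvec_space n = module.extend (module_vec TYPE(complex) n) \<lparr>ip = (\<lambda>v w. v \<bullet>c w)\<rparr>"

definition mat_op :: "nat \<Rightarrow> complex mat \<Rightarrow> complex vec \<Rightarrow> complex vec" where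
  "mat_op n A = (\<lambda>v\<in>carrier_vec n. A *\<^sub>v v)"

definition unit_mat :: "nat \<Rightarrow> nat \<Rightarrow> nat \<Rightarrow> complex mat" where
  "unit_mat n i j = mat n n (\<lambda>(p, q). if p = i \<and> q = j then 1 else 0)"

text \<open>A graph is a symmetric digraph without loops, so that an edge contributes both ordered pairs
  to \<^term>\<open>parcs G\<close>. Vertices are \<open>0, \<dots>, n - 1\<close>, matching the row and column indices.\<close>

definition graph_mats :: "nat \<Rightarrow> nat pair_pre_digraph \<Rightarrow> complex mat set" where
  "graph_mats n G = LinearCombinations.module.span class_ring (module_mat TYPE(complex) n n)
     ({unit_mat n i j | i j. (i, j) \<in> parcs G} \<union> {unit_mat n i i | i. i < n})"

definition graph_op_system :: "nat \<Rightarrow> nat pair_pre_digraph \<Rightarrow> (complex vec \<Rightarrow> complex vec) set" where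
  "graph_op_system n G = mat_op n ` graph_mats n G"

end

theory Submission
  imports Defs
begin

text \<open>All components of \<open>G\<close> are complete iff adjacency-or-equality \<open>R\<close> is transitive.

  If it is, write a positive element of \<open>S\<^sub>G \<otimes>\<^sub>m\<^sub>i\<^sub>n T\<close> as \<open>X = \<Sum> E\<^sub>i\<^sub>j \<otimes> X\<^sub>i\<^sub>j\<close> over \<open>R\<close>. The block matrices
  \<open>P = (E\<^sub>i\<^sub>j)\<close> over \<open>R\<close> and \<open>Q = (X\<^sub>i\<^sub>j)\<close> are positive, and \<open>X = \<alpha> (P \<otimes> Q) \<alpha>\<^sup>*\<close> for a selection
  matrix \<open>\<alpha>\<close>.

  If it is not, \<open>G\<close> contains an induced path on \<open>v\<^sub>1, v\<^sub>2, v\<^sub>3\<close>. For \<open>T\<close> take the dual of the operator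
  system of that path, which acts on \<open>\<complex>\<^sup>4\<close>. The canonical tensor, twisted by the signs \<open>(1, -1, 1)\<close>,
  is positive in the minimal tensor product, while the functional of the identity map is positive
  on the maximal one and takes the value \<open>-1\<close> at it.\<close>

section \<open>Hilbert spaces\<close>

text \<open>A positive matrix over the path, with entries blown up to blocks of any size, is a sum
  of a positive matrix on v1, v2 and one on v2, v3. Dually, a functional on the path system is
  positive iff its two 2 by 2 blocks are, so the dual consists of pairs of 2 by 2 blocks that share
  the diagonal entry of v2. The sign matrix built from (1, -1, 1) has positive 2 by 2 blocks, and
  for the dual nothing but the blocks counts. The sum of its nine entries is (1 - 1 + 1)^2 = 1; the
  missing pair (v1, v3), (v3, v1) accounts for 2 of it, and 1 - 2 = -1 is left. The maximal cone is
  a closure, so the separation has to survive a small multiple of the unit; a strictly negative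
  value does. In the transitive case every element of the minimal cone, at every level, factors
  exactly, and no limit is taken. The space \<open>L\<close> is known only through the axioms of a
  tensor product, so it has to be identified with \<open>N\<close> copies of \<open>K\<close> before
  anything can be computed.\<close>

context complex_hilbert
begin

lemma minus_conv: "\<lbrakk>x \<in> carrier V; y \<in> carrier V\<rbrakk> \<Longrightarrow> x \<ominus> y = x \<oplus> (-1) \<odot> y"
  using smult_l_minus[of 1 y] smult_one[of y] by (simp add: a_minus_def class_ring_simps)

lemma scale_closed [simp, intro]: "x \<in> carrier V \<Longrightarrow> c \<odot> x \<in> carrier V"
  using smult_closed[of c x] by simp

lemma ip_add_right:
  "\<lbrakk>x \<in> carrier V; y \<in> carrier V; z \<in> carrier V\<rbrakk> \<Longrightarrow> ip V z (x \<oplus> y) = ip V z x + ip V z y"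
  using ip_cnj[of z "x \<oplus> y"] ip_cnj[of z x] ip_cnj[of z y]
    ip_cnj[of "x \<oplus> y" z] ip_add[of x y z] by simp

lemma ip_smult_right:
  "\<lbrakk>x \<in> carrier V; y \<in> carrier V\<rbrakk> \<Longrightarrow> ip V x (c \<odot> y) = cnj c * ip V x y"
  using ip_cnj[of "c \<odot> y" x] ip_smult[of y x c] ip_cnj[of y x] by simp

lemma zero_conv: "\<zero> = 0 \<odot> \<zero>"
  using smult_l_null[of \<zero>] by simp

lemma ip_zero_left [simp]: "x \<in> carrier V \<Longrightarrow> ip V \<zero> x = 0"
  using ip_smult[of \<zero> x 0] zero_conv by simp

lemma ip_zero_right [simp]: "x \<in> carrier V \<Longrightarrow> ip V x \<zero> = 0"
  using ip_smult_right[of x \<zero> 0] zero_conv by simp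

lemma ip_diff_left:
  "\<lbrakk>x \<in> carrier V; y \<in> carrier V; z \<in> carrier V\<rbrakk> \<Longrightarrow> ip V (x \<ominus> y) z = ip V x z - ip V y z"
  by (simp add: minus_conv ip_add ip_smult)

lemma ip_diff_right:
  "\<lbrakk>x \<in> carrier V; y \<in> carrier V; z \<in> carrier V\<rbrakk> \<Longrightarrow> ip V z (x \<ominus> y) = ip V z x - ip V z y"
  by (simp add: minus_conv ip_add_right ip_smult_right)

lemma ip_finsum_left:
  "\<lbrakk>f \<in> I \<rightarrow> carrier V; y \<in> carrier V\<rbrakk> \<Longrightarrow> ip V (\<Oplus>\<^bsub>V\<^esub>i\<in>I. f i) y = (\<Sum>i\<in>I. ip V (f i) y)"
proof (induction I rule: infinite_finite_induct)
  case (insert i I)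
  then show ?case by (subst finsum_insert) (auto simp: ip_add finsum_closed)
qed (auto simp: finsum_infinite)

lemma ip_finsum_right:
  "\<lbrakk>f \<in> I \<rightarrow> carrier V; y \<in> carrier V\<rbrakk> \<Longrightarrow> ip V y (\<Oplus>\<^bsub>V\<^esub>i\<in>I. f i) = (\<Sum>i\<in>I. ip V y (f i))"
proof (induction I rule: infinite_finite_induct)
  case (insert i I)
  then show ?case by (subst finsum_insert) (auto simp: ip_add_right finsum_closed)
qed (auto simp: finsum_infinite)

lemma ip_self_nonneg: "x \<in> carrier V \<Longrightarrow> 0 \<le> ip V x x"
  using ip_pos[of x] by (cases "x = \<zero>") (auto simp: less_le)

lemma ip_self: "x \<in> carrier V \<Longrightarrow> ip V x x = of_real ((vnorm V x)\<^sup>2)"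
  using ip_self_nonneg[of x] by (auto simp: vnorm_def less_eq_complex_def complex_eq_iff)

lemma vnorm_nonneg: "x \<in> carrier V \<Longrightarrow> 0 \<le> vnorm V x"
  using ip_self_nonneg[of x] by (auto simp: vnorm_def less_eq_complex_def)

lemma vnorm_sq: "x \<in> carrier V \<Longrightarrow> (vnorm V x)\<^sup>2 = Re (ip V x x)"
  by (simp add: ip_self)

lemma ip_self_eq_0: "x \<in> carrier V \<Longrightarrow> ip V x x = 0 \<longleftrightarrow> x = \<zero>"
  using ip_pos[of x] by (cases "x = \<zero>") auto

lemma vnorm_eq_0: "x \<in> carrier V \<Longrightarrow> vnorm V x = 0 \<longleftrightarrow> x = \<zero>"
  using ip_self_eq_0[of x] ip_self[of x] by simp

lemma vnorm_zero [simp]: "vnorm V \<zero> = 0"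
  by (simp add: vnorm_eq_0)

lemma minus_eq_zero: "\<lbrakk>x \<in> carrier V; y \<in> carrier V; x \<ominus> y = \<zero>\<rbrakk> \<Longrightarrow> x = y"
  by (metis M.minus_closed M.minus_equality M.minus_minus M.a_inv_closed M.minus_eq M.a_comm)

text \<open>Vector identities are proved by testing against all \<open>w\<close>: the simplifier
  then computes with complex numbers instead of module terms. \<open>bop_ext\<close> does the same
  for operators.\<close>

lemma ip_ext:
  assumes "x \<in> carrier V" "y \<in> carrier V" "\<And>w. w \<in> carrier V \<Longrightarrow> ip V x w = ip V y w"
  shows "x = y"
proof -
  have "ip V (x \<ominus> y) (x \<ominus> y) = 0"
    using assms by (simp add: ip_diff_left)
  then show ?thesis
    using assms(1,2) ip_self_eq_0[of "x \<ominus> y"] minus_eq_zero[of x y] by simp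
qed

lemma vnorm_smult: "x \<in> carrier V \<Longrightarrow> vnorm V (c \<odot> x) = cmod c * vnorm V x"
proof -
  assume x: "x \<in> carrier V"
  have "(vnorm V (c \<odot> x))\<^sup>2 = (cmod c * vnorm V x)\<^sup>2"
  proof -
    have "complex_of_real ((vnorm V (c \<odot> x))\<^sup>2) = c * cnj c * ip V x x"
      using x by (simp del: of_real_power add: ip_self[symmetric] ip_smult ip_smult_right)
    also have "\<dots> = of_real ((cmod c * vnorm V x)\<^sup>2)"
      using x by (simp add: ip_self complex_norm_square[symmetric] power_mult_distrib)
    finally show ?thesis by (simp only: of_real_eq_iff)
  qed
  then show ?thesis
    using x by (simp add: vnorm_nonneg power2_eq_iff_nonneg)
qed

lemma cauchy_schwarz:
  assumes x: "x \<in> carrier V" and y: "y \<in> carrier V"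
  shows "cmod (ip V x y) \<le> vnorm V x * vnorm V y"
proof (cases "y = \<zero>")
  case True
  then show ?thesis using x by simp
next
  case False
  then have n: "vnorm V y > 0"
    using vnorm_eq_0[OF y] vnorm_nonneg[OF y] by simp
  define c where "c = ip V x y / of_real ((vnorm V y)\<^sup>2)"
  let ?z = "x \<oplus> (- c) \<odot> y"
  have "ip V ?z ?z = ip V x x - cnj c * ip V x y - c * cnj (ip V x y) + c * cnj c * ip V y y"
    using x y ip_cnj[of x y] by (simp add: ip_add ip_add_right ip_smult ip_smult_right algebra_simps)
  also have "c * cnj c * ip V y y = c * cnj (ip V x y)"
    using n by (simp add: c_def ip_self[OF y] power2_eq_square)
  finally have "ip V ?z ?z = ip V x x - cnj c * ip V x y" by simp
  also have "cnj c * ip V x y = of_real ((cmod (ip V x y))\<^sup>2 / (vnorm V y)\<^sup>2)"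
    by (simp add: c_def complex_norm_square[symmetric] mult.commute)
  finally have "ip V ?z ?z = of_real ((vnorm V x)\<^sup>2 - (cmod (ip V x y))\<^sup>2 / (vnorm V y)\<^sup>2)"
    using x by (simp add: ip_self)
  moreover have "0 \<le> ip V ?z ?z" using x y by (intro ip_self_nonneg) auto
  ultimately have "(cmod (ip V x y))\<^sup>2 / (vnorm V y)\<^sup>2 \<le> (vnorm V x)\<^sup>2"
    by (simp add: less_eq_complex_def)
  then have "(cmod (ip V x y))\<^sup>2 \<le> (vnorm V x * vnorm V y)\<^sup>2"
    using n by (simp add: field_simps power_mult_distrib)
  then show ?thesis
    by (rule power2_le_imp_le) (simp add: vnorm_nonneg x y)
qed

lemma vnorm_add:
  assumes x: "x \<in> carrier V" and y: "y \<in> carrier V"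
  shows "vnorm V (x \<oplus> y) \<le> vnorm V x + vnorm V y"
proof (rule power2_le_imp_le)
  have "(vnorm V (x \<oplus> y))\<^sup>2 = (vnorm V x)\<^sup>2 + 2 * Re (ip V x y) + (vnorm V y)\<^sup>2"
    using x y ip_cnj[of x y] by (simp add: vnorm_sq ip_add ip_add_right)
  also have "\<dots> \<le> (vnorm V x)\<^sup>2 + 2 * (vnorm V x * vnorm V y) + (vnorm V y)\<^sup>2"
    using cauchy_schwarz[OF x y] complex_Re_le_cmod[of "ip V x y"] by simp
  finally show "(vnorm V (x \<oplus> y))\<^sup>2 \<le> (vnorm V x + vnorm V y)\<^sup>2"
    by (simp add: power2_sum)
qed (use vnorm_nonneg x y in auto)

lemma vnorm_finsum:
  "f \<in> I \<rightarrow> carrier V \<Longrightarrow> vnorm V (\<Oplus>\<^bsub>V\<^esub>i\<in>I. f i) \<le> (\<Sum>i\<in>I. vnorm V (f i))"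
proof (induction I rule: infinite_finite_induct)
  case (insert i I)
  then have *: "(\<Oplus>\<^bsub>V\<^esub>i\<in>insert i I. f i) = f i \<oplus> (\<Oplus>\<^bsub>V\<^esub>i\<in>I. f i)"
    by (subst finsum_insert) auto
  have "vnorm V (f i \<oplus> (\<Oplus>\<^bsub>V\<^esub>i\<in>I. f i)) \<le> vnorm V (f i) + vnorm V (\<Oplus>\<^bsub>V\<^esub>i\<in>I. f i)"
    using insert by (intro vnorm_add) auto
  with insert show ?case unfolding * by auto
qed (auto simp: finsum_infinite)

sublocale Metric_space "carrier V" "vdist V"
proof
  fix x y z
  show "0 \<le> vdist V x y" by (auto simp: vdist_def vnorm_nonneg)
  have sw: "vnorm V (x \<ominus> y) = vnorm V (y \<ominus> x)" if "x \<in> carrier V" "y \<in> carrier V" for x y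
    using that by (simp add: vnorm_def ip_diff_left ip_diff_right)
  show "vdist V x y = vdist V y x" by (auto simp: vdist_def sw)
  assume x: "x \<in> carrier V" and y: "y \<in> carrier V"
  show "vdist V x y = 0 \<longleftrightarrow> x = y"
    using x y minus_eq_zero by (auto simp: vdist_def vnorm_eq_0 M.r_neg a_minus_def)
  assume z: "z \<in> carrier V"
  have "x \<ominus> z = (x \<ominus> y) \<oplus> (y \<ominus> z)"
    using x y z by (intro ip_ext) (auto simp: ip_diff_left ip_add)
  then show "vdist V x z \<le> vdist V x y + vdist V y z"
    using x y z vnorm_add[of "x \<ominus> y" "y \<ominus> z"] by (auto simp: vdist_def)
qed

end

section \<open>Bounded operators\<close>

context complex_hilbert
begin

lemma carrier_bop: "carrier (bop V) = {f. bounded_op V f}"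
  by (simp add: bop_def)

lemma bop_closed: "\<lbrakk>f \<in> carrier (bop V); x \<in> carrier V\<rbrakk> \<Longrightarrow> f x \<in> carrier V"
  by (auto simp: carrier_bop bounded_op_def module_hom_def)

lemma bop_add:
  "\<lbrakk>f \<in> carrier (bop V); x \<in> carrier V; y \<in> carrier V\<rbrakk> \<Longrightarrow> f (x \<oplus> y) = f x \<oplus> f y"
  by (auto simp: carrier_bop bounded_op_def module_hom_def)

lemma bop_smult: "\<lbrakk>f \<in> carrier (bop V); x \<in> carrier V\<rbrakk> \<Longrightarrow> f (c \<odot> x) = c \<odot> f x"
  by (auto simp: carrier_bop bounded_op_def module_hom_def)

lemma bop_zero: "f \<in> carrier (bop V) \<Longrightarrow> f \<zero> = \<zero>"
  using bop_smult[of f \<zero> 0] zero_conv bop_closed[of f \<zero>] smult_l_null[of "f \<zero>"]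
  by simp

lemma bop_finsum:
  "\<lbrakk>f \<in> carrier (bop V); g \<in> I \<rightarrow> carrier V\<rbrakk> \<Longrightarrow> f (\<Oplus>\<^bsub>V\<^esub>i\<in>I. g i) = (\<Oplus>\<^bsub>V\<^esub>i\<in>I. f (g i))"
proof (induction I rule: infinite_finite_induct)
  case (insert i I)
  then have "(\<lambda>i. f (g i)) \<in> insert i I \<rightarrow> carrier V" by (auto intro: bop_closed)
  with insert show ?case by (auto simp: finsum_insert bop_add finsum_closed Pi_iff)
qed (auto simp: finsum_infinite bop_zero)

lemma bop_ext:
  assumes "f \<in> carrier (bop V)" "g \<in> carrier (bop V)"
    "\<And>x y. \<lbrakk>x \<in> carrier V; y \<in> carrier V\<rbrakk> \<Longrightarrow> ip V (f x) y = ip V (g x) y"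
  shows "f = g"
proof (rule extensionalityI)
  show "f \<in> extensional (carrier V)" "g \<in> extensional (carrier V)"
    using assms by (auto simp: carrier_bop bounded_op_def)
  show "f x = g x" if "x \<in> carrier V" for x
    using assms that by (intro ip_ext) (auto intro: bop_closed)
qed

lemma bopI:
  assumes "f \<in> extensional (carrier V)" "\<And>x. x \<in> carrier V \<Longrightarrow> f x \<in> carrier V"
    "\<And>x y. \<lbrakk>x \<in> carrier V; y \<in> carrier V\<rbrakk> \<Longrightarrow> f (x \<oplus> y) = f x \<oplus> f y"
    "\<And>c x. x \<in> carrier V \<Longrightarrow> f (c \<odot> x) = c \<odot> f x"
    "\<And>x. x \<in> carrier V \<Longrightarrow> vnorm V (f x) \<le> C * vnorm V x"
  shows "f \<in> carrier (bop V)"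
  using assms(1-4) exI[of "\<lambda>C. \<forall>x\<in>carrier V. vnorm V (f x) \<le> C * vnorm V x" C] assms(5)
  by (auto simp: carrier_bop bounded_op_def module_hom_def)

lemma bop_bound:
  assumes "f \<in> carrier (bop V)"
  obtains C where "C \<ge> 0" "\<And>x. x \<in> carrier V \<Longrightarrow> vnorm V (f x) \<le> C * vnorm V x"
proof -
  obtain C where C: "\<And>x. x \<in> carrier V \<Longrightarrow> vnorm V (f x) \<le> C * vnorm V x"
    using assms by (auto simp: carrier_bop bounded_op_def)
  \<comment> \<open>On the zero space a negative \<open>C\<close> also satisfies
    \<open>bounded_op\<close>; the absolute value makes the bound usable in monotonicity
    arguments.\<close>
  have "vnorm V (f x) \<le> \<bar>C\<bar> * vnorm V x" if "x \<in> carrier V" for x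
    using C[OF that] mult_right_mono[OF abs_ge_self vnorm_nonneg[OF that], of C]
    by (rule order_trans)
  then show ?thesis using that[of "\<bar>C\<bar>"] by simp
qed

lemma bop_add_app: "x \<in> carrier V \<Longrightarrow> (f \<oplus>\<^bsub>bop V\<^esub> g) x = f x \<oplus> g x"
  and bop_smult_app: "x \<in> carrier V \<Longrightarrow> (c \<odot>\<^bsub>bop V\<^esub> f) x = c \<odot> f x"
  and bop_zero_app: "x \<in> carrier V \<Longrightarrow> \<zero>\<^bsub>bop V\<^esub> x = \<zero>"
  and bop_one_app: "x \<in> carrier V \<Longrightarrow> \<one>\<^bsub>bop V\<^esub> x = x"
  by (auto simp: bop_def)

lemma bop_zero_closed: "\<zero>\<^bsub>bop V\<^esub> \<in> carrier (bop V)"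
  by (rule bopI[of _ 0]) (auto simp: bop_zero_app, auto simp: bop_def)

lemma bop_one_closed: "\<one>\<^bsub>bop V\<^esub> \<in> carrier (bop V)"
  by (rule bopI[of _ 1]) (auto simp: bop_one_app, auto simp: bop_def)

lemma bop_add_closed:
  assumes f: "f \<in> carrier (bop V)" and g: "g \<in> carrier (bop V)"
  shows "f \<oplus>\<^bsub>bop V\<^esub> g \<in> carrier (bop V)"
proof -
  obtain C D where C: "\<And>x. x \<in> carrier V \<Longrightarrow> vnorm V (f x) \<le> C * vnorm V x"
    and D: "\<And>x. x \<in> carrier V \<Longrightarrow> vnorm V (g x) \<le> D * vnorm V x"
    using bop_bound f g by metis
  show ?thesis
  proof (rule bopI[of _ "C + D"])
    show "f \<oplus>\<^bsub>bop V\<^esub> g \<in> extensional (carrier V)" by (auto simp: bop_def)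
    fix x assume x: "x \<in> carrier V"
    have "vnorm V (f x \<oplus> g x) \<le> vnorm V (f x) + vnorm V (g x)"
      using x f g by (simp add: vnorm_add bop_closed)
    then show "vnorm V ((f \<oplus>\<^bsub>bop V\<^esub> g) x) \<le> (C + D) * vnorm V x"
      using C[OF x] D[OF x] x by (simp add: bop_add_app algebra_simps)
  qed (use f g in \<open>auto simp: bop_add_app bop_closed bop_add bop_smult smult_r_distr
      M.a_ac\<close>)
qed

lemma bop_smult_closed:
  assumes f: "f \<in> carrier (bop V)"
  shows "c \<odot>\<^bsub>bop V\<^esub> f \<in> carrier (bop V)"
proof -
  obtain C where C: "\<And>x. x \<in> carrier V \<Longrightarrow> vnorm V (f x) \<le> C * vnorm V x"
    using bop_bound f by metis
  show ?thesis
  proof (rule bopI[of _ "cmod c * C"])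
    show "c \<odot>\<^bsub>bop V\<^esub> f \<in> extensional (carrier V)" by (auto simp: bop_def)
    fix x assume x: "x \<in> carrier V"
    then show "vnorm V ((c \<odot>\<^bsub>bop V\<^esub> f) x) \<le> cmod c * C * vnorm V x"
      using C[OF x] by (simp add: bop_smult_app vnorm_smult bop_closed f mult.assoc mult_left_mono)
    show "(c \<odot>\<^bsub>bop V\<^esub> f) (d \<odot> x) = d \<odot> (c \<odot>\<^bsub>bop V\<^esub> f) x" for d
      using x f by (intro ip_ext)
        (auto simp: bop_smult_app bop_closed bop_smult ip_smult)
  qed (use f in \<open>auto simp: bop_smult_app bop_closed bop_add smult_r_distr\<close>)
qed

lemma ip_bop:
  assumes "x \<in> carrier V" "y \<in> carrier V" "f \<in> carrier (bop V)"
  shows "g \<in> carrier (bop V) \<Longrightarrow> ip V ((f \<oplus>\<^bsub>bop V\<^esub> g) x) y = ip V (f x) y + ip V (g x) y"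
    and "ip V ((c \<odot>\<^bsub>bop V\<^esub> f) x) y = c * ip V (f x) y"
  using assms by (auto simp: bop_add_app bop_smult_app ip_add ip_smult bop_closed)

lemma vectorspace_bop: "vectorspace class_ring (bop V)"
proof (rule vs_criteria, goal_cases)
  case 1
  show ?case by (rule class_field)
next
  case 4
  show ?case
  proof
    fix f assume f: "f \<in> carrier (bop V)"
    show "\<exists>g\<in>carrier (bop V). f \<oplus>\<^bsub>bop V\<^esub> g = \<zero>\<^bsub>bop V\<^esub>"
    proof (rule bexI[of _ "(-1) \<odot>\<^bsub>bop V\<^esub> f"])
      show "f \<oplus>\<^bsub>bop V\<^esub> (-1) \<odot>\<^bsub>bop V\<^esub> f = \<zero>\<^bsub>bop V\<^esub>"
        using f by (intro bop_ext) (auto simp: bop_add_closed bop_smult_closed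
            bop_zero_closed bop_zero_app ip_bop)
    qed (simp add: f bop_smult_closed)
  qed
qed (auto simp: bop_zero_closed bop_add_closed bop_smult_closed bop_zero_app ip_bop algebra_simps
    intro!: bop_ext)

sublocale bop: vectorspace class_ring "bop V"
  by (rule vectorspace_bop)

lemma ip_bop_finsum:
  "\<lbrakk>f \<in> I \<rightarrow> carrier (bop V); x \<in> carrier V; y \<in> carrier V\<rbrakk>
    \<Longrightarrow> ip V ((\<Oplus>\<^bsub>bop V\<^esub>i\<in>I. f i) x) y = (\<Sum>i\<in>I. ip V (f i x) y)"
proof (induction I rule: infinite_finite_induct)
  case (insert i I)
  then show ?case by (simp add: bop.finsum_insert Pi_iff ip_bop bop.finsum_closed)
qed (auto simp: bop.finsum_infinite bop_zero_app)

end

section \<open>Coordinates in the tensor product of \<open>\<complex>\<^sup>N\<close> with a Hilbert space\<close>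

lemma cvec_space_simps [simp]:
  "carrier (cvec_space n) = carrier_vec n"
  "zero (cvec_space n) = 0\<^sub>v n"
  "add (cvec_space n) = (+)"
  "smult (cvec_space n) = (\<cdot>\<^sub>v)"
  "ip (cvec_space n) = (\<lambda>v w. v \<bullet>c w)"
  by (auto simp: cvec_space_def module.defs module_vec_def)

lemma cscalar_prod_sum:
  "\<lbrakk>x \<in> carrier_vec n; y \<in> carrier_vec n\<rbrakk> \<Longrightarrow> x \<bullet>c y = (\<Sum>i<n. x $ i * cnj (y $ i :: complex))"
  by (auto simp: scalar_prod_def atLeast0LessThan intro!: sum.cong)

lemma mat_op_apply: "x \<in> carrier_vec n \<Longrightarrow> mat_op n A x = A *\<^sub>v x"
  by (simp add: mat_op_def)

lemma mult_mat_vec_nth: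
  "\<lbrakk>A \<in> carrier_mat n n; x \<in> carrier_vec n; i < n\<rbrakk>
    \<Longrightarrow> (A *\<^sub>v x) $ i = (\<Sum>j<n. A $$ (i, j) * (x $ j :: complex))"
  by (auto simp: mult_mat_vec_def scalar_prod_def atLeast0LessThan intro!: sum.cong)

lemma if_mult: "(if b then x else 0) * y = (if b then x * y else 0)" for x y :: complex
  by simp

text \<open>Here \<open>L\<close> and \<open>\<tau>\<close> are any pair satisfying the axioms of a
  tensor product, not a chosen model; that \<open>L\<close> is a direct sum of \<open>N\<close>
  copies of \<open>K\<close> is derived below.\<close>

locale cvec_tensor = K: complex_hilbert K + L: complex_hilbert L
  for N :: nat and K :: "'v cinner_space" and L :: "'w cinner_space"
    and \<tau> :: "complex vec \<Rightarrow> 'v \<Rightarrow> 'w" +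
  assumes tensor: "hilbert_tensor (cvec_space N) K L \<tau>"
begin

lemma tau_closed [simp]: "\<lbrakk>x \<in> carrier_vec N; y \<in> carrier K\<rbrakk> \<Longrightarrow> \<tau> x y \<in> carrier L"
  and tau_add_right: "\<lbrakk>x \<in> carrier_vec N; y \<in> carrier K; y' \<in> carrier K\<rbrakk>
    \<Longrightarrow> \<tau> x (y \<oplus>\<^bsub>K\<^esub> y') = \<tau> x y \<oplus>\<^bsub>L\<^esub> \<tau> x y'"
  and tau_smult_right: "\<lbrakk>x \<in> carrier_vec N; y \<in> carrier K\<rbrakk> \<Longrightarrow> \<tau> x (c \<odot>\<^bsub>K\<^esub> y) = c \<odot>\<^bsub>L\<^esub> \<tau> x y"
  and ip_tau: "\<lbrakk>x \<in> carrier_vec N; x' \<in> carrier_vec N; y \<in> carrier K; y' \<in> carrier K\<rbrakk>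
    \<Longrightarrow> ip L (\<tau> x y) (\<tau> x' y') = (x \<bullet>c x') * ip K y y'"
  using tensor by (auto simp: hilbert_tensor_def module_hom_def)

text \<open>The isometric embedding of \<open>K\<close> as the i-th summand of \<open>L\<close>;
  \<open>comb\<close> below is the resulting map from N-tuples in \<open>K\<close> to
  \<open>L\<close>.\<close>

definition emb :: "nat \<Rightarrow> 'v \<Rightarrow> 'w" where
  "emb i y = \<tau> (unit_vec N i) y"

lemma emb_closed [simp]: "y \<in> carrier K \<Longrightarrow> emb i y \<in> carrier L"
  and emb_add: "\<lbrakk>y \<in> carrier K; y' \<in> carrier K\<rbrakk> \<Longrightarrow> emb i (y \<oplus>\<^bsub>K\<^esub> y') = emb i y \<oplus>\<^bsub>L\<^esub> emb i y'"
  and emb_smult: "y \<in> carrier K \<Longrightarrow> emb i (c \<odot>\<^bsub>K\<^esub> y) = c \<odot>\<^bsub>L\<^esub> emb i y"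
  by (auto simp: emb_def tau_add_right tau_smult_right)

lemma ip_tau_emb:
  assumes "x \<in> carrier_vec N" "y \<in> carrier K" "y' \<in> carrier K" "i < N"
  shows "ip L (\<tau> x y) (emb i y') = x $ i * ip K y y'"
proof -
  have "x \<bullet>c unit_vec N i = x $ i"
    using assms by (subst cscalar_prod_sum[of _ N])
      (auto simp: unit_vec_def if_distrib[of cnj] if_distrib[of "(*) _"] cong: if_cong)
  then show ?thesis using assms by (simp add: emb_def ip_tau)
qed

lemma ip_emb:
  assumes "y \<in> carrier K" "y' \<in> carrier K" "i < N" "j < N"
  shows "ip L (emb i y) (emb j y') = (if i = j then ip K y y' else 0)"
  using assms ip_tau_emb[of "unit_vec N i" y y' j] by (auto simp: emb_def[of i])

lemma vnorm_emb: "\<lbrakk>y \<in> carrier K; i < N\<rbrakk> \<Longrightarrow> vnorm L (emb i y) = vnorm K y"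
  by (simp add: vnorm_def ip_emb)

definition comb :: "(nat \<Rightarrow> 'v) \<Rightarrow> 'w" where
  "comb y = (\<Oplus>\<^bsub>L\<^esub>i\<in>{..<N}. emb i (y i))"

lemma comb_closed [simp]: "y \<in> {..<N} \<rightarrow> carrier K \<Longrightarrow> comb y \<in> carrier L"
  unfolding comb_def by (rule L.finsum_closed) (auto simp: Pi_iff)

lemma ip_comb_left:
  "\<lbrakk>y \<in> {..<N} \<rightarrow> carrier K; w \<in> carrier L\<rbrakk> \<Longrightarrow> ip L (comb y) w = (\<Sum>i<N. ip L (emb i (y i)) w)"
  unfolding comb_def by (rule L.ip_finsum_left) (auto simp: Pi_iff)

lemma ip_comb_right:
  "\<lbrakk>y \<in> {..<N} \<rightarrow> carrier K; w \<in> carrier L\<rbrakk> \<Longrightarrow> ip L w (comb y) = (\<Sum>i<N. ip L w (emb i (y i)))"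
  unfolding comb_def by (rule L.ip_finsum_right) (auto simp: Pi_iff)

lemma ip_comb_emb:
  assumes "y \<in> {..<N} \<rightarrow> carrier K" "y' \<in> carrier K" "i < N"
  shows "ip L (comb y) (emb i y') = ip K (y i) y'"
proof -
  have "ip L (comb y) (emb i y') = (\<Sum>k<N. if k = i then ip K (y k) y' else 0)"
    using assms by (subst ip_comb_left) (auto simp: ip_emb Pi_iff intro!: sum.cong)
  then show ?thesis using assms by simp
qed

lemma ip_comb:
  assumes "y \<in> {..<N} \<rightarrow> carrier K" "y' \<in> {..<N} \<rightarrow> carrier K"
  shows "ip L (comb y) (comb y') = (\<Sum>i<N. ip K (y i) (y' i))"
  using assms by (subst ip_comb_right) (auto simp: ip_comb_emb Pi_iff)

text \<open>All four inner products between the two sides coincide, so their difference has norm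
  zero. This avoids expanding \<open>x\<close> in unit vectors under \<open>\<tau>\<close>.\<close>

lemma tau_eq_comb:
  assumes x: "x \<in> carrier_vec N" and y: "y \<in> carrier K"
  shows "\<tau> x y = comb (\<lambda>i. x $ i \<odot>\<^bsub>K\<^esub> y)"
proof -
  let ?c = "comb (\<lambda>i. x $ i \<odot>\<^bsub>K\<^esub> y)"
  have c: "?c \<in> carrier L" using y by auto
  have s: "ip L (\<tau> x y) (\<tau> x y) = (\<Sum>i<N. x $ i * cnj (x $ i)) * ip K y y"
    using x y by (simp add: ip_tau cscalar_prod_sum[of _ N])
  have s1: "ip L (\<tau> x y) ?c = (\<Sum>i<N. x $ i * cnj (x $ i)) * ip K y y"
    using x y by (subst ip_comb_right) (auto simp: ip_tau_emb K.ip_smult_right sum_distrib_right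
        intro!: sum.cong)
  have s2: "ip L ?c (\<tau> x y) = (\<Sum>i<N. x $ i * cnj (x $ i)) * ip K y y"
    using L.ip_cnj[of "\<tau> x y" ?c] K.ip_cnj[of y y] x y c s1 by (simp add: mult.commute)
  have s3: "ip L ?c ?c = (\<Sum>i<N. x $ i * cnj (x $ i)) * ip K y y"
    using y by (subst ip_comb) (auto simp: K.ip_smult_right K.ip_smult sum_distrib_right
        intro!: sum.cong)
  have "ip L (\<tau> x y \<ominus>\<^bsub>L\<^esub> ?c) (\<tau> x y \<ominus>\<^bsub>L\<^esub> ?c) = 0"
    using x y c by (simp add: L.ip_diff_left L.ip_diff_right s s1 s2 s3)
  then show ?thesis
    using x y c L.ip_self_eq_0[of "\<tau> x y \<ominus>\<^bsub>L\<^esub> ?c"] L.minus_eq_zero[of "\<tau> x y" ?c] by simp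
qed

lemma comb_add:
  assumes "y \<in> {..<N} \<rightarrow> carrier K" "y' \<in> {..<N} \<rightarrow> carrier K"
  shows "comb y \<oplus>\<^bsub>L\<^esub> comb y' = comb (\<lambda>i. y i \<oplus>\<^bsub>K\<^esub> y' i)"
proof (rule L.ip_ext)
  have *: "(\<lambda>i. y i \<oplus>\<^bsub>K\<^esub> y' i) \<in> {..<N} \<rightarrow> carrier K" using assms by auto
  then show "comb (\<lambda>i. y i \<oplus>\<^bsub>K\<^esub> y' i) \<in> carrier L" by simp
  show "comb y \<oplus>\<^bsub>L\<^esub> comb y' \<in> carrier L" using assms by simp
  show "ip L (comb y \<oplus>\<^bsub>L\<^esub> comb y') w = ip L (comb (\<lambda>i. y i \<oplus>\<^bsub>K\<^esub> y' i)) w"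
    if "w \<in> carrier L" for w
    using assms * that
    by (simp add: L.ip_add ip_comb_left, subst sum.distrib[symmetric])
      (auto simp: L.ip_add emb_add Pi_iff intro!: sum.cong)
qed

lemma comb_smult:
  assumes "y \<in> {..<N} \<rightarrow> carrier K"
  shows "c \<odot>\<^bsub>L\<^esub> comb y = comb (\<lambda>i. c \<odot>\<^bsub>K\<^esub> y i)"
proof (rule L.ip_ext)
  have *: "(\<lambda>i. c \<odot>\<^bsub>K\<^esub> y i) \<in> {..<N} \<rightarrow> carrier K" using assms by auto
  then show "comb (\<lambda>i. c \<odot>\<^bsub>K\<^esub> y i) \<in> carrier L" by simp
  show "c \<odot>\<^bsub>L\<^esub> comb y \<in> carrier L" using assms by simp
  show "ip L (c \<odot>\<^bsub>L\<^esub> comb y) w = ip L (comb (\<lambda>i. c \<odot>\<^bsub>K\<^esub> y i)) w"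
    if "w \<in> carrier L" for w
    using assms * that
    by (auto simp: L.ip_smult ip_comb_left emb_smult Pi_iff sum_distrib_left intro!: sum.cong)
qed

text \<open>Together the two bounds say that convergence in \<open>L\<close> is convergence in each
  coordinate. The first makes the coordinates of a Cauchy sequence Cauchy, the second turns
  coordinatewise limits into limits in \<open>L\<close>.\<close>

lemma comb_vdist:
  assumes "y \<in> {..<N} \<rightarrow> carrier K" "y' \<in> {..<N} \<rightarrow> carrier K"
  shows "i < N \<Longrightarrow> vdist K (y i) (y' i) \<le> vdist L (comb y) (comb y')"
    and "vdist L (comb y) (comb y') \<le> (\<Sum>i<N. vdist K (y i) (y' i))"
proof -
  have m: "comb y \<ominus>\<^bsub>L\<^esub> comb y' = comb (\<lambda>i. y i \<ominus>\<^bsub>K\<^esub> y' i)"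
  proof -
    have "comb y \<ominus>\<^bsub>L\<^esub> comb y' = comb y \<oplus>\<^bsub>L\<^esub> (-1) \<odot>\<^bsub>L\<^esub> comb y'"
      using assms by (simp add: L.minus_conv)
    also have "\<dots> = comb (\<lambda>i. y i \<oplus>\<^bsub>K\<^esub> (-1) \<odot>\<^bsub>K\<^esub> y' i)"
      using assms by (subst comb_smult, simp, subst comb_add) (auto simp: Pi_iff)
    also have "\<dots> = comb (\<lambda>i. y i \<ominus>\<^bsub>K\<^esub> y' i)"
      unfolding comb_def using assms by (intro L.finsum_cong') (auto simp: K.minus_conv Pi_iff)
    finally show ?thesis .
  qed
  have d: "(\<lambda>i. y i \<ominus>\<^bsub>K\<^esub> y' i) \<in> {..<N} \<rightarrow> carrier K" using assms by auto
  have vd: "vdist K (y j) (y' j) = vnorm K (y j \<ominus>\<^bsub>K\<^esub> y' j)" if "j < N" for j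
    using assms that by (auto simp: vdist_def Pi_iff)
  have vl: "vdist L (comb y) (comb y') = vnorm L (comb (\<lambda>i. y i \<ominus>\<^bsub>K\<^esub> y' i))"
    using assms by (simp add: vdist_def m)
  show "vdist K (y i) (y' i) \<le> vdist L (comb y) (comb y')" if "i < N"
  proof -
    have "(vnorm L (comb (\<lambda>i. y i \<ominus>\<^bsub>K\<^esub> y' i)))\<^sup>2 = (\<Sum>j<N. (vnorm K (y j \<ominus>\<^bsub>K\<^esub> y' j))\<^sup>2)"
      using d assms by (simp add: L.vnorm_sq ip_comb) (simp add: Pi_iff K.vnorm_sq)
    also have "\<dots> \<ge> (vnorm K (y i \<ominus>\<^bsub>K\<^esub> y' i))\<^sup>2"
      using \<open>i < N\<close> by (intro member_le_sum) auto
    finally have "vnorm K (y i \<ominus>\<^bsub>K\<^esub> y' i) \<le> vnorm L (comb (\<lambda>i. y i \<ominus>\<^bsub>K\<^esub> y' i))"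
      by (rule power2_le_imp_le) (simp add: L.vnorm_nonneg d)
    then show ?thesis using assms that by (simp add: vl vd)
  qed
  show "vdist L (comb y) (comb y') \<le> (\<Sum>i<N. vdist K (y i) (y' i))"
  proof -
    have "vnorm L (comb (\<lambda>i. y i \<ominus>\<^bsub>K\<^esub> y' i)) \<le> (\<Sum>i<N. vnorm L (emb i (y i \<ominus>\<^bsub>K\<^esub> y' i)))"
      unfolding comb_def using d by (intro L.vnorm_finsum) (auto simp: Pi_iff)
    also have "\<dots> = (\<Sum>i<N. vdist K (y i) (y' i))"
      using d by (auto simp: vd vnorm_emb Pi_iff intro!: sum.cong)
    finally show ?thesis by (simp add: vl)
  qed
qed

text \<open>The range of \<open>comb\<close> is a submodule containing the elementary tensors, hence
  dense. It is also closed, because \<open>K\<close> is complete and there are finitely many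
  coordinates.\<close>

lemma L_eq_comb:
  assumes z: "z \<in> carrier L"
  obtains y where "y \<in> {..<N} \<rightarrow> carrier K" "z = comb y"
proof -
  let ?M = "comb ` ({..<N} \<rightarrow> carrier K)"
  have "LinearCombinations.submodule class_ring ?M L"
  proof
    show "\<zero>\<^bsub>L\<^esub> \<in> ?M"
    proof (rule image_eqI[of _ _ "\<lambda>i. \<zero>\<^bsub>K\<^esub>"])
      have "comb (\<lambda>i. \<zero>\<^bsub>K\<^esub>) = 0 \<odot>\<^bsub>L\<^esub> comb (\<lambda>i. \<zero>\<^bsub>K\<^esub>)"
        by (subst comb_smult) (auto simp: K.zero_conv[symmetric])
      then show "\<zero>\<^bsub>L\<^esub> = comb (\<lambda>i. \<zero>\<^bsub>K\<^esub>)"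
        using L.smult_l_null[of "comb (\<lambda>i. \<zero>\<^bsub>K\<^esub>)"] by simp
    qed auto
    show "v \<oplus>\<^bsub>L\<^esub> w \<in> ?M" if vw: "v \<in> ?M" "w \<in> ?M" for v w
    proof -
      obtain y y' where "v = comb y" "y \<in> {..<N} \<rightarrow> carrier K" "w = comb y'" "y' \<in> {..<N} \<rightarrow> carrier K"
        using vw by auto
      then show ?thesis
        by (intro image_eqI[of _ _ "\<lambda>i. y i \<oplus>\<^bsub>K\<^esub> y' i"]) (auto simp: comb_add)
    qed
    show "c \<odot>\<^bsub>L\<^esub> v \<in> ?M" if v: "v \<in> ?M" for c v
    proof -
      obtain y where "v = comb y" "y \<in> {..<N} \<rightarrow> carrier K"
        using v by auto
      then show ?thesis
        by (intro image_eqI[of _ _ "\<lambda>i. c \<odot>\<^bsub>K\<^esub> y i"]) (auto simp: comb_smult)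
    qed
  qed auto
  moreover have "{\<tau> x y |x y. x \<in> carrier (cvec_space N) \<and> y \<in> carrier K} \<subseteq> ?M"
    by (auto simp: tau_eq_comb)
  ultimately have "L.span {\<tau> x y |x y. x \<in> carrier (cvec_space N) \<and> y \<in> carrier K} \<subseteq> ?M"
    by (intro L.span_is_subset)
  from closure_of_mono[OF this, of L.mtopology]
  have "carrier L \<subseteq> L.mtopology closure_of ?M"
    using tensor unfolding hilbert_tensor_def by simp
  then have cl: "L.mtopology closure_of ?M = carrier L"
    using closure_of_subset_topspace[of L.mtopology ?M] by (simp add: subset_antisym)
  \<comment> \<open>The radii 1/(n+1) produce a sequence in the range of \<open>comb\<close> that
    converges to \<open>z\<close>.\<close>
  have "\<exists>y. y \<in> {..<N} \<rightarrow> carrier K \<and> vdist L z (comb y) < inverse (Suc n)" for n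
  proof -
    have "z \<in> L.mtopology closure_of ?M" using z cl by simp
    then have "\<exists>w\<in>?M. w \<in> L.mball z (inverse (Suc n))"
      unfolding L.metric_closure_of by (simp del: of_nat_Suc)
    then show ?thesis by auto
  qed
  then obtain Y where Y: "\<And>n. Y n \<in> {..<N} \<rightarrow> carrier K"
    and Yz: "\<And>n. vdist L z (comb (Y n)) < inverse (Suc n)"
    by metis
  have lim: "limitin L.mtopology (\<lambda>n. comb (Y n)) z sequentially"
    unfolding L.limitin_metric
  proof (intro conjI strip)
    fix e :: real assume "e > 0"
    then obtain n0 where n0: "inverse (Suc n0) < e" using reals_Archimedean by blast
    have "vdist L (comb (Y n)) z < e" if "n \<ge> n0" for n
    proof -
      have "inverse (real (Suc n)) \<le> inverse (Suc n0)" using that by simp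
      then show ?thesis
        using Yz[of n] n0 unfolding L.commute[of "comb (Y n)"] by linarith
    qed
    then show "\<forall>\<^sub>F n in sequentially. comb (Y n) \<in> carrier L \<and> vdist L (comb (Y n)) z < e"
      using Y by (auto simp: eventually_sequentially)
  qed (rule z)
  then have cau: "L.MCauchy (\<lambda>n. comb (Y n))"
    using Y by (intro L.convergent_imp_MCauchy[OF _ lim]) auto
  have "\<exists>l. limitin K.mtopology (\<lambda>n. Y n i) l sequentially" if i: "i < N" for i
  proof -
    have "K.MCauchy (\<lambda>n. Y n i)"
      unfolding K.MCauchy_def
    proof (intro conjI strip)
      show "range (\<lambda>n. Y n i) \<subseteq> carrier K" using Y i by auto
      fix e :: real assume "e > 0"
      then obtain n0 where "\<And>n n'. n0 \<le> n \<Longrightarrow> n0 \<le> n' \<Longrightarrow> vdist L (comb (Y n)) (comb (Y n')) < e"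
        using cau unfolding L.MCauchy_def by meson
      then show "\<exists>n0. \<forall>n n'. n0 \<le> n \<longrightarrow> n0 \<le> n' \<longrightarrow> vdist K (Y n i) (Y n' i) < e"
        using comb_vdist(1)[OF Y Y i] by (meson le_less_trans)
    qed
    then show ?thesis using K.complete unfolding K.mcomplete_def by blast
  qed
  then obtain l where l: "\<And>i. i < N \<Longrightarrow> limitin K.mtopology (\<lambda>n. Y n i) (l i) sequentially"
    by metis
  have lc: "l \<in> {..<N} \<rightarrow> carrier K"
    using l unfolding K.limitin_metric by auto
  have "limitin L.mtopology (\<lambda>n. comb (Y n)) (comb l) sequentially"
    unfolding L.limitin_metric_dist_null
  proof (intro conjI)
    have "((\<lambda>n. vdist K (Y n i) (l i)) \<longlongrightarrow> 0) sequentially" if "i < N" for i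
      using l[OF that] unfolding K.limitin_metric_dist_null by blast
    then have "((\<lambda>n. \<Sum>i<N. vdist K (Y n i) (l i)) \<longlongrightarrow> (\<Sum>i<N. 0)) sequentially"
      by (intro tendsto_sum) auto
    then have "((\<lambda>n. \<Sum>i<N. vdist K (Y n i) (l i)) \<longlongrightarrow> 0) sequentially" by simp
    then show "((\<lambda>n. vdist L (comb (Y n)) (comb l)) \<longlongrightarrow> 0) sequentially"
      by (rule Lim_null_comparison[rotated]) (use comb_vdist(2)[OF Y lc] in auto)
  qed (use Y lc in auto)
  then have "z = comb l"
    using lim by (intro L.limitin_metric_unique) auto
  then show ?thesis using lc that by blast
qed

text \<open>The choice is unique at indices below \<open>N\<close>, by \<open>crd_comb\<close>;
  \<open>comb\<close> does not look at the others.\<close>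

definition crd :: "'w \<Rightarrow> nat \<Rightarrow> 'v" where
  "crd z = (SOME y. y \<in> {..<N} \<rightarrow> carrier K \<and> z = comb y)"

lemma crd:
  assumes "z \<in> carrier L"
  shows crd_fun: "crd z \<in> {..<N} \<rightarrow> carrier K" and comb_crd: "comb (crd z) = z"
proof -
  have "\<exists>y. y \<in> {..<N} \<rightarrow> carrier K \<and> z = comb y"
    by (rule L_eq_comb[OF assms]) blast
  then have "crd z \<in> {..<N} \<rightarrow> carrier K \<and> z = comb (crd z)"
    unfolding crd_def by (rule someI_ex)
  then show "crd z \<in> {..<N} \<rightarrow> carrier K" "comb (crd z) = z" by auto
qed

lemma crd_closed [simp]: "\<lbrakk>z \<in> carrier L; i < N\<rbrakk> \<Longrightarrow> crd z i \<in> carrier K"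
  using crd_fun by auto

lemma ip_crd:
  "\<lbrakk>z \<in> carrier L; i < N; y \<in> carrier K\<rbrakk> \<Longrightarrow> ip K (crd z i) y = ip L z (emb i y)"
  using ip_comb_emb[of "crd z" y i] crd by simp

lemma ip_emb_left:
  "\<lbrakk>z \<in> carrier L; i < N; y \<in> carrier K\<rbrakk> \<Longrightarrow> ip L (emb i y) z = ip K y (crd z i)"
  using ip_crd[of z i y] L.ip_cnj[of z "emb i y"] K.ip_cnj[of "crd z i" y] by simp

lemma ip_L: "\<lbrakk>z \<in> carrier L; w \<in> carrier L\<rbrakk> \<Longrightarrow> ip L z w = (\<Sum>i<N. ip K (crd z i) (crd w i))"
  using ip_comb[of "crd z" "crd w"] crd by simp

lemma crd_comb: "\<lbrakk>y \<in> {..<N} \<rightarrow> carrier K; i < N\<rbrakk> \<Longrightarrow> crd (comb y) i = y i"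
  by (rule K.ip_ext) (auto simp: ip_crd ip_comb_emb)

lemma crd_tau: "\<lbrakk>x \<in> carrier_vec N; y \<in> carrier K; i < N\<rbrakk> \<Longrightarrow> crd (\<tau> x y) i = x $ i \<odot>\<^bsub>K\<^esub> y"
  by (simp add: tau_eq_comb crd_comb)

lemma crd_emb: "\<lbrakk>y \<in> carrier K; i < N; j < N\<rbrakk> \<Longrightarrow> crd (emb i y) j = (if j = i then y else \<zero>\<^bsub>K\<^esub>)"
  by (rule K.ip_ext) (auto simp: ip_crd ip_emb)

lemma crd_add:
  "\<lbrakk>z \<in> carrier L; w \<in> carrier L; i < N\<rbrakk> \<Longrightarrow> crd (z \<oplus>\<^bsub>L\<^esub> w) i = crd z i \<oplus>\<^bsub>K\<^esub> crd w i"
  by (rule K.ip_ext) (auto simp: ip_crd L.ip_add K.ip_add)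

lemma crd_smult: "\<lbrakk>z \<in> carrier L; i < N\<rbrakk> \<Longrightarrow> crd (c \<odot>\<^bsub>L\<^esub> z) i = c \<odot>\<^bsub>K\<^esub> crd z i"
  by (rule K.ip_ext) (auto simp: ip_crd L.ip_smult K.ip_smult)

lemma vnorm_crd: "\<lbrakk>z \<in> carrier L; i < N\<rbrakk> \<Longrightarrow> vnorm K (crd z i) \<le> vnorm L z"
proof (rule power2_le_imp_le)
  assume z: "z \<in> carrier L" and i: "i < N"
  have "(vnorm L z)\<^sup>2 = (\<Sum>j<N. (vnorm K (crd z j))\<^sup>2)"
    using z by (simp add: L.vnorm_sq ip_L K.vnorm_sq)
  also have "\<dots> \<ge> (vnorm K (crd z i))\<^sup>2" using i by (intro member_le_sum) auto
  finally show "(vnorm K (crd z i))\<^sup>2 \<le> (vnorm L z)\<^sup>2" .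
qed (simp add: L.vnorm_nonneg)

text \<open>The block operator with blocks \<open>A $$ (i, j)\<close> times \<open>t\<close>. It
  supplies the existence behind the definite description in \<open>op_tensor\<close>; from then on
  elementary tensors of operators are handled through the form in \<open>ip_tens\<close>.\<close>

definition tens :: "complex mat \<Rightarrow> ('v \<Rightarrow> 'v) \<Rightarrow> 'w \<Rightarrow> 'w" where
  "tens A t = (\<lambda>z\<in>carrier L. comb (\<lambda>i. \<Oplus>\<^bsub>K\<^esub>j\<in>{..<N}. A $$ (i, j) \<odot>\<^bsub>K\<^esub> t (crd z j)))"

lemma ip_tens:
  assumes t: "t \<in> carrier (bop K)" and z: "z \<in> carrier L" and w: "w \<in> carrier L"
  shows "ip L (tens A t z) w = (\<Sum>i<N. \<Sum>j<N. A $$ (i, j) * ip K (t (crd z j)) (crd w i))"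
proof -
  have 1: "(\<Oplus>\<^bsub>K\<^esub>j\<in>{..<N}. A $$ (i, j) \<odot>\<^bsub>K\<^esub> t (crd z j)) \<in> carrier K" for i
    using t z by (auto intro!: K.finsum_closed simp: K.bop_closed)
  have 2: "ip K (\<Oplus>\<^bsub>K\<^esub>j\<in>{..<N}. A $$ (i, j) \<odot>\<^bsub>K\<^esub> t (crd z j)) (crd w i)
    = (\<Sum>j<N. A $$ (i, j) * ip K (t (crd z j)) (crd w i))" if "i < N" for i
    using that t z w by (subst K.ip_finsum_left) (auto simp: K.bop_closed K.ip_smult)
  show ?thesis
    using z w 1 by (simp add: tens_def ip_comb_left ip_emb_left 2)
qed

lemma ip_tens_unit:
  assumes t: "t \<in> carrier (bop K)" and z: "z \<in> carrier L" and w: "w \<in> carrier L" and ij: "i < N" "j < N"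
  shows "ip L (tens (unit_mat N i j) t z) w = ip K (t (crd z j)) (crd w i)"
proof -
  have "(\<Sum>i'<N. \<Sum>j'<N. unit_mat N i j $$ (i', j') * ip K (t (crd z j')) (crd w i'))
    = (\<Sum>i'<N. if i' = i then \<Sum>j'<N. if j' = j then ip K (t (crd z j')) (crd w i') else 0 else 0)"
    using ij by (intro sum.cong refl) (auto simp: unit_mat_def if_mult)
  then show ?thesis using assms by (simp add: ip_tens)
qed

lemma ip_tens_emb:
  assumes t: "t \<in> carrier (bop K)" and y: "y \<in> carrier K" "y' \<in> carrier K" and ij: "i < N" "j < N"
  shows "ip L (tens A t (emb j y)) (emb i y') = A $$ (i, j) * ip K (t y) y'"
proof -
  have "(\<Sum>i'<N. \<Sum>j'<N. A $$ (i', j') * ip K (t (crd (emb j y) j')) (crd (emb i y') i'))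
    = (\<Sum>i'<N. \<Sum>j'<N. if j' = j then if i' = i then A $$ (i', j') * ip K (t y) y' else 0 else 0)"
    using ij y t by (intro sum.cong refl) (auto simp: crd_emb K.bop_zero K.bop_closed)
  then show ?thesis using assms by (simp add: ip_tens del: sum.delta) simp
qed

lemma tens_app_closed:
  assumes t: "t \<in> carrier (bop K)" and z: "z \<in> carrier L"
  shows "tens A t z \<in> carrier L"
  using t z by (auto simp: tens_def K.bop_closed intro!: comb_closed K.finsum_closed)

lemma tens_closed:
  assumes t: "t \<in> carrier (bop K)"
  shows "tens A t \<in> carrier (bop L)"
proof -
  obtain C where C: "C \<ge> 0" "\<And>y. y \<in> carrier K \<Longrightarrow> vnorm K (t y) \<le> C * vnorm K y"
    using K.bop_bound[OF t] by metis
  show ?thesis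
  proof (rule L.bopI)
    show "tens A t \<in> extensional (carrier L)" by (simp add: tens_def)
    fix x assume x: "x \<in> carrier L"
    show "tens A t x \<in> carrier L" using t x by (rule tens_app_closed)
    show "tens A t (x \<oplus>\<^bsub>L\<^esub> y) = tens A t x \<oplus>\<^bsub>L\<^esub> tens A t y" if y: "y \<in> carrier L" for y
    proof (rule L.ip_ext)
      fix w assume w: "w \<in> carrier L"
      show "ip L (tens A t (x \<oplus>\<^bsub>L\<^esub> y)) w = ip L (tens A t x \<oplus>\<^bsub>L\<^esub> tens A t y) w"
        using x y w t
        by (simp add: L.ip_add tens_app_closed ip_tens crd_add K.bop_add K.ip_add K.bop_closed
            distrib_left sum.distrib)
    qed (use x y t in \<open>auto simp: tens_app_closed\<close>)
    show "tens A t (c \<odot>\<^bsub>L\<^esub> x) = c \<odot>\<^bsub>L\<^esub> tens A t x" for c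
    proof (rule L.ip_ext)
      fix w assume w: "w \<in> carrier L"
      show "ip L (tens A t (c \<odot>\<^bsub>L\<^esub> x)) w = ip L (c \<odot>\<^bsub>L\<^esub> tens A t x) w"
        using x w t
        by (simp add: L.ip_smult tens_app_closed ip_tens crd_smult K.bop_smult K.ip_smult K.bop_closed
            sum_distrib_left mult.left_commute)
    qed (use x t in \<open>auto simp: tens_app_closed\<close>)
    have i: "(\<Oplus>\<^bsub>K\<^esub>j\<in>{..<N}. A $$ (i, j) \<odot>\<^bsub>K\<^esub> t (crd x j)) \<in> carrier K" for i
      using t x by (auto intro!: K.finsum_closed simp: K.bop_closed)
    have "vnorm L (tens A t x)
      \<le> (\<Sum>i<N. vnorm L (emb i (\<Oplus>\<^bsub>K\<^esub>j\<in>{..<N}. A $$ (i, j) \<odot>\<^bsub>K\<^esub> t (crd x j))))"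
      using x i by (auto simp: tens_def comb_def intro!: L.vnorm_finsum)
    also have "\<dots> = (\<Sum>i<N. vnorm K (\<Oplus>\<^bsub>K\<^esub>j\<in>{..<N}. A $$ (i, j) \<odot>\<^bsub>K\<^esub> t (crd x j)))"
      using i by (simp add: vnorm_emb)
    also have "\<dots> \<le> (\<Sum>i<N. \<Sum>j<N. vnorm K (A $$ (i, j) \<odot>\<^bsub>K\<^esub> t (crd x j)))"
      using t x by (intro sum_mono K.vnorm_finsum) (auto simp: K.bop_closed)
    also have "\<dots> \<le> (\<Sum>i<N. \<Sum>j<N. cmod (A $$ (i, j)) * (C * vnorm L x))"
    proof (intro sum_mono)
      fix i j assume "i \<in> {..<N}" and j: "j \<in> {..<N}"
      have "vnorm K (t (crd x j)) \<le> C * vnorm K (crd x j)" using C x j by simp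
      also have "\<dots> \<le> C * vnorm L x" using C x j by (simp add: vnorm_crd mult_left_mono)
      finally show "vnorm K (A $$ (i, j) \<odot>\<^bsub>K\<^esub> t (crd x j)) \<le> cmod (A $$ (i, j)) * (C * vnorm L x)"
        using t x j by (simp add: K.vnorm_smult K.bop_closed mult_left_mono)
    qed
    also have "\<dots> = (\<Sum>i<N. \<Sum>j<N. cmod (A $$ (i, j)) * C) * vnorm L x"
      by (simp add: sum_distrib_right mult.assoc)
    finally show "vnorm L (tens A t x) \<le> (\<Sum>i<N. \<Sum>j<N. cmod (A $$ (i, j)) * C) * vnorm L x" .
  qed
qed

lemma tens_tau:
  assumes A: "A \<in> carrier_mat N N" and t: "t \<in> carrier (bop K)"
    and x: "x \<in> carrier_vec N" and y: "y \<in> carrier K"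
  shows "tens A t (\<tau> x y) = \<tau> (A *\<^sub>v x) (t y)"
proof (rule L.ip_ext)
  have Ax: "A *\<^sub>v x \<in> carrier_vec N" using A x by simp
  fix w assume w: "w \<in> carrier L"
  have "ip L (\<tau> (A *\<^sub>v x) (t y)) w = (\<Sum>i<N. (A *\<^sub>v x) $ i * ip K (t y) (crd w i))"
    using Ax y w t by (simp add: ip_L crd_tau K.bop_closed K.ip_smult)
  also have "\<dots> = (\<Sum>i<N. \<Sum>j<N. A $$ (i, j) * (x $ j * ip K (t y) (crd w i)))"
    using A x by (simp add: mult_mat_vec_nth sum_distrib_right mult.assoc del: index_mult_mat_vec)
  also have "\<dots> = ip L (tens A t (\<tau> x y)) w"
    using x y w t by (simp add: ip_tens crd_tau K.bop_smult K.ip_smult K.bop_closed)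
  finally show "ip L (tens A t (\<tau> x y)) w = ip L (\<tau> (A *\<^sub>v x) (t y)) w" by simp
qed (use A t x y in \<open>auto simp: tens_app_closed K.bop_closed\<close>)

text \<open>Every vector of \<open>L\<close> is a finite sum of elementary tensors
  \<open>emb i y\<close>, so agreement on elementary tensors spreads by additivity alone. This is
  the uniqueness half of \<open>op_tensor_eq\<close>.\<close>

lemma bop_L_eqI:
  assumes f: "f \<in> carrier (bop L)" and g: "g \<in> carrier (bop L)"
    and eq: "\<And>x y. \<lbrakk>x \<in> carrier_vec N; y \<in> carrier K\<rbrakk> \<Longrightarrow> f (\<tau> x y) = g (\<tau> x y)"
  shows "f = g"
proof (rule L.bop_ext[OF f g])
  fix z w assume z: "z \<in> carrier L" and w: "w \<in> carrier L"
  have e: "(\<lambda>i. emb i (crd z i)) \<in> {..<N} \<rightarrow> carrier L" using z by simp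
  have "f (emb i (crd z i)) = g (emb i (crd z i))" if "i < N" for i
    using eq z that by (simp add: emb_def)
  then have "(\<Oplus>\<^bsub>L\<^esub>i\<in>{..<N}. f (emb i (crd z i))) = (\<Oplus>\<^bsub>L\<^esub>i\<in>{..<N}. g (emb i (crd z i)))"
    using e f g z by (intro L.finsum_cong') (auto simp: L.bop_closed)
  then have "f (comb (crd z)) = g (comb (crd z))"
    unfolding comb_def using e f g by (simp add: L.bop_finsum)
  then show "ip L (f z) w = ip L (g z) w" using z by (simp add: comb_crd)
qed

lemma op_tensor_eq:
  assumes A: "A \<in> carrier_mat N N" and t: "t \<in> carrier (bop K)"
  shows "op_tensor (cvec_space N) K L \<tau> (mat_op N A) t = tens A t"
  unfolding op_tensor_def
proof (rule the_equality)
  show "tens A t \<in> carrier (bop L) \<and> (\<forall>x\<in>carrier (cvec_space N). \<forall>y\<in>carrier K.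
      tens A t (\<tau> x y) = \<tau> (mat_op N A x) (t y))"
    using A t by (auto simp: tens_closed tens_tau mat_op_apply)
next
  fix f assume "f \<in> carrier (bop L) \<and> (\<forall>x\<in>carrier (cvec_space N). \<forall>y\<in>carrier K.
      f (\<tau> x y) = \<tau> (mat_op N A x) (t y))"
  then show "f = tens A t"
    using A t by (intro bop_L_eqI) (auto simp: tens_closed tens_tau mat_op_apply)
qed

end

section \<open>Positive semidefinite kernels\<close>

text \<open>Kernels on arbitrary index sets instead of matrices: the indices will be pairs of a
  matrix position and a vertex, and blocks are addressed by the vertex. The order of factors follows
  \<open>pos_op_mat\<close>.\<close>

definition psd :: "'i set \<Rightarrow> ('i \<Rightarrow> 'i \<Rightarrow> complex) \<Rightarrow> bool" where
  "psd J M \<longleftrightarrow> (\<forall>c. 0 \<le> (\<Sum>x\<in>J. \<Sum>y\<in>J. M x y * c y * cnj (c x)))"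

lemma psdD: "psd J M \<Longrightarrow> 0 \<le> (\<Sum>x\<in>J. \<Sum>y\<in>J. M x y * c y * cnj (c x))"
  by (simp add: psd_def)

lemma psd_subset:
  assumes "psd J M" "I \<subseteq> J" "finite J"
  shows "psd I M"
  unfolding psd_def
proof
  fix c :: "_ \<Rightarrow> complex"
  let ?c = "\<lambda>x. if x \<in> I then c x else 0"
  have "(\<Sum>x\<in>I. \<Sum>y\<in>I. M x y * c y * cnj (c x)) = (\<Sum>x\<in>I. \<Sum>y\<in>J. M x y * ?c y * cnj (?c x))"
    using assms by (intro sum.cong[OF refl] sum.mono_neutral_cong_left) auto
  also have "\<dots> = (\<Sum>x\<in>J. \<Sum>y\<in>J. M x y * ?c y * cnj (?c x))"
    using assms by (intro sum.mono_neutral_left) auto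
  also have "0 \<le> \<dots>" by (rule psdD[OF assms(1)])
  finally show "0 \<le> (\<Sum>x\<in>I. \<Sum>y\<in>I. M x y * c y * cnj (c x))" .
qed

lemma psd_diag:
  assumes "psd J M" "finite J" "x \<in> J"
  shows "0 \<le> M x x"
proof -
  have "psd {x} M" by (rule psd_subset[OF assms(1)]) (use assms in auto)
  from psdD[OF this, of "\<lambda>_. 1"] show ?thesis by simp
qed

lemma psd_pair:
  assumes "psd J M" "finite J" "x \<in> J" "y \<in> J" "x \<noteq> y"
  shows "0 \<le> M x x * a * cnj a + M x y * b * cnj a + M y x * a * cnj b + M y y * b * cnj b"
proof -
  have "psd {x, y} M" by (rule psd_subset[OF assms(1)]) (use assms in auto)
  from psdD[OF this, of "\<lambda>z. if z = x then a else b"] show ?thesis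
    using assms(5) by (simp add: add_ac)
qed

text \<open>Polarisation: the test vectors (1, 1) and (1, i) force the imaginary parts to cancel and
  the real parts to agree.\<close>

lemma psd_hermitian:
  assumes "psd J M" "finite J" "x \<in> J" "y \<in> J"
  shows "M y x = cnj (M x y)"
proof (cases "x = y")
  case True
  then show ?thesis using psd_diag[OF assms(1-3)] by (auto simp: complex_eq_iff less_eq_complex_def)
next
  case False
  have d: "Im (M x x) = 0" "Im (M y y) = 0"
    using psd_diag[OF assms(1-3)] psd_diag[OF assms(1,2,4)] by (auto simp: less_eq_complex_def)
  show ?thesis
    using psd_pair[OF assms False, of 1 1] psd_pair[OF assms False, of 1 \<i>] d
    by (simp add: less_eq_complex_def complex_eq_iff)
qed

text \<open>With a zero at \<open>a\<close>, the form at 1 on \<open>x\<close> and -t times the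
  conjugate of \<open>M x a\<close> on \<open>a\<close> is affine in \<open>t\<close> with slope -2
  |M x a|^2. It stays nonnegative for all real \<open>t\<close> only if the slope is zero.\<close>

lemma psd_diag_zero:
  assumes "psd J M" "finite J" "x \<in> J" "a \<in> J" "M a a = 0"
  shows "M x a = 0"
proof (cases "x = a")
  case False
  define n where "n = (cmod (M x a))\<^sup>2"
  have n: "M x a * cnj (M x a) = of_real n"
    by (simp only: n_def complex_norm_square)
  have *: "0 \<le> Re (M x x) - 2 * t * n" for t :: real
  proof -
    have "0 \<le> M x x - of_real t * (M x a * cnj (M x a)) - of_real t * (M x a * cnj (M x a))"
      using psd_pair[OF assms(1-4) False, of 1 "- of_real t * cnj (M x a)"]
        psd_hermitian[OF assms(1-4)] assms(5) by (simp add: algebra_simps)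
    then show ?thesis unfolding n by (simp add: less_eq_complex_def algebra_simps)
  qed
  have "n = 0"
  proof (rule ccontr)
    assume "n \<noteq> 0"
    \<comment> \<open>This \<open>t\<close> gives the affine function the value -1.\<close>
    then show False using *[of "(Re (M x x) + 1) / (2 * n)"] by simp
  qed
  then show ?thesis by (simp add: n_def)
qed (use assms in simp)

text \<open>Completing the square: the form of the Schur complement at \<open>c\<close> is the form
  of \<open>M\<close> at the vector obtained by adding \<open>s = - u / M a a\<close> to the
  coordinate \<open>a\<close> of \<open>c\<close>.\<close>

lemma psd_schur_complement:
  assumes M: "psd J M" "finite J" and a: "a \<in> J" and d: "M a a \<noteq> 0"
  shows "psd J (\<lambda>x y. M x y - M x a * M a y / M a a)"
  unfolding psd_def
proof
  fix c :: "_ \<Rightarrow> complex"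
  define u where "u = (\<Sum>y\<in>J. M a y * c y)"
  define s where "s = - u / M a a"
  have cu: "(\<Sum>x\<in>J. M x a * cnj (c x)) = cnj u"
    using psd_hermitian[OF M a] by (simp add: u_def)
  have cd: "cnj (M a a) = M a a" using psd_hermitian[OF M a a] by simp
  let ?e = "\<lambda>x. if x = a then s else 0"
  have su: "(\<Sum>x\<in>J. f x * ?e x) = f a * s" "(\<Sum>x\<in>J. f x * cnj (?e x)) = f a * cnj s" for f
    using M(2) a by (simp_all add: if_distrib[of cnj] if_distrib[of "(*) _"] cong: if_cong)
  have "(\<Sum>x\<in>J. \<Sum>y\<in>J. M x y * (c y + ?e y) * cnj (c x + ?e x))
    = (\<Sum>x\<in>J. (\<Sum>y\<in>J. M x y * (c y + ?e y)) * cnj (c x + ?e x))"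
    by (simp only: sum_distrib_right)
  also have "\<dots> = (\<Sum>x\<in>J. ((\<Sum>y\<in>J. M x y * c y) + M x a * s) * cnj (c x + ?e x))"
    by (simp only: distrib_left sum.distrib su)
  also have "\<dots> = (\<Sum>x\<in>J. (\<Sum>y\<in>J. M x y * c y) * cnj (c x)) + s * (\<Sum>x\<in>J. M x a * cnj (c x))
      + ((\<Sum>y\<in>J. M a y * c y) + M a a * s) * cnj s"
  proof -
    have "(\<Sum>x\<in>J. ((\<Sum>y\<in>J. M x y * c y) + M x a * s) * cnj (c x + ?e x))
      = (\<Sum>x\<in>J. ((\<Sum>y\<in>J. M x y * c y) + M x a * s) * cnj (c x))
      + (\<Sum>x\<in>J. ((\<Sum>y\<in>J. M x y * c y) + M x a * s) * cnj (?e x))"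
      by (simp only: complex_cnj_add distrib_left sum.distrib)
    then show ?thesis
      by (simp only: su) (simp add: distrib_right sum.distrib sum_distrib_left mult.assoc mult.left_commute)
  qed
  also have "\<dots> = (\<Sum>x\<in>J. (\<Sum>y\<in>J. M x y * c y) * cnj (c x)) - u * cnj u / M a a"
    unfolding cu u_def[symmetric] s_def using d cd by (simp add: field_simps)
  also have "\<dots> = (\<Sum>x\<in>J. \<Sum>y\<in>J. (M x y - M x a * M a y / M a a) * c y * cnj (c x))"
  proof -
    have "u * cnj u / M a a = (\<Sum>x\<in>J. \<Sum>y\<in>J. M x a * M a y / M a a * c y * cnj (c x))"
    proof -
      have "u * cnj u / M a a = (\<Sum>x\<in>J. M x a * cnj (c x)) * (\<Sum>y\<in>J. M a y * c y) / M a a"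
        unfolding cu u_def[symmetric] by (simp only: mult.commute)
      also have "\<dots> = (\<Sum>x\<in>J. \<Sum>y\<in>J. (M x a * cnj (c x)) * (M a y * c y) / M a a)"
        by (simp only: sum_product sum_divide_distrib)
      finally show ?thesis by (simp add: mult_ac)
    qed
    then show ?thesis by (simp add: left_diff_distrib sum_subtractf sum_distrib_right)
  qed
  finally show "0 \<le> (\<Sum>x\<in>J. \<Sum>y\<in>J. (M x y - M x a * M a y / M a a) * c y * cnj (c x))"
    using psdD[OF M(1), of "\<lambda>x. c x + ?e x"] by simp
qed

text \<open>Gaussian elimination of the indices in \<open>A\<close>; a zero block \<open>A \<times> B\<close> keeps the eliminated
  rank-one terms off \<open>B\<close>.\<close>

lemma psd_eliminate:
  assumes M: "psd J M" "finite J" and "finite A" "A \<subseteq> J" "B \<subseteq> J"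
    and "\<And>a b. \<lbrakk>a \<in> A; b \<in> B\<rbrakk> \<Longrightarrow> M a b = 0"
  obtains v M' where "psd J M'" "\<And>x a. \<lbrakk>x \<in> J; a \<in> A\<rbrakk> \<Longrightarrow> M' x a = 0 \<and> M' a x = 0"
    "\<And>x y. \<lbrakk>x \<in> J; y \<in> J\<rbrakk> \<Longrightarrow> M x y = M' x y + (\<Sum>a\<in>A. v a x * cnj (v a y))"
    "\<And>a b. \<lbrakk>a \<in> A; b \<in> B\<rbrakk> \<Longrightarrow> v a b = 0"
proof -
  define good where "good A v M' \<longleftrightarrow> psd J M' \<and> (\<forall>x\<in>J. \<forall>a\<in>A. M' x a = 0 \<and> M' a x = 0)
    \<and> (\<forall>x\<in>J. \<forall>y\<in>J. M x y = M' x y + (\<Sum>a\<in>A. v a x * cnj (v a y)))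
    \<and> (\<forall>a\<in>A. \<forall>b\<in>B. v a b = 0)" for A v M'
  from assms(3-) have "\<exists>v M'. good A v M'"
  proof (induction A rule: finite_induct)
    case empty
    then show ?case using M by (intro exI[of _ "\<lambda>_ _. 0"] exI[of _ M]) (auto simp: good_def)
  next
    case (insert a A)
    have "\<exists>v M'. good A v M'"
      using insert.prems by (intro insert.IH) auto
    then obtain v M' where *: "good A v M'" by blast
    then have M': "psd J M'" "\<And>x a. \<lbrakk>x \<in> J; a \<in> A\<rbrakk> \<Longrightarrow> M' x a = 0 \<and> M' a x = 0"
      "\<And>x y. \<lbrakk>x \<in> J; y \<in> J\<rbrakk> \<Longrightarrow> M x y = M' x y + (\<Sum>a\<in>A. v a x * cnj (v a y))"
      "\<And>a b. \<lbrakk>a \<in> A; b \<in> B\<rbrakk> \<Longrightarrow> v a b = 0"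
      unfolding good_def by blast+
    have a: "a \<in> J" "a \<notin> A" using insert by auto
    \<comment> \<open>The zero block survives the earlier eliminations, since the rank-one terms
      removed so far vanish on \<open>B\<close>.\<close>
    have ab: "M' a b = 0" if "b \<in> B" for b
      using M'(3)[of a b] M'(4)[of _ b] insert.prems that a by auto
    have herm: "M' y x = cnj (M' x y)" if "x \<in> J" "y \<in> J" for x y
      using psd_hermitian[OF M'(1) M(2) that] .
    show ?case
    proof (cases "M' a a = 0")
      case True
      \<comment> \<open>A zero pivot comes with a zero row and column, so nothing has to be removed
        and the new vector is 0.\<close>
      have "M' x a = 0" "M' a x = 0" if "x \<in> J" for x
        using psd_diag_zero[OF M'(1) M(2) that a(1) True] herm[OF that a(1)] by auto
      moreover have "(\<Sum>b\<in>insert a A. (v(a := \<lambda>_. 0)) b x * cnj ((v(a := \<lambda>_. 0)) b y))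
          = (\<Sum>b\<in>A. v b x * cnj (v b y))" for x y
        using a insert.hyps by (auto intro!: sum.cong)
      ultimately have "good (insert a A) (v(a := \<lambda>_. 0)) M'"
        unfolding good_def using M' by auto
      then show ?thesis by blast
    next
      case False
      \<comment> \<open>The square root of the pivot, chosen so that the outer product of
        \<open>w\<close> is exactly the term that the Schur complement subtracts.\<close>
      define s where "s = sqrt (Re (M' a a))"
      have s: "of_real s * of_real s = M' a a" "s \<noteq> 0"
        using psd_diag[OF M'(1) M(2) a(1)] False
        by (auto simp: s_def less_eq_complex_def complex_eq_iff)
      define w where "w x = M' x a / of_real s" for x
      have w: "w x * cnj (w y) = M' x a * M' a y / M' a a" if "x \<in> J" "y \<in> J" for x y
        using herm[OF that(2) a(1)] s by (simp add: w_def)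
      have "M x y = M' x y - M' x a * M' a y / M' a a
          + (\<Sum>b\<in>insert a A. (v(a := w)) b x * cnj ((v(a := w)) b y))"
        if "x \<in> J" "y \<in> J" for x y
      proof -
        have "(\<Sum>b\<in>A. (v(a := w)) b x * cnj ((v(a := w)) b y)) = (\<Sum>b\<in>A. v b x * cnj (v b y))"
          using a by (intro sum.cong) auto
        then show ?thesis using M'(3)[OF that] w[OF that] insert.hyps by simp
      qed
      moreover have "w b = 0" if "b \<in> B" for b
        using ab[OF that] herm[OF a(1), of b] insert.prems that by (auto simp: w_def)
      ultimately have "good (insert a A) (v(a := w)) (\<lambda>x y. M' x y - M' x a * M' a y / M' a a)"
        unfolding good_def
        using M' a False psd_schur_complement[OF M'(1) M(2) a(1) False] by auto
      then show ?thesis by blast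
    qed
  qed
  then obtain v M' where "good A v M'" by blast
  then show ?thesis using that[of M' v] unfolding good_def by blast
qed

lemma psd_outer: "psd J (\<lambda>x y. \<Sum>a\<in>A. v a x * cnj (v a y))"
  unfolding psd_def
proof
  fix c :: "_ \<Rightarrow> complex"
  have "(\<Sum>x\<in>J. \<Sum>y\<in>J. (\<Sum>a\<in>A. v a x * cnj (v a y)) * c y * cnj (c x))
    = (\<Sum>x\<in>J. \<Sum>y\<in>J. \<Sum>a\<in>A. (v a x * cnj (c x)) * cnj (v a y * cnj (c y)))"
    by (simp add: sum_distrib_left sum_distrib_right mult_ac)
  also have "\<dots> = (\<Sum>a\<in>A. \<Sum>x\<in>J. \<Sum>y\<in>J. (v a x * cnj (c x)) * cnj (v a y * cnj (c y)))"
    by (simp only: sum.swap[of _ A])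
  also have "\<dots> = (\<Sum>a\<in>A. (\<Sum>x\<in>J. v a x * cnj (c x)) * cnj (\<Sum>x\<in>J. v a x * cnj (c x)))"
    by (simp add: sum_product)
  also have "\<dots> = of_real (\<Sum>a\<in>A. (cmod (\<Sum>x\<in>J. v a x * cnj (c x)))\<^sup>2)"
    by (simp only: of_real_sum complex_norm_square)
  also have "0 \<le> \<dots>" by (simp add: less_eq_complex_def sum_nonneg)
  finally show "0 \<le> (\<Sum>x\<in>J. \<Sum>y\<in>J. (\<Sum>a\<in>A. v a x * cnj (v a y)) * c y * cnj (c x))" .
qed

text \<open>The Schur product theorem, tested on the all-ones vector. Eliminating every index leaves
  \<open>M' = 0\<close> and writes \<open>M\<close> as a sum of rank-one kernels; each of them
  contributes the form of \<open>N\<close> at the conjugate of \<open>v a\<close>.\<close>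

lemma psd_schur_sum:
  assumes M: "psd J M" "finite J" and N: "psd J N"
  shows "0 \<le> (\<Sum>x\<in>J. \<Sum>y\<in>J. M x y * N x y)"
proof -
  obtain v M' where "\<And>x a. \<lbrakk>x \<in> J; a \<in> J\<rbrakk> \<Longrightarrow> M' x a = 0 \<and> M' a x = 0"
    "\<And>x y. \<lbrakk>x \<in> J; y \<in> J\<rbrakk> \<Longrightarrow> M x y = M' x y + (\<Sum>a\<in>J. v a x * cnj (v a y))"
    by (rule psd_eliminate[OF M M(2) subset_refl empty_subsetI]) blast+
  then have "(\<Sum>x\<in>J. \<Sum>y\<in>J. M x y * N x y)
    = (\<Sum>x\<in>J. \<Sum>y\<in>J. \<Sum>a\<in>J. N x y * cnj (v a y) * cnj (cnj (v a x)))"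
    by (intro sum.cong refl) (simp add: sum_distrib_left mult_ac)
  also have "\<dots> = (\<Sum>x\<in>J. \<Sum>a\<in>J. \<Sum>y\<in>J. N x y * cnj (v a y) * cnj (cnj (v a x)))"
    by (rule sum.cong[OF refl], rule sum.swap)
  also have "\<dots> = (\<Sum>a\<in>J. \<Sum>x\<in>J. \<Sum>y\<in>J. N x y * cnj (v a y) * cnj (cnj (v a x)))"
    by (rule sum.swap)
  also have "0 \<le> \<dots>"
    by (rule sum_nonneg) (rule psdD[OF N])
  finally show ?thesis .
qed

text \<open>Splits a sum along the encoding of index pairs used by
  \<open>mat_tensor\<close>.\<close>

lemma sum_lessThan_mult:
  "(\<Sum>p<k * m. f p) = (\<Sum>a<k. \<Sum>b<m. f (a * m + b))" for f :: "nat \<Rightarrow> 'a :: comm_monoid_add"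
proof -
  have "sum f {a * m..<a * m + m} = (\<Sum>b<m. f (a * m + b))" for a
    by (simp add: sum.atLeastLessThan_shift_0[of _ "a * m"] lessThan_atLeast0)
  then show ?thesis by (simp add: sum.nat_group[symmetric] mult.commute)
qed

section \<open>Scalar kernels from positive operator matrices\<close>

context complex_hilbert
begin

lemma ip_lincomb:
  assumes f: "f \<in> carrier (bop V)" and u: "u \<in> J \<rightarrow> carrier V" and w: "w \<in> carrier V"
  shows "ip V (f (\<Oplus>\<^bsub>V\<^esub>y\<in>J. c y \<odot> u y)) w = (\<Sum>y\<in>J. c y * ip V (f (u y)) w)"
proof -
  have "(\<lambda>y. c y \<odot> u y) \<in> J \<rightarrow> carrier V" using u by auto
  then have "f (\<Oplus>\<^bsub>V\<^esub>y\<in>J. c y \<odot> u y) = (\<Oplus>\<^bsub>V\<^esub>y\<in>J. f (c y \<odot> u y))"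
    using f by (simp add: bop_finsum)
  also have "ip V \<dots> w = (\<Sum>y\<in>J. ip V (f (c y \<odot> u y)) w)"
    using f u w by (intro ip_finsum_left) (auto simp: bop_closed Pi_iff)
  also have "\<dots> = (\<Sum>y\<in>J. c y * ip V (f (u y)) w)"
    using f u w by (intro sum.cong) (auto simp: bop_closed bop_smult ip_smult Pi_iff)
  finally show ?thesis .
qed

lemma ip_lincomb_right:
  assumes u: "u \<in> J \<rightarrow> carrier V" and w: "w \<in> carrier V"
  shows "ip V w (\<Oplus>\<^bsub>V\<^esub>y\<in>J. c y \<odot> u y) = (\<Sum>y\<in>J. cnj (c y) * ip V w (u y))"
proof -
  have "ip V w (\<Oplus>\<^bsub>V\<^esub>y\<in>J. c y \<odot> u y) = (\<Sum>y\<in>J. ip V w (c y \<odot> u y))"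
    using u w by (intro ip_finsum_right) (auto simp: Pi_iff)
  also have "\<dots> = (\<Sum>y\<in>J. cnj (c y) * ip V w (u y))"
    using u w by (intro sum.cong) (auto simp: ip_smult_right Pi_iff)
  finally show ?thesis .
qed

lemma lincomb_closed': "u \<in> J \<rightarrow> carrier V \<Longrightarrow> (\<Oplus>\<^bsub>V\<^esub>y\<in>J. c y \<odot> u y) \<in> carrier V"
  by (rule finsum_closed) auto

text \<open>The form of the kernel at \<open>c\<close> is the form of \<open>Q\<close> at the
  vectors \<open>v q\<close>, the combinations of the \<open>u y q\<close> with coefficients
  \<open>c y\<close>. The rest moves the sums over \<open>J\<close> outwards.\<close>

lemma psd_of_pos_op_mat:
  assumes Q: "pos_op_mat V m Q" "\<And>p q. \<lbrakk>p < m; q < m\<rbrakk> \<Longrightarrow> Q $$ (p, q) \<in> carrier (bop V)"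
    and u: "\<And>x q. \<lbrakk>x \<in> J; q < m\<rbrakk> \<Longrightarrow> u x q \<in> carrier V"
  shows "psd J (\<lambda>x y. \<Sum>p<m. \<Sum>q<m. ip V ((Q $$ (p, q)) (u y q)) (u x p))"
  unfolding psd_def
proof
  fix c :: "_ \<Rightarrow> complex"
  define v where "v q = (\<Oplus>\<^bsub>V\<^esub>y\<in>J. c y \<odot> u y q)" for q
  have v: "v q \<in> carrier V" if "q < m" for q
    unfolding v_def using u that by (intro lincomb_closed') auto
  have *: "ip V ((Q $$ (p, q)) (v q)) (v p)
    = (\<Sum>x\<in>J. \<Sum>y\<in>J. ip V ((Q $$ (p, q)) (u y q)) (u x p) * c y * cnj (c x))" if "p < m" "q < m" for p q
  proof -
    have "ip V ((Q $$ (p, q)) (v q)) (v p) = (\<Sum>x\<in>J. cnj (c x) * ip V ((Q $$ (p, q)) (v q)) (u x p))"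
      unfolding v_def[of p] using u that v Q(2)
      by (intro ip_lincomb_right[of "\<lambda>x. u x p"]) (simp_all add: bop_closed)
    also have "\<dots> = (\<Sum>x\<in>J. cnj (c x) * (\<Sum>y\<in>J. c y * ip V ((Q $$ (p, q)) (u y q)) (u x p)))"
      unfolding v_def[of q] using u that v Q(2) by (intro sum.cong refl arg_cong2[where f = "(*)"] ip_lincomb) auto
    finally show ?thesis by (simp add: sum_distrib_left sum_distrib_right mult_ac)
  qed
  have "0 \<le> (\<Sum>p<m. \<Sum>q<m. ip V ((Q $$ (p, q)) (v q)) (v p))"
    using Q(1) v unfolding pos_op_mat_def by (auto simp: Pi_iff)
  also have "\<dots> = (\<Sum>p<m. \<Sum>q<m. \<Sum>x\<in>J. \<Sum>y\<in>J. ip V ((Q $$ (p, q)) (u y q)) (u x p) * c y * cnj (c x))"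
    by (simp add: *)
  also have "\<dots> = (\<Sum>p<m. \<Sum>x\<in>J. \<Sum>q<m. \<Sum>y\<in>J. ip V ((Q $$ (p, q)) (u y q)) (u x p) * c y * cnj (c x))"
    by (intro sum.cong refl sum.swap)
  also have "\<dots> = (\<Sum>p<m. \<Sum>x\<in>J. \<Sum>y\<in>J. \<Sum>q<m. ip V ((Q $$ (p, q)) (u y q)) (u x p) * c y * cnj (c x))"
    by (intro sum.cong refl sum.swap)
  also have "\<dots> = (\<Sum>x\<in>J. \<Sum>p<m. \<Sum>y\<in>J. \<Sum>q<m. ip V ((Q $$ (p, q)) (u y q)) (u x p) * c y * cnj (c x))"
    by (rule sum.swap)
  also have "\<dots> = (\<Sum>x\<in>J. \<Sum>y\<in>J. \<Sum>p<m. \<Sum>q<m. ip V ((Q $$ (p, q)) (u y q)) (u x p) * c y * cnj (c x))"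
    by (intro sum.cong refl sum.swap)
  finally show "0 \<le> (\<Sum>x\<in>J. \<Sum>y\<in>J. (\<Sum>p<m. \<Sum>q<m. ip V ((Q $$ (p, q)) (u y q)) (u x p)) * c y * cnj (c x))"
    by (simp add: sum_distrib_right)
qed

lemma mat_conj_entry:
  assumes X: "\<And>p q. \<lbrakk>p < m; q < m\<rbrakk> \<Longrightarrow> X $$ (p, q) \<in> carrier (bop V)" and ab: "a < n" "b < n"
  shows "mat_conj V n m \<alpha> X $$ (a, b) \<in> carrier (bop V)"
    and "\<lbrakk>z \<in> carrier V; w \<in> carrier V\<rbrakk> \<Longrightarrow> ip V ((mat_conj V n m \<alpha> X $$ (a, b)) z) w
      = (\<Sum>p<m. \<Sum>q<m. \<alpha> $$ (a, p) * cnj (\<alpha> $$ (b, q)) * ip V ((X $$ (p, q)) z) w)"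
proof -
  have 1: "(\<lambda>q. (\<alpha> $$ (a, p) * cnj (\<alpha> $$ (b, q))) \<odot>\<^bsub>bop V\<^esub> X $$ (p, q)) \<in> {..<m} \<rightarrow> carrier (bop V)"
    if "p < m" for p
    using X that by (auto simp: bop_smult_closed)
  then have 2: "(\<lambda>p. \<Oplus>\<^bsub>bop V\<^esub>q\<in>{..<m}. (\<alpha> $$ (a, p) * cnj (\<alpha> $$ (b, q))) \<odot>\<^bsub>bop V\<^esub> X $$ (p, q))
      \<in> {..<m} \<rightarrow> carrier (bop V)"
    by (auto intro!: bop.finsum_closed)
  show "mat_conj V n m \<alpha> X $$ (a, b) \<in> carrier (bop V)"
    using ab 2 by (simp add: mat_conj_def bop.finsum_closed)
  assume zw: "z \<in> carrier V" "w \<in> carrier V"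
  show "ip V ((mat_conj V n m \<alpha> X $$ (a, b)) z) w
      = (\<Sum>p<m. \<Sum>q<m. \<alpha> $$ (a, p) * cnj (\<alpha> $$ (b, q)) * ip V ((X $$ (p, q)) z) w)"
    using ab zw X by (simp add: mat_conj_def ip_bop_finsum[OF 2] ip_bop_finsum[OF 1] ip_bop)
qed

text \<open>The form of the conjugated matrix at \<open>v\<close> is the sum of all entries of a
  kernel as in \<open>psd_of_pos_op_mat\<close>, with the scalars of \<open>\<alpha>\<close> moved
  onto the vectors \<open>v a\<close>.\<close>

lemma pos_op_mat_conj:
  assumes X: "\<And>p q. \<lbrakk>p < m; q < m\<rbrakk> \<Longrightarrow> X $$ (p, q) \<in> carrier (bop V)" and pos: "pos_op_mat V m X"
  shows "pos_op_mat V n (mat_conj V n m \<alpha> X)"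
  unfolding pos_op_mat_def
proof
  fix v assume v: "v \<in> {..<n} \<rightarrow> carrier V"
  have "psd {..<n} (\<lambda>a b. \<Sum>p<m. \<Sum>q<m. ip V ((X $$ (p, q)) (cnj (\<alpha> $$ (b, q)) \<odot> v b)) (cnj (\<alpha> $$ (a, p)) \<odot> v a))"
    using X v by (intro psd_of_pos_op_mat[OF pos]) auto
  from psdD[OF this, of "\<lambda>_. 1"]
  have "0 \<le> (\<Sum>a<n. \<Sum>b<n. \<Sum>p<m. \<Sum>q<m.
      ip V ((X $$ (p, q)) (cnj (\<alpha> $$ (b, q)) \<odot> v b)) (cnj (\<alpha> $$ (a, p)) \<odot> v a))"
    by simp
  also have "\<dots> = (\<Sum>a<n. \<Sum>b<n. ip V ((mat_conj V n m \<alpha> X $$ (a, b)) (v b)) (v a))"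
  proof (intro sum.cong refl)
    fix a b assume "a \<in> {..<n}" "b \<in> {..<n}"
    then have ab: "a < n" "b < n" "v a \<in> carrier V" "v b \<in> carrier V" using v by auto
    show "(\<Sum>p<m. \<Sum>q<m. ip V ((X $$ (p, q)) (cnj (\<alpha> $$ (b, q)) \<odot> v b)) (cnj (\<alpha> $$ (a, p)) \<odot> v a))
      = ip V ((mat_conj V n m \<alpha> X $$ (a, b)) (v b)) (v a)"
      using ab X
      by (subst mat_conj_entry(2))
        (auto simp: bop_smult bop_closed ip_smult ip_smult_right mult_ac intro!: sum.cong)
  qed
  finally show "0 \<le> (\<Sum>i<n. \<Sum>j<n. ip V ((mat_conj V n m \<alpha> X $$ (i, j)) (v j)) (v i))" .
qed

end

section \<open>Graph operator systems\<close>

definition supp_mats :: "nat \<Rightarrow> (nat \<Rightarrow> nat \<Rightarrow> bool) \<Rightarrow> complex mat set" where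
  "supp_mats n R = {A \<in> carrier_mat n n. \<forall>i<n. \<forall>j<n. \<not> R i j \<longrightarrow> A $$ (i, j) = 0}"

text \<open>Reflexive on all natural numbers, so that \<open>refl_R\<close> below carries no range
  condition.\<close>

definition adj :: "nat pair_pre_digraph \<Rightarrow> nat \<Rightarrow> nat \<Rightarrow> bool" where
  "adj G i j \<longleftrightarrow> i = j \<or> (i, j) \<in> parcs G"

text \<open>Trades the span for an entrywise condition, after which the graph enters only through
  the relation \<open>adj G\<close>. For the converse inclusion a matrix is assembled one entry at a
  time.\<close>

lemma graph_mats_eq:
  assumes "parcs G \<subseteq> {0..<n} \<times> {0..<n}"
  shows "graph_mats n G = supp_mats n (adj G)"
proof
  interpret matrix_vs n n "TYPE(complex)" .
  let ?E = "{unit_mat n i j | i j. (i, j) \<in> parcs G} \<union> {unit_mat n i i | i. i < n}"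
  have E: "?E \<subseteq> supp_mats n (adj G)"
    by (auto simp: supp_mats_def adj_def unit_mat_def)
  have Ec: "?E \<subseteq> carrier_mat n n" by (auto simp: unit_mat_def)
  have "LinearCombinations.submodule class_ring (supp_mats n (adj G)) V"
    by standard (auto simp: supp_mats_def matrix_vs_simps)
  then have "span ?E \<subseteq> supp_mats n (adj G)" using E by (intro span_is_subset)
  then show "graph_mats n G \<subseteq> supp_mats n (adj G)" by (simp add: graph_mats_def)
  have sub: "LinearCombinations.submodule class_ring (span ?E) V"
    using Ec by (intro span_is_submodule)
  note cl = LinearCombinations.submodule.m_closed[OF sub] LinearCombinations.submodule.smult_closed[OF sub]
    LinearCombinations.submodule.zero_closed[OF sub]
  show "supp_mats n (adj G) \<subseteq> graph_mats n G"
  proof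
    fix A assume A: "A \<in> supp_mats n (adj G)"
    let ?P = "{p \<in> {0..<n} \<times> {0..<n}. adj G (fst p) (snd p)}"
    have "mat n n (\<lambda>p. if p \<in> P then A $$ p else 0) \<in> span ?E" if "finite P" "P \<subseteq> ?P" for P
      using that
    proof (induction P rule: finite_induct)
      case empty
      have "mat n n (\<lambda>p. if p \<in> {} then A $$ p else 0) = 0\<^sub>m n n" by auto
      then show ?case using cl(3) by (simp add: matrix_vs_simps)
    next
      case (insert p P)
      obtain i j where p: "p = (i, j)" by (cases p)
      then have "unit_mat n i j \<in> ?E" using insert.prems assms by (auto simp: adj_def)
      then have "unit_mat n i j \<in> span ?E" using in_own_span[OF Ec] by blast
      then have "A $$ p \<cdot>\<^sub>m unit_mat n i j + mat n n (\<lambda>p. if p \<in> P then A $$ p else 0) \<in> span ?E"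
        using cl insert by (simp add: matrix_vs_simps)
      also have "A $$ p \<cdot>\<^sub>m unit_mat n i j + mat n n (\<lambda>p. if p \<in> P then A $$ p else 0)
        = mat n n (\<lambda>q. if q \<in> insert p P then A $$ q else 0)"
        using insert.hyps p by (intro eq_matI) (auto simp: unit_mat_def)
      finally show ?case .
    qed
    from this[of ?P] have "mat n n (\<lambda>p. if p \<in> ?P then A $$ p else 0) \<in> span ?E" by simp
    moreover have "mat n n (\<lambda>p. if p \<in> ?P then A $$ p else 0) = A"
      using A by (intro eq_matI) (auto simp: supp_mats_def)
    ultimately show "A \<in> graph_mats n G" by (simp add: graph_mats_def)
  qed
qed

text \<open>Passes between the order of Kronecker indices, on the left, and the grouping by pairs
  (matrix position, vertex) that \<open>psd_schur_sum\<close> uses, on the right.\<close>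

lemma sum_reorder:
  "(\<Sum>p\<in>A. \<Sum>p'\<in>B. \<Sum>q\<in>C. \<Sum>q'\<in>D. \<Sum>i\<in>E. \<Sum>j\<in>F. f p i q j p' q')
    = (\<Sum>p\<in>A. \<Sum>i\<in>E. \<Sum>q\<in>C. \<Sum>j\<in>F. \<Sum>p'\<in>B. \<Sum>q'\<in>D. f p i q j p' q')"
  unfolding sum.cartesian_product
  by (rule sum.reindex_bij_witness[where
      i = "\<lambda>(p, i, q, j, p', q'). (p, p', q, q', i, j)" and
      j = "\<lambda>(p, p', q, q', i, j). (p, i, q, j, p', q')"]) auto

text \<open>Only reflexivity of \<open>R\<close> is fixed, so the transitive case and the path
  argument both live in this locale.\<close>

locale supp_tensor = cvec_tensor N K L \<tau>
  for N :: nat and K :: "'v cinner_space" and L :: "'w cinner_space"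
    and \<tau> :: "complex vec \<Rightarrow> 'v \<Rightarrow> 'w" +
  fixes R :: "nat \<Rightarrow> nat \<Rightarrow> bool" and T :: "('v \<Rightarrow> 'v) set"
  assumes refl_R: "R i i" and T: "operator_system K T"
begin

abbreviation S where "S \<equiv> mat_op N ` supp_mats N R"
abbreviation H where "H \<equiv> cvec_space N"

lemma T_sub: "LinearCombinations.submodule class_ring T (bop K)"
  using T by (simp add: operator_system_def VectorSpace.subspace_def)

lemma T_bop: "t \<in> T \<Longrightarrow> t \<in> carrier (bop K)"
  using LinearCombinations.submodule.subset[OF T_sub] by auto

lemma T_zero: "\<zero>\<^bsub>bop K\<^esub> \<in> T"
  and T_add: "\<lbrakk>s \<in> T; t \<in> T\<rbrakk> \<Longrightarrow> s \<oplus>\<^bsub>bop K\<^esub> t \<in> T"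
  and T_smult: "t \<in> T \<Longrightarrow> c \<odot>\<^bsub>bop K\<^esub> t \<in> T"
  using LinearCombinations.submodule.zero_closed[OF T_sub]
    LinearCombinations.submodule.m_closed[OF T_sub]
    LinearCombinations.submodule.smult_closed[OF T_sub] by auto

lemma T_one: "\<one>\<^bsub>bop K\<^esub> \<in> T"
  using T by (simp add: operator_system_def)

lemma supp_carrier: "A \<in> supp_mats N R \<Longrightarrow> A \<in> carrier_mat N N"
  by (simp add: supp_mats_def)

lemma alg_tensor_eq:
  "alg_tensor H K L \<tau> S T = L.bop.span {tens A t | A t. A \<in> supp_mats N R \<and> t \<in> T}"
proof -
  have "{op_tensor H K L \<tau> s t | s t. s \<in> S \<and> t \<in> T} = {tens A t | A t. A \<in> supp_mats N R \<and> t \<in> T}"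
    (is "?X = ?Y")
  proof (rule Set.set_eqI)
    fix F
    have "F \<in> ?X \<longleftrightarrow> (\<exists>A\<in>supp_mats N R. \<exists>t\<in>T. F = op_tensor H K L \<tau> (mat_op N A) t)" by blast
    also have "\<dots> \<longleftrightarrow> (\<exists>A\<in>supp_mats N R. \<exists>t\<in>T. F = tens A t)"
      by (intro bex_cong refl) (simp add: op_tensor_eq supp_carrier T_bop)
    also have "\<dots> \<longleftrightarrow> F \<in> ?Y" by blast
    finally show "F \<in> ?X \<longleftrightarrow> F \<in> ?Y" .
  qed
  then show ?thesis by (simp add: alg_tensor_def)
qed

lemma tens_gen: "{tens A t | A t. A \<in> supp_mats N R \<and> t \<in> T} \<subseteq> carrier (bop L)"
  by (auto simp: tens_closed T_bop)

lemma alg_sub: "LinearCombinations.submodule class_ring (alg_tensor H K L \<tau> S T) (bop L)"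
  unfolding alg_tensor_eq by (rule L.bop.span_is_submodule[OF tens_gen])

lemma alg_bop: "F \<in> alg_tensor H K L \<tau> S T \<Longrightarrow> F \<in> carrier (bop L)"
  using LinearCombinations.submodule.subset[OF alg_sub] by auto

lemma alg_zero: "\<zero>\<^bsub>bop L\<^esub> \<in> alg_tensor H K L \<tau> S T"
  and alg_add: "\<lbrakk>F \<in> alg_tensor H K L \<tau> S T; F' \<in> alg_tensor H K L \<tau> S T\<rbrakk>
    \<Longrightarrow> F \<oplus>\<^bsub>bop L\<^esub> F' \<in> alg_tensor H K L \<tau> S T"
  and alg_smult: "F \<in> alg_tensor H K L \<tau> S T \<Longrightarrow> c \<odot>\<^bsub>bop L\<^esub> F \<in> alg_tensor H K L \<tau> S T"
  using LinearCombinations.submodule.zero_closed[OF alg_sub]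
    LinearCombinations.submodule.m_closed[OF alg_sub]
    LinearCombinations.submodule.smult_closed[OF alg_sub] by auto

lemma tens_alg: "\<lbrakk>A \<in> supp_mats N R; t \<in> T\<rbrakk> \<Longrightarrow> tens A t \<in> alg_tensor H K L \<tau> S T"
  unfolding alg_tensor_eq using L.bop.in_own_span[OF tens_gen] by blast

text \<open>Here \<open>t i j\<close> is the coefficient of the matrix unit at (i, j). The expansion
  is stated for the sesquilinear form, so that it passes to sums and multiples by linearity.\<close>

definition has_coeffs :: "('w \<Rightarrow> 'w) \<Rightarrow> (nat \<Rightarrow> nat \<Rightarrow> 'v \<Rightarrow> 'v) \<Rightarrow> bool" where
  "has_coeffs F t \<longleftrightarrow> (\<forall>i<N. \<forall>j<N. t i j \<in> T \<and> (\<not> R i j \<longrightarrow> t i j = \<zero>\<^bsub>bop K\<^esub>)) \<and>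
    (\<forall>z\<in>carrier L. \<forall>w\<in>carrier L.
      ip L (F z) w = (\<Sum>i<N. \<Sum>j<N. ip K (t i j (crd z j)) (crd w i)))"

text \<open>Operators having coefficients form a submodule, and \<open>tens A t\<close> has the
  coefficients \<open>A $$ (i, j)\<close> times \<open>t\<close>; hence the whole span is
  covered.\<close>

lemma alg_coeffs:
  assumes "F \<in> alg_tensor H K L \<tau> S T"
  obtains t where "has_coeffs F t"
proof -
  let ?W = "{F \<in> carrier (bop L). \<exists>t. has_coeffs F t}"
  have "LinearCombinations.submodule class_ring ?W (bop L)"
  proof
    show "?W \<subseteq> carrier (bop L)" by auto
    have "has_coeffs \<zero>\<^bsub>bop L\<^esub> (\<lambda>_ _. \<zero>\<^bsub>bop K\<^esub>)"
      by (auto simp: has_coeffs_def T_zero L.bop_zero_app K.bop_zero_app)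
    then show "\<zero>\<^bsub>bop L\<^esub> \<in> ?W" by (auto simp: L.bop_zero_closed)
    fix F assume F: "F \<in> ?W"
    then obtain t where t: "has_coeffs F t" by blast
    have tb: "t i j \<in> carrier (bop K)" if "i < N" "j < N" for i j
      using t that T_bop by (auto simp: has_coeffs_def)
    show "c \<odot>\<^bsub>bop L\<^esub> F \<in> ?W" for c
    proof -
      have "has_coeffs (c \<odot>\<^bsub>bop L\<^esub> F) (\<lambda>i j. c \<odot>\<^bsub>bop K\<^esub> t i j)"
        unfolding has_coeffs_def
      proof (intro conjI allI impI ballI)
        fix i j assume ij: "i < N" "j < N"
        show "c \<odot>\<^bsub>bop K\<^esub> t i j \<in> T" using ij t by (simp add: has_coeffs_def T_smult)
        assume "\<not> R i j"
        then show "c \<odot>\<^bsub>bop K\<^esub> t i j = \<zero>\<^bsub>bop K\<^esub>"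
          using ij t K.bop.smult_r_null[of c] by (simp add: has_coeffs_def)
      next
        fix z w assume zw: "z \<in> carrier L" "w \<in> carrier L"
        then show "ip L ((c \<odot>\<^bsub>bop L\<^esub> F) z) w = (\<Sum>i<N. \<Sum>j<N. ip K ((c \<odot>\<^bsub>bop K\<^esub> t i j) (crd z j)) (crd w i))"
          using F t tb by (simp add: L.ip_bop K.ip_bop has_coeffs_def sum_distrib_left)
      qed
      then show ?thesis using F by (auto simp: L.bop_smult_closed)
    qed
    fix F' assume F': "F' \<in> ?W"
    then obtain t' where t': "has_coeffs F' t'" by blast
    have tb': "t' i j \<in> carrier (bop K)" if "i < N" "j < N" for i j
      using t' that T_bop by (auto simp: has_coeffs_def)
    have "has_coeffs (F \<oplus>\<^bsub>bop L\<^esub> F') (\<lambda>i j. t i j \<oplus>\<^bsub>bop K\<^esub> t' i j)"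
      unfolding has_coeffs_def
    proof (intro conjI allI impI ballI)
      fix i j assume ij: "i < N" "j < N"
      show "t i j \<oplus>\<^bsub>bop K\<^esub> t' i j \<in> T" using ij t t' by (simp add: has_coeffs_def T_add)
      assume "\<not> R i j"
      then show "t i j \<oplus>\<^bsub>bop K\<^esub> t' i j = \<zero>\<^bsub>bop K\<^esub>"
        using ij t t' by (simp add: has_coeffs_def)
    next
      fix z w assume zw: "z \<in> carrier L" "w \<in> carrier L"
      then show "ip L ((F \<oplus>\<^bsub>bop L\<^esub> F') z) w = (\<Sum>i<N. \<Sum>j<N. ip K ((t i j \<oplus>\<^bsub>bop K\<^esub> t' i j) (crd z j)) (crd w i))"
        using F F' t t' tb tb' by (simp add: L.ip_bop K.ip_bop has_coeffs_def sum.distrib)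
    qed
    then show "F \<oplus>\<^bsub>bop L\<^esub> F' \<in> ?W" using F F' by (auto simp: L.bop_add_closed)
  qed
  moreover have "{tens A t | A t. A \<in> supp_mats N R \<and> t \<in> T} \<subseteq> ?W"
  proof clarify
    fix A t assume A: "A \<in> supp_mats N R" and t: "t \<in> T"
    have "has_coeffs (tens A t) (\<lambda>i j. A $$ (i, j) \<odot>\<^bsub>bop K\<^esub> t)"
      unfolding has_coeffs_def
    proof (intro conjI allI impI ballI)
      fix i j assume ij: "i < N" "j < N"
      show "A $$ (i, j) \<odot>\<^bsub>bop K\<^esub> t \<in> T" using t by (rule T_smult)
      assume "\<not> R i j"
      then show "A $$ (i, j) \<odot>\<^bsub>bop K\<^esub> t = \<zero>\<^bsub>bop K\<^esub>"
        using ij A K.bop.smult_l_null[OF T_bop[OF t]] by (simp add: supp_mats_def)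
    next
      fix z w assume zw: "z \<in> carrier L" "w \<in> carrier L"
      then show "ip L (tens A t z) w = (\<Sum>i<N. \<Sum>j<N. ip K ((A $$ (i, j) \<odot>\<^bsub>bop K\<^esub> t) (crd z j)) (crd w i))"
        using T_bop[OF t] by (simp add: ip_tens K.ip_bop)
    qed
    then show "tens A t \<in> carrier (bop L) \<and> (\<exists>t'. has_coeffs (tens A t) t')"
      using T_bop[OF t] by (auto simp: tens_closed)
  qed
  ultimately have "alg_tensor H K L \<tau> S T \<subseteq> ?W"
    unfolding alg_tensor_eq by (intro L.bop.span_is_subset)
  then show ?thesis using assms that by blast
qed

lemma one_mats: "1\<^sub>m N \<in> supp_mats N R"
  using refl_R by (auto simp: supp_mats_def)

lemma op_tensor_one: "op_tensor H K L \<tau> \<one>\<^bsub>bop H\<^esub> \<one>\<^bsub>bop K\<^esub> = \<one>\<^bsub>bop L\<^esub>"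
proof -
  have "\<one>\<^bsub>bop H\<^esub> = mat_op N (1\<^sub>m N)"
    by (auto simp: bop_def mat_op_def)
  then have "op_tensor H K L \<tau> \<one>\<^bsub>bop H\<^esub> \<one>\<^bsub>bop K\<^esub> = tens (1\<^sub>m N) \<one>\<^bsub>bop K\<^esub>"
    by (simp add: op_tensor_eq K.bop_one_closed)
  also have "\<dots> = \<one>\<^bsub>bop L\<^esub>"
    by (rule L.bop_ext) (auto simp: tens_closed K.bop_one_closed L.bop_one_closed ip_tens ip_L
        K.bop_one_app L.bop_one_app if_distrib[of "\<lambda>x. x * _"] cong: if_cong)
  finally show ?thesis .
qed

lemma one_alg: "\<one>\<^bsub>bop L\<^esub> \<in> alg_tensor H K L \<tau> S T"
proof -
  have "\<one>\<^bsub>bop H\<^esub> = mat_op N (1\<^sub>m N)"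
    by (auto simp: bop_def mat_op_def)
  then have "\<one>\<^bsub>bop L\<^esub> = tens (1\<^sub>m N) \<one>\<^bsub>bop K\<^esub>"
    using op_tensor_one by (simp add: op_tensor_eq K.bop_one_closed)
  then show ?thesis using tens_alg[OF one_mats T_one] by simp
qed

text \<open>A k by k matrix over N by N matrices is a scalar kernel on pairs (block index, vertex);
  positivity is tested on vectors with entries \<open>c (p, i)\<close>.\<close>

lemma pos_cone_S:
  assumes "P \<in> pos_cone H S k"
  obtains B where "\<And>p q. \<lbrakk>p < k; q < k\<rbrakk> \<Longrightarrow> B p q \<in> supp_mats N R"
    "\<And>p q. \<lbrakk>p < k; q < k\<rbrakk> \<Longrightarrow> P $$ (p, q) = mat_op N (B p q)"
    "psd ({..<k} \<times> {..<N}) (\<lambda>x y. B (fst x) (fst y) $$ (snd x, snd y))"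
proof -
  have "\<forall>p q. \<exists>A. p < k \<and> q < k \<longrightarrow> A \<in> supp_mats N R \<and> P $$ (p, q) = mat_op N A"
    using assms by (auto simp: pos_cone_def sq_mats_def image_iff)
  then obtain B where B: "\<And>p q. \<lbrakk>p < k; q < k\<rbrakk> \<Longrightarrow> B p q \<in> supp_mats N R"
    "\<And>p q. \<lbrakk>p < k; q < k\<rbrakk> \<Longrightarrow> P $$ (p, q) = mat_op N (B p q)" by metis
  have "psd ({..<k} \<times> {..<N}) (\<lambda>x y. B (fst x) (fst y) $$ (snd x, snd y))"
    unfolding psd_def
  proof
    fix c :: "nat \<times> nat \<Rightarrow> complex"
    let ?v = "\<lambda>p. vec N (\<lambda>i. c (p, i))"
    have "0 \<le> (\<Sum>p<k. \<Sum>q<k. ip H ((P $$ (p, q)) (?v q)) (?v p))"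
      using assms unfolding pos_cone_def pos_op_mat_def by auto
    also have "\<dots> = (\<Sum>p<k. \<Sum>q<k. \<Sum>i<N. \<Sum>j<N. B p q $$ (i, j) * c (q, j) * cnj (c (p, i)))"
    proof (intro sum.cong refl)
      fix p q assume "p \<in> {..<k}" "q \<in> {..<k}"
      then have pq: "p < k" "q < k" by auto
      then have Bc: "B p q \<in> carrier_mat N N" using B(1) supp_carrier by auto
      then show "ip H ((P $$ (p, q)) (?v q)) (?v p) = (\<Sum>i<N. \<Sum>j<N. B p q $$ (i, j) * c (q, j) * cnj (c (p, i)))"
        using pq B(2) by (simp add: mat_op_apply cscalar_prod_sum[of _ N] mult_mat_vec_nth
            sum_distrib_right del: index_mult_mat_vec)
    qed
    also have "\<dots> = (\<Sum>p<k. \<Sum>i<N. \<Sum>q<k. \<Sum>j<N. B p q $$ (i, j) * c (q, j) * cnj (c (p, i)))"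
      by (intro sum.cong refl sum.swap)
    finally show "0 \<le> (\<Sum>x\<in>{..<k} \<times> {..<N}. \<Sum>y\<in>{..<k} \<times> {..<N}.
        B (fst x) (fst y) $$ (snd x, snd y) * c y * cnj (c x))"
      by (simp add: sum.cartesian_product' )
  qed
  then show ?thesis using B that by blast
qed

lemma pos_cone_T: "Q \<in> pos_cone K T m \<Longrightarrow> pos_op_mat K m Q"
  "\<lbrakk>Q \<in> pos_cone K T m; p < m; q < m\<rbrakk> \<Longrightarrow> Q $$ (p, q) \<in> carrier (bop K)"
  by (auto simp: pos_cone_def sq_mats_def T_bop)

lemma mat_tensor_entry:
  assumes B: "\<And>p q. \<lbrakk>p < k; q < k\<rbrakk> \<Longrightarrow> B p q \<in> supp_mats N R"
      "\<And>p q. \<lbrakk>p < k; q < k\<rbrakk> \<Longrightarrow> P $$ (p, q) = mat_op N (B p q)"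
    and Q: "\<And>p q. \<lbrakk>p < m; q < m\<rbrakk> \<Longrightarrow> Q $$ (p, q) \<in> carrier (bop K)"
    and pq: "p < k * m" "q < k * m"
  shows "mat_tensor H K L \<tau> k m P Q $$ (p, q)
    = tens (B (p div m) (q div m)) (Q $$ (p mod m, q mod m))"
proof -
  have "m > 0" using pq by (cases m) auto
  then have "p div m < k" "q div m < k" "p mod m < m" "q mod m < m"
    using pq by (auto simp: less_mult_imp_div_less)
  then show ?thesis
    using pq B Q supp_carrier by (simp add: mat_tensor_def op_tensor_eq)
qed

text \<open>In coordinates the form of \<open>P\<close> tensor \<open>Q\<close> at \<open>v\<close>
  is the entrywise pairing of two psd kernels on pairs (p, i): the entries of \<open>P\<close>, and
  the form of \<open>Q\<close> on the coordinates of \<open>v\<close>. So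
  \<open>psd_schur_sum\<close> applies.\<close>

lemma mat_tensor_pos:
  assumes P: "P \<in> pos_cone H S k" and Q: "Q \<in> pos_cone K T m"
  shows "pos_op_mat L (k * m) (mat_tensor H K L \<tau> k m P Q)"
    and "\<lbrakk>p < k * m; q < k * m\<rbrakk> \<Longrightarrow> mat_tensor H K L \<tau> k m P Q $$ (p, q) \<in> carrier (bop L)"
proof -
  obtain B where B: "\<And>p q. \<lbrakk>p < k; q < k\<rbrakk> \<Longrightarrow> B p q \<in> supp_mats N R"
    "\<And>p q. \<lbrakk>p < k; q < k\<rbrakk> \<Longrightarrow> P $$ (p, q) = mat_op N (B p q)"
    "psd ({..<k} \<times> {..<N}) (\<lambda>x y. B (fst x) (fst y) $$ (snd x, snd y))"
    by (rule pos_cone_S[OF P]) blast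
  note entry = mat_tensor_entry[where B = B and P = P and Q = Q and k = k and m = m,
      OF B(1,2) pos_cone_T(2)[OF Q]]
  have pm: "p div m < k" "p mod m < m" if "p < k * m" for p
  proof -
    have "m > 0" using that by (cases m) auto
    then show "p div m < k" "p mod m < m" using that by (auto simp: less_mult_imp_div_less)
  qed
  show "mat_tensor H K L \<tau> k m P Q $$ (p, q) \<in> carrier (bop L)" if "p < k * m" "q < k * m" for p q
    using that pm pos_cone_T(2)[OF Q] by (simp add: entry tens_closed)
  show "pos_op_mat L (k * m) (mat_tensor H K L \<tau> k m P Q)"
    unfolding pos_op_mat_def
  proof
    fix v assume v: "v \<in> {..<k * m} \<rightarrow> carrier L"
    \<comment> \<open>For y = (p, i) this is the i-th coordinate of the component of
      \<open>v\<close> at the Kronecker index of (p, q).\<close>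
    define u where "u y q = crd (v (fst y * m + q)) (snd y)" for y :: "nat \<times> nat" and q
    have idx: "a * m + b < k * m" if "a < k" "b < m" for a b
      using that mult_le_mono1[of "Suc a" k m] by simp
    let ?J = "{..<k} \<times> {..<N}"
    have "psd ?J (\<lambda>x y. \<Sum>p<m. \<Sum>q<m. ip K ((Q $$ (p, q)) (u y q)) (u x p))"
      using v idx by (intro K.psd_of_pos_op_mat pos_cone_T[OF Q]) (auto simp: u_def Pi_iff)
    from psd_schur_sum[OF B(3) _ this]
    have "0 \<le> (\<Sum>x\<in>?J. \<Sum>y\<in>?J. B (fst x) (fst y) $$ (snd x, snd y) *
        (\<Sum>p<m. \<Sum>q<m. ip K ((Q $$ (p, q)) (u y q)) (u x p)))"
      by simp
    also have "\<dots> = (\<Sum>p<k. \<Sum>i<N. \<Sum>q<k. \<Sum>j<N. \<Sum>p'<m. \<Sum>q'<m.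
        B p q $$ (i, j) * ip K ((Q $$ (p', q')) (u (q, j) q')) (u (p, i) p'))"
      by (simp add: sum.cartesian_product' sum_distrib_left)
    also have "\<dots> = (\<Sum>p<k. \<Sum>p'<m. \<Sum>q<k. \<Sum>q'<m. \<Sum>i<N. \<Sum>j<N.
        B p q $$ (i, j) * ip K ((Q $$ (p', q')) (u (q, j) q')) (u (p, i) p'))"
      by (rule sum_reorder[symmetric])
    also have "\<dots> = (\<Sum>p<k. \<Sum>p'<m. \<Sum>q<k. \<Sum>q'<m.
        ip L ((mat_tensor H K L \<tau> k m P Q $$ (p * m + p', q * m + q')) (v (q * m + q'))) (v (p * m + p')))"
    proof (intro sum.cong refl)
      fix p p' q q' assume "p \<in> {..<k}" "p' \<in> {..<m}" "q \<in> {..<k}" "q' \<in> {..<m}"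
      then show "(\<Sum>i<N. \<Sum>j<N. B p q $$ (i, j) * ip K ((Q $$ (p', q')) (u (q, j) q')) (u (p, i) p'))
        = ip L ((mat_tensor H K L \<tau> k m P Q $$ (p * m + p', q * m + q')) (v (q * m + q'))) (v (p * m + p'))"
        using v idx pos_cone_T(2)[OF Q] by (simp add: entry ip_tens u_def Pi_iff)
    qed
    also have "\<dots> = (\<Sum>p<k * m. \<Sum>q<k * m. ip L ((mat_tensor H K L \<tau> k m P Q $$ (p, q)) (v q)) (v p))"
      by (simp add: sum_lessThan_mult)
    finally show "0 \<le> (\<Sum>p<k * m. \<Sum>q<k * m. ip L ((mat_tensor H K L \<tau> k m P Q $$ (p, q)) (v q)) (v p))" .
  qed
qed

lemma D_max_pos: "X \<in> D_max H K L \<tau> S T n \<Longrightarrow> pos_op_mat L n X"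
  unfolding D_max_def using mat_tensor_pos by (auto intro!: L.pos_op_mat_conj)

section \<open>Perturbation by multiples of the unit\<close>

definition add_unit :: "nat \<Rightarrow> real \<Rightarrow> ('w \<Rightarrow> 'w) mat \<Rightarrow> ('w \<Rightarrow> 'w) mat" where
  "add_unit n r X = mat n n (\<lambda>(i, j).
    (if i = j then complex_of_real r \<odot>\<^bsub>bop L\<^esub> op_tensor H K L \<tau> \<one>\<^bsub>bop H\<^esub> \<one>\<^bsub>bop K\<^esub>
     else \<zero>\<^bsub>bop L\<^esub>) \<oplus>\<^bsub>bop L\<^esub> X $$ (i, j))"

lemma max_cone_iff:
  "X \<in> max_cone H K L \<tau> S T n \<longleftrightarrow> X \<in> sq_mats n (alg_tensor H K L \<tau> S T) \<and>
    (\<forall>r>0. add_unit n r X \<in> D_max H K L \<tau> S T n)"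
  by (simp add: max_cone_def add_unit_def)

lemma add_unit_entry:
  assumes "i < n" "j < n"
  shows "add_unit n r X $$ (i, j) = (if i = j then complex_of_real r \<odot>\<^bsub>bop L\<^esub> \<one>\<^bsub>bop L\<^esub>
     else \<zero>\<^bsub>bop L\<^esub>) \<oplus>\<^bsub>bop L\<^esub> X $$ (i, j)"
  using assms by (simp add: add_unit_def op_tensor_one)

lemma add_unit_form:
  assumes X: "\<And>i j. \<lbrakk>i < n; j < n\<rbrakk> \<Longrightarrow> X $$ (i, j) \<in> carrier (bop L)"
    and v: "v \<in> {..<n} \<rightarrow> carrier L"
  shows "(\<Sum>i<n. \<Sum>j<n. ip L ((add_unit n r X $$ (i, j)) (v j)) (v i))
    = of_real (r * (\<Sum>i<n. (vnorm L (v i))\<^sup>2)) + (\<Sum>i<n. \<Sum>j<n. ip L ((X $$ (i, j)) (v j)) (v i))"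
proof -
  have "(\<Sum>i<n. \<Sum>j<n. ip L ((add_unit n r X $$ (i, j)) (v j)) (v i))
    = (\<Sum>i<n. \<Sum>j<n. (if i = j then of_real (r * (vnorm L (v i))\<^sup>2) else 0)
        + ip L ((X $$ (i, j)) (v j)) (v i))"
  proof (intro sum.cong refl)
    fix i j assume "i \<in> {..<n}" "j \<in> {..<n}"
    then have ij: "i < n" "j < n" "v i \<in> carrier L" "v j \<in> carrier L" using v by auto
    show "ip L ((add_unit n r X $$ (i, j)) (v j)) (v i)
      = (if i = j then of_real (r * (vnorm L (v i))\<^sup>2) else 0) + ip L ((X $$ (i, j)) (v j)) (v i)"
      using ij X[of i j]
      by (auto simp: add_unit_entry L.ip_bop L.bop_smult_closed L.bop_one_closed L.bop_zero_closed
          L.bop_one_app L.bop_zero_app L.ip_self)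
  qed
  then show ?thesis by (simp add: sum.distrib sum_distrib_left)
qed

text \<open>Elements of \<open>D_max\<close> are positive operators, so the form of \<open>X\<close>
  plus r times a squared norm is nonnegative for every r > 0; letting r tend to 0 gives positivity
  of \<open>X\<close>.\<close>

lemma max_subset_min: "max_cone H K L \<tau> S T n \<subseteq> min_cone H K L \<tau> S T n"
proof
  fix X assume X: "X \<in> max_cone H K L \<tau> S T n"
  then have Xs: "X \<in> sq_mats n (alg_tensor H K L \<tau> S T)" by (simp add: max_cone_def)
  then have Xb: "X $$ (i, j) \<in> carrier (bop L)" if "i < n" "j < n" for i j
    using that alg_bop by (simp add: sq_mats_def)
  have "pos_op_mat L n X"
    unfolding pos_op_mat_def
  proof
    fix v assume v: "v \<in> {..<n} \<rightarrow> carrier L"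
    let ?f = "\<Sum>i<n. \<Sum>j<n. ip L ((X $$ (i, j)) (v j)) (v i)"
    let ?n = "\<Sum>i<n. (vnorm L (v i))\<^sup>2"
    have *: "0 \<le> of_real (r * ?n) + ?f" if "r > 0" for r :: real
    proof -
      have "add_unit n r X \<in> D_max H K L \<tau> S T n"
        using X that by (simp add: max_cone_iff)
      then have "0 \<le> (\<Sum>i<n. \<Sum>j<n. ip L ((add_unit n r X $$ (i, j)) (v j)) (v i))"
        using D_max_pos v unfolding pos_op_mat_def by blast
      then show ?thesis using add_unit_form[OF Xb v] by simp
    qed
    have "Im ?f = 0" using *[of 1] by (simp add: less_eq_complex_def)
    moreover have "0 \<le> Re ?f"
    proof (rule field_le_epsilon)
      fix e :: real assume e: "e > 0"
      have n: "?n \<ge> 0" by (simp add: sum_nonneg)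
      \<comment> \<open>The added 1 keeps the denominator positive when all test vectors are
        zero.\<close>
      have "0 \<le> e / (?n + 1) * ?n + Re ?f"
        using *[of "e / (?n + 1)"] e n by (simp add: less_eq_complex_def)
      moreover have "e / (?n + 1) * ?n \<le> e" using e n by (simp add: field_simps)
      ultimately show "0 \<le> Re ?f + e" by linarith
    qed
    ultimately show "0 \<le> ?f" by (simp add: less_eq_complex_def)
  qed
  then show "X \<in> min_cone H K L \<tau> S T n"
    using Xs by (simp add: min_cone_def pos_cone_def)
qed

text \<open>Membership in the maximal cone asks for factorisations of the perturbed matrices. Since
  these remain in the minimal cone, it suffices to factor elements of the minimal cone.\<close>

lemma min_add_unit:
  assumes X: "X \<in> min_cone H K L \<tau> S T n" and r: "r > 0"
  shows "add_unit n r X \<in> min_cone H K L \<tau> S T n"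
proof -
  have Xs: "X \<in> sq_mats n (alg_tensor H K L \<tau> S T)" and Xp: "pos_op_mat L n X"
    using X by (auto simp: min_cone_def pos_cone_def)
  then have Xa: "X $$ (i, j) \<in> alg_tensor H K L \<tau> S T" if "i < n" "j < n" for i j
    using that by (simp add: sq_mats_def)
  then have Xb: "X $$ (i, j) \<in> carrier (bop L)" if "i < n" "j < n" for i j
    using that by (simp add: alg_bop)
  have "add_unit n r X \<in> carrier_mat n n" by (simp add: add_unit_def)
  then have "add_unit n r X \<in> sq_mats n (alg_tensor H K L \<tau> S T)"
    using Xa by (auto simp: sq_mats_def add_unit_entry intro!: alg_add alg_smult alg_zero one_alg)
  moreover have "pos_op_mat L n (add_unit n r X)"
    unfolding pos_op_mat_def
  proof
    fix v assume v: "v \<in> {..<n} \<rightarrow> carrier L"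
    have form: "(\<Sum>i<n. \<Sum>j<n. ip L ((add_unit n r X $$ (i, j)) (v j)) (v i))
      = of_real (r * (\<Sum>i<n. (vnorm L (v i))\<^sup>2)) + (\<Sum>i<n. \<Sum>j<n. ip L ((X $$ (i, j)) (v j)) (v i))"
      using Xb v by (rule add_unit_form)
    have "0 \<le> complex_of_real (r * (\<Sum>i<n. (vnorm L (v i))\<^sup>2))"
      using r by (simp add: less_eq_complex_def sum_nonneg)
    moreover have "0 \<le> (\<Sum>i<n. \<Sum>j<n. ip L ((X $$ (i, j)) (v j)) (v i))"
      using Xp v unfolding pos_op_mat_def by blast
    ultimately show "0 \<le> (\<Sum>i<n. \<Sum>j<n. ip L ((add_unit n r X $$ (i, j)) (v j)) (v i))"
      unfolding form by (rule add_nonneg_nonneg)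
  qed
  ultimately show ?thesis by (simp add: min_cone_def pos_cone_def)
qed

section \<open>Factorisation over an equivalence relation\<close>

lemma unit_mats: "R i j \<Longrightarrow> unit_mat N i j \<in> supp_mats N R"
  and zero_mats: "0\<^sub>m N N \<in> supp_mats N R"
  by (auto simp: supp_mats_def unit_mat_def)

text \<open>The form at \<open>v\<close> is the sum over the classes of \<open>R\<close> of |s|^2,
  where s is the sum of the entries \<open>v i $ i\<close> over the class.\<close>

lemma block_unit_pos_cone:
  assumes tr: "\<And>i j k. \<lbrakk>R i j; R j k\<rbrakk> \<Longrightarrow> R i k" and sym: "\<And>i j. R i j \<Longrightarrow> R j i"
  shows "mat N N (\<lambda>(i, j). mat_op N (if R i j then unit_mat N i j else 0\<^sub>m N N)) \<in> pos_cone H S N"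
proof -
  \<comment> \<open>The least member labels each class by an index not above \<open>i\<close>, hence
    below \<open>N\<close>, so classes can be summed over \<open>{..<N}\<close>.\<close>
  define \<rho> where "\<rho> i = (LEAST k. R i k)" for i
  have \<rho>: "R i (\<rho> i)" "\<rho> i \<le> i" for i
    unfolding \<rho>_def using refl_R by (auto intro: LeastI Least_le)
  have R\<rho>: "R i j \<longleftrightarrow> \<rho> i = \<rho> j" for i j
  proof
    assume "R i j"
    then have "R i k \<longleftrightarrow> R j k" for k using tr sym by blast
    then show "\<rho> i = \<rho> j" by (simp add: \<rho>_def)
  next
    assume "\<rho> i = \<rho> j"
    then show "R i j" using \<rho>(1)[of i] \<rho>(1)[of j] tr sym by metis
  qed
  let ?P = "mat N N (\<lambda>(i, j). mat_op N (if R i j then unit_mat N i j else 0\<^sub>m N N))"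
  have "pos_op_mat H N ?P"
    unfolding pos_op_mat_def
  proof
    fix v assume "v \<in> {..<N} \<rightarrow> carrier H"
    then have v: "v i \<in> carrier_vec N" if "i < N" for i using that by auto
    \<comment> \<open>One vector per class, whose outer products add up to the kernel of the
      form.\<close>
    define w where "w k i = (if \<rho> i = k then cnj (v i $ i) else 0)" for k i
    have "ip H ((?P $$ (i, j)) (v j)) (v i) = (\<Sum>k<N. w k i * cnj (w k j))" if "i < N" "j < N" for i j
    proof -
      have "ip H ((?P $$ (i, j)) (v j)) (v i) = (if R i j then v j $ j * cnj (v i $ i) else 0)"
      proof (cases "R i j")
        case True
        have "(unit_mat N i j *\<^sub>v v j) $ p = (if p = i then v j $ j else 0)" if "p < N" for p
          using that v[OF \<open>j < N\<close>] \<open>j < N\<close>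
          by (subst mult_mat_vec_nth) (auto simp: unit_mat_def if_distrib[of "\<lambda>x. x * _"] cong: if_cong)
        moreover have "unit_mat N i j *\<^sub>v v j \<in> carrier_vec N"
          by (simp add: unit_mat_def carrier_vecI)
        ultimately have "(unit_mat N i j *\<^sub>v v j) \<bullet>c v i = v j $ j * cnj (v i $ i)"
          using v[OF \<open>i < N\<close>] \<open>i < N\<close>
          by (subst cscalar_prod_sum[of _ N]) (auto simp: if_mult)
        then show ?thesis using True that v by (simp add: mat_op_apply)
      next
        case False
        have "0\<^sub>m N N *\<^sub>v v j = 0\<^sub>v N"
          using v[OF \<open>j < N\<close>] by (intro eq_vecI) (auto simp: mult_mat_vec_nth[of _ N] simp del: index_mult_mat_vec)
        then show ?thesis using False that v by (simp add: mat_op_apply cscalar_prod_sum[of _ N])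
      qed
      also have "\<dots> = (\<Sum>k<N. if k = \<rho> i then (if \<rho> i = \<rho> j then v j $ j * cnj (v i $ i) else 0) else 0)"
        using \<rho>(2)[of i] that by (simp add: R\<rho>)
      also have "\<dots> = (\<Sum>k<N. w k i * cnj (w k j))"
        by (intro sum.cong refl) (auto simp: w_def)
      finally show ?thesis .
    qed
    then have "(\<Sum>i<N. \<Sum>j<N. ip H ((?P $$ (i, j)) (v j)) (v i)) = (\<Sum>i<N. \<Sum>j<N. \<Sum>k<N. w k i * cnj (w k j))"
      by (simp del: index_mat)
    then show "0 \<le> (\<Sum>i<N. \<Sum>j<N. ip H ((?P $$ (i, j)) (v j)) (v i))"
      using psdD[OF psd_outer[of "{..<N}" w "{..<N}"], of "\<lambda>_. 1"] by simp
  qed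
  moreover have "?P \<in> sq_mats N S"
    using unit_mats zero_mats by (auto simp: sq_mats_def)
  ultimately show ?thesis by (simp add: pos_cone_def)
qed

text \<open>With \<open>X = \<Sum> E\<^sub>i\<^sub>j \<otimes> X\<^sub>i\<^sub>j\<close> the block matrix \<open>Q = (X\<^sub>i\<^sub>j)\<close> is positive whenever \<open>X\<close> is, and
  \<open>P = (E\<^sub>i\<^sub>j)\<close>, restricted to \<open>R\<close>, is positive because \<open>R\<close> is an equivalence relation. Selecting the
  entries of \<open>P \<otimes> Q\<close> with matching indices recovers \<open>X\<close>.\<close>

lemma min_subset_D_max:
  assumes tr: "\<And>i j k. \<lbrakk>R i j; R j k\<rbrakk> \<Longrightarrow> R i k" and sym: "\<And>i j. R i j \<Longrightarrow> R j i"
    and X: "X \<in> min_cone H K L \<tau> S T n"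
  shows "X \<in> D_max H K L \<tau> S T n"
proof -
  have Xc: "X \<in> carrier_mat n n"
    and Xa: "\<And>a b. \<lbrakk>a < n; b < n\<rbrakk> \<Longrightarrow> X $$ (a, b) \<in> alg_tensor H K L \<tau> S T"
    and Xp: "pos_op_mat L n X"
    using X by (auto simp: min_cone_def pos_cone_def sq_mats_def)
  have "\<forall>a b. \<exists>t. a < n \<and> b < n \<longrightarrow> has_coeffs (X $$ (a, b)) t"
    using alg_coeffs[OF Xa] by metis
  then obtain t where t: "\<And>a b. \<lbrakk>a < n; b < n\<rbrakk> \<Longrightarrow> has_coeffs (X $$ (a, b)) (t a b)" by metis
  have tT: "t a b i j \<in> T" if "a < n" "b < n" "i < N" "j < N" for a b i j
    using t that by (simp add: has_coeffs_def)
  \<comment> \<open>The rows of \<open>Q\<close> are indexed by pairs of a vertex \<open>i\<close>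
    and a matrix level \<open>a\<close>, encoded as \<open>i * n + a\<close>.\<close>
  define m where "m = N * n"
  define P where "P = mat N N (\<lambda>(i, j). mat_op N (if R i j then unit_mat N i j else 0\<^sub>m N N))"
  define Q where "Q = mat m m (\<lambda>(p, q). t (p mod n) (q mod n) (p div n) (q div n))"
  \<comment> \<open>A row of the Kronecker product is a triple (i, (j, b)) with \<open>i\<close>
    from \<open>P\<close> and (j, b) from \<open>Q\<close>; row \<open>a\<close> of
    \<open>\<alpha>\<close> keeps those with j = i and b = a.\<close>
  define \<alpha> where "\<alpha> = mat n (N * m) (\<lambda>(a, p). if p div m = p mod m div n \<and> p mod m mod n = a
    then 1 else 0 :: complex)"
  have idx: "i * n + a < m" if "i < N" "a < n" for i a
    using that mult_le_mono1[of "Suc i" N n] by (simp add: m_def)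
  have Qi: "Q $$ (i * n + a, j * n + b) = t a b i j" if "a < n" "b < n" "i < N" "j < N" for a b i j
    using that idx by (simp add: Q_def)
  have "P \<in> pos_cone H S N" unfolding P_def using tr sym by (rule block_unit_pos_cone)
  moreover have "Q \<in> pos_cone K T m"
  proof -
    have "Q $$ (p, q) \<in> T" if "p < m" "q < m" for p q
    proof -
      have "n > 0" using that by (cases n) (auto simp: m_def)
      then show ?thesis using that tT by (auto simp: Q_def m_def less_mult_imp_div_less)
    qed
    then have "Q \<in> sq_mats m T" by (auto simp: sq_mats_def Q_def)
    moreover have "pos_op_mat K m Q"
      unfolding pos_op_mat_def
    proof
      fix v assume v: "v \<in> {..<m} \<rightarrow> carrier K"
      \<comment> \<open>Regrouping \<open>v\<close> by level gives \<open>n\<close> vectors of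
        \<open>L\<close>; the form of \<open>Q\<close> at \<open>v\<close> is the form of
        \<open>X\<close> at \<open>z\<close>.\<close>
      define z where "z a = comb (\<lambda>i. v (i * n + a))" for a
      have vc: "(\<lambda>i. v (i * n + a)) \<in> {..<N} \<rightarrow> carrier K" if "a < n" for a
        using v idx that by (auto simp: Pi_iff)
      then have z: "z a \<in> carrier L" if "a < n" for a using that by (simp add: z_def)
      have cz: "crd (z a) i = v (i * n + a)" if "a < n" "i < N" for a i
        using that vc by (simp add: z_def crd_comb)
      have "0 \<le> (\<Sum>a<n. \<Sum>b<n. ip L ((X $$ (a, b)) (z b)) (z a))"
        using Xp z unfolding pos_op_mat_def by (auto simp: Pi_iff)
      also have "\<dots> = (\<Sum>a<n. \<Sum>b<n. \<Sum>i<N. \<Sum>j<N. ip K (t a b i j (v (j * n + b))) (v (i * n + a)))"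
      proof (intro sum.cong refl)
        fix a b assume ab: "a \<in> {..<n}" "b \<in> {..<n}"
        then have "ip L ((X $$ (a, b)) (z b)) (z a) = (\<Sum>i<N. \<Sum>j<N. ip K (t a b i j (crd (z b) j)) (crd (z a) i))"
          using t z unfolding has_coeffs_def by auto
        also have "\<dots> = (\<Sum>i<N. \<Sum>j<N. ip K (t a b i j (v (j * n + b))) (v (i * n + a)))"
          using ab cz by (intro sum.cong refl) auto
        finally show "ip L ((X $$ (a, b)) (z b)) (z a) = \<dots>" .
      qed
      also have "\<dots> = (\<Sum>i<N. \<Sum>a<n. \<Sum>j<N. \<Sum>b<n. ip K (t a b i j (v (j * n + b))) (v (i * n + a)))"
        unfolding sum.cartesian_product
        by (rule sum.reindex_bij_witness[where i = "\<lambda>(i, a, j, b). (a, b, i, j)"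
              and j = "\<lambda>(a, b, i, j). (i, a, j, b)"]) auto
      also have "\<dots> = (\<Sum>i<N. \<Sum>a<n. \<Sum>j<N. \<Sum>b<n.
          ip K ((Q $$ (i * n + a, j * n + b)) (v (j * n + b))) (v (i * n + a)))"
        by (simp add: Qi)
      also have "\<dots> = (\<Sum>p<m. \<Sum>q<m. ip K ((Q $$ (p, q)) (v q)) (v p))"
        by (simp add: m_def sum_lessThan_mult)
      finally show "0 \<le> (\<Sum>p<m. \<Sum>q<m. ip K ((Q $$ (p, q)) (v q)) (v p))" .
    qed
    ultimately show ?thesis by (simp add: pos_cone_def)
  qed
  moreover have "X = mat_conj L n (N * m) \<alpha> (mat_tensor H K L \<tau> N m P Q)"
  proof (rule eq_matI)
    show "dim_row X = dim_row (mat_conj L n (N * m) \<alpha> (mat_tensor H K L \<tau> N m P Q))"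
      "dim_col X = dim_col (mat_conj L n (N * m) \<alpha> (mat_tensor H K L \<tau> N m P Q))"
      using Xc by (auto simp: mat_conj_def)
    fix a b assume "a < dim_row (mat_conj L n (N * m) \<alpha> (mat_tensor H K L \<tau> N m P Q))"
      "b < dim_col (mat_conj L n (N * m) \<alpha> (mat_tensor H K L \<tau> N m P Q))"
    then have ab: "a < n" "b < n" by (auto simp: mat_conj_def)
    let ?M = "mat_tensor H K L \<tau> N m P Q"
    note Mb = mat_tensor_pos(2)[OF \<open>P \<in> pos_cone H S N\<close> \<open>Q \<in> pos_cone K T m\<close>]
    \<comment> \<open>The Kronecker index of (i, (i, a)), that is, the i-th position at which row
      \<open>a\<close> of \<open>\<alpha>\<close> is 1.\<close>
    define \<iota> where "\<iota> i a = i * m + (i * n + a)" for i a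
    have pick: "(\<Sum>p<N * m. \<alpha> $$ (a, p) * g p) = (\<Sum>i<N. g (\<iota> i a))"
      "(\<Sum>p<N * m. cnj (\<alpha> $$ (a, p)) * g p) = (\<Sum>i<N. g (\<iota> i a))" if "a < n" for a g
    proof -
      have \<alpha>i: "\<alpha> $$ (a, i * m + (j * n + b)) = (if j = i \<and> b = a then 1 else 0)"
        if "i < N" "j < N" "b < n" for i j b
      proof -
        have "i * m + (j * n + b) < N * m"
          using idx[OF that(2,3)] mult_le_mono1[of "Suc i" N m] that by simp
        then show ?thesis using idx[OF that(2,3)] that \<open>a < n\<close> by (auto simp: \<alpha>_def)
      qed
      have e: "(\<Sum>j<N. \<Sum>b<n. (if j = i \<and> b = a then 1 else 0) * g (i * m + (j * n + b))) = g (\<iota> i a)"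
        if "i < N" for i
      proof -
        have "(\<Sum>j<N. \<Sum>b<n. (if j = i \<and> b = a then 1 else 0) * g (i * m + (j * n + b)))
          = (\<Sum>j<N. if j = i then \<Sum>b<n. if b = a then g (i * m + (j * n + b)) else 0 else 0)"
          by (intro sum.cong refl) (auto simp: if_mult)
        then show ?thesis
          using that \<open>a < n\<close> by (simp add: \<iota>_def if_mult)
      qed
      show "(\<Sum>p<N * m. \<alpha> $$ (a, p) * g p) = (\<Sum>i<N. g (\<iota> i a))"
        by (simp add: sum_lessThan_mult[of _ N m], simp add: m_def sum_lessThan_mult[of _ N n])
          (simp add: m_def[symmetric] \<alpha>i e)
      show "(\<Sum>p<N * m. cnj (\<alpha> $$ (a, p)) * g p) = (\<Sum>i<N. g (\<iota> i a))"
        by (simp add: sum_lessThan_mult[of _ N m], simp add: m_def sum_lessThan_mult[of _ N n])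
          (simp add: m_def[symmetric] \<alpha>i e if_distrib[of cnj] cong: if_cong)
    qed
    have \<iota>: "\<iota> i a < N * m" "\<iota> i a div m = i" "\<iota> i a mod m = i * n + a" if "i < N" "a < n" for i a
      using idx[OF that] mult_le_mono1[of "Suc i" N m] that by (auto simp: \<iota>_def)
    have Me: "?M $$ (\<iota> i a, \<iota> j b) = tens (if R i j then unit_mat N i j else 0\<^sub>m N N) (t a b i j)"
      if "i < N" "j < N" for i j
    proof -
      have "?M $$ (\<iota> i a, \<iota> j b) = op_tensor H K L \<tau> (P $$ (i, j)) (Q $$ (i * n + a, j * n + b))"
        using \<iota> that ab by (simp add: mat_tensor_def)
      then show ?thesis
        using that ab T_bop[OF tT] by (simp add: Qi P_def op_tensor_eq unit_mat_def)
    qed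
    show "X $$ (a, b) = mat_conj L n (N * m) \<alpha> ?M $$ (a, b)"
    proof (rule L.bop_ext)
      show "X $$ (a, b) \<in> carrier (bop L)" using Xa ab alg_bop by auto
      show "mat_conj L n (N * m) \<alpha> ?M $$ (a, b) \<in> carrier (bop L)"
        using ab Mb by (intro L.mat_conj_entry)
      fix z w assume zw: "z \<in> carrier L" "w \<in> carrier L"
      have "ip L ((mat_conj L n (N * m) \<alpha> ?M $$ (a, b)) z) w
        = (\<Sum>p<N * m. \<Sum>q<N * m. \<alpha> $$ (a, p) * cnj (\<alpha> $$ (b, q)) * ip L ((?M $$ (p, q)) z) w)"
        using ab Mb zw by (intro L.mat_conj_entry(2))
      also have "\<dots> = (\<Sum>p<N * m. \<alpha> $$ (a, p) * (\<Sum>q<N * m. cnj (\<alpha> $$ (b, q)) * ip L ((?M $$ (p, q)) z) w))"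
        by (simp add: sum_distrib_left mult.assoc)
      also have "\<dots> = (\<Sum>i<N. \<Sum>j<N. ip L ((?M $$ (\<iota> i a, \<iota> j b)) z) w)"
        using ab by (simp add: pick)
      also have "\<dots> = (\<Sum>i<N. \<Sum>j<N. ip K (t a b i j (crd z j)) (crd w i))"
      proof (intro sum.cong refl)
        fix i j assume "i \<in> {..<N}" "j \<in> {..<N}"
        then have ij: "i < N" "j < N" by auto
        have tb: "t a b i j \<in> carrier (bop K)" using T_bop tT ab ij by simp
        show "ip L ((?M $$ (\<iota> i a, \<iota> j b)) z) w = ip K (t a b i j (crd z j)) (crd w i)"
        proof (cases "R i j")
          case True
          then show ?thesis using ij zw tb by (simp add: Me ip_tens_unit)
        next
          case False
          \<comment> \<open>Outside \<open>R\<close> the block of \<open>P\<close> is zero, and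
            \<open>X\<close> has no coefficient there either, so the truncation of \<open>P\<close>
            loses nothing.\<close>
          then have "t a b i j = \<zero>\<^bsub>bop K\<^esub>" using t ab ij by (simp add: has_coeffs_def)
          then show ?thesis using False ij zw tb by (simp add: Me ip_tens K.bop_zero_app)
        qed
      qed
      also have "\<dots> = ip L ((X $$ (a, b)) z) w"
        using t[OF ab] zw by (simp add: has_coeffs_def)
      finally show "ip L ((X $$ (a, b)) z) w = ip L ((mat_conj L n (N * m) \<alpha> ?M $$ (a, b)) z) w" ..
    qed
  qed
  moreover have "\<alpha> \<in> carrier_mat n (N * m)" by (simp add: \<alpha>_def)
  ultimately show ?thesis unfolding D_max_def by blast
qed

lemma min_eq_max:
  assumes "\<And>i j k. \<lbrakk>R i j; R j k\<rbrakk> \<Longrightarrow> R i k" and "\<And>i j. R i j \<Longrightarrow> R j i"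
  shows "min_cone H K L \<tau> S T n = max_cone H K L \<tau> S T n"
proof (rule equalityI)
  show "min_cone H K L \<tau> S T n \<subseteq> max_cone H K L \<tau> S T n"
  proof
    fix X assume X: "X \<in> min_cone H K L \<tau> S T n"
    then show "X \<in> max_cone H K L \<tau> S T n"
      using min_subset_D_max[OF assms min_add_unit[OF X]]
      by (simp add: max_cone_iff min_cone_def pos_cone_def)
  qed
qed (rule max_subset_min)

end

section \<open>An operator system distinguishing the tensor products over a path\<close>

text \<open>\<open>T\<close> will act on a copy of four-dimensional space inside an arbitrary type,
  so matrix entries have to be read off an orthonormal basis.\<close>

locale onb = complex_hilbert V for V :: "'v cinner_space" (structure) +
  fixes d :: nat and e :: "nat \<Rightarrow> 'v"
  assumes e_closed: "i < d \<Longrightarrow> e i \<in> carrier V"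
    and ip_e: "\<lbrakk>i < d; j < d\<rbrakk> \<Longrightarrow> ip V (e i) (e j) = (if i = j then 1 else 0)"
    and expand: "x \<in> carrier V \<Longrightarrow> x = (\<Oplus>\<^bsub>V\<^esub>i\<in>{..<d}. ip V x (e i) \<odot> e i)"
begin

lemma e_fun: "e \<in> {..<d} \<rightarrow> carrier V"
  using e_closed by auto

lemma vnorm_coord: "\<lbrakk>x \<in> carrier V; i < d\<rbrakk> \<Longrightarrow> cmod (ip V x (e i)) \<le> vnorm V x"
  using cauchy_schwarz[of x "e i"] e_closed[of i] ip_e[of i i] by (simp add: vnorm_def[of V "e i"])

lemma bop_finite_dim:
  assumes "f \<in> extensional (carrier V)" and cl: "\<And>x. x \<in> carrier V \<Longrightarrow> f x \<in> carrier V"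
    and add: "\<And>x y. \<lbrakk>x \<in> carrier V; y \<in> carrier V\<rbrakk> \<Longrightarrow> f (x \<oplus> y) = f x \<oplus> f y"
    and sm: "\<And>c x. x \<in> carrier V \<Longrightarrow> f (c \<odot> x) = c \<odot> f x"
  shows "f \<in> carrier (bop V)"
proof (rule bopI[OF assms])
  fix x assume x: "x \<in> carrier V"
  have z: "f \<zero> = \<zero>"
    using sm[of \<zero> 0] cl[of \<zero>] smult_l_null[of "f \<zero>"] by (simp add: zero_conv[symmetric])
  have fs: "g \<in> I \<rightarrow> carrier V \<Longrightarrow> f (\<Oplus>\<^bsub>V\<^esub>i\<in>I. g i) = (\<Oplus>\<^bsub>V\<^esub>i\<in>I. f (g i))" for g and I :: "nat set"
  proof (induction I rule: infinite_finite_induct)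
    case (insert i I)
    then have "(\<lambda>i. f (g i)) \<in> insert i I \<rightarrow> carrier V" by (auto intro: cl)
    with insert show ?case by (auto simp: finsum_insert add finsum_closed Pi_iff)
  qed (auto simp: finsum_infinite z)
  have "f x = f (\<Oplus>\<^bsub>V\<^esub>i\<in>{..<d}. ip V x (e i) \<odot> e i)"
    using expand[OF x] by simp
  also have "\<dots> = (\<Oplus>\<^bsub>V\<^esub>i\<in>{..<d}. f (ip V x (e i) \<odot> e i))"
    using e_closed by (intro fs) auto
  finally have "vnorm V (f x) \<le> (\<Sum>i<d. vnorm V (f (ip V x (e i) \<odot> e i)))"
    using e_closed cl by (simp add: vnorm_finsum)
  also have "\<dots> \<le> (\<Sum>i<d. vnorm V (f (e i)) * vnorm V x)"
    using e_closed cl x vnorm_coord[OF x]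
    by (intro sum_mono) (simp add: sm vnorm_smult mult.commute[of "cmod _"] mult_left_mono vnorm_nonneg)
  finally show "vnorm V (f x) \<le> (\<Sum>i<d. vnorm V (f (e i))) * vnorm V x"
    by (simp add: sum_distrib_right)
qed

text \<open>The adjoint is written down from its coordinates: the i-th coordinate of
  \<open>g y\<close> must be \<open>ip V y (f (e i))\<close>.\<close>

lemma adjoint_exists:
  assumes f: "f \<in> carrier (bop V)"
  obtains g where "g \<in> carrier (bop V)" "adjoint_op V f g"
proof -
  define g where "g = (\<lambda>y\<in>carrier V. \<Oplus>\<^bsub>V\<^esub>i\<in>{..<d}. ip V y (f (e i)) \<odot> e i)"
  have gc: "g y \<in> carrier V" if "y \<in> carrier V" for y
    using that e_fun by (auto simp: g_def intro!: lincomb_closed')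
  have adj: "ip V x (g y) = ip V (f x) y" if x: "x \<in> carrier V" and y: "y \<in> carrier V" for x y
  proof -
    have "ip V x (g y) = (\<Sum>i<d. cnj (ip V y (f (e i))) * ip V x (e i))"
      using x y e_fun by (simp add: g_def ip_lincomb_right)
    also have "\<dots> = (\<Sum>i<d. ip V x (e i) * ip V (f (e i)) y)"
      using e_closed y f ip_cnj[symmetric] by (auto simp: bop_closed mult.commute intro!: sum.cong)
    also have "\<dots> = ip V (f (\<Oplus>\<^bsub>V\<^esub>i\<in>{..<d}. ip V x (e i) \<odot> e i)) y"
      using f e_fun y by (rule ip_lincomb[symmetric])
    also have "\<dots> = ip V (f x) y" using expand[OF x] by simp
    finally show ?thesis .
  qed
  have adj': "ip V (g y) x = ip V y (f x)" if x: "x \<in> carrier V" and y: "y \<in> carrier V" for x y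
    using adj[OF x y] ip_cnj[of x "g y"] ip_cnj[of "f x" y] x y f gc by (simp add: bop_closed)
  have "g \<in> carrier (bop V)"
  proof (rule bop_finite_dim)
    show "g \<in> extensional (carrier V)" by (simp add: g_def)
    show "g (x \<oplus> y) = g x \<oplus> g y" if "x \<in> carrier V" "y \<in> carrier V" for x y
      using that gc f by (intro ip_ext) (auto simp: adj' ip_add bop_closed)
    show "g (c \<odot> x) = c \<odot> g x" if "x \<in> carrier V" for c x
      using that gc f by (intro ip_ext) (auto simp: adj' ip_smult bop_closed)
  qed (rule gc)
  moreover have "adjoint_op V f g" using adj by (simp add: adjoint_op_def)
  ultimately show ?thesis using that by blast
qed

definition elem_op :: "nat \<Rightarrow> nat \<Rightarrow> 'v \<Rightarrow> 'v" where
  "elem_op a b = (\<lambda>x\<in>carrier V. ip V x (e b) \<odot> e a)"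

lemma elem_op_bop: "\<lbrakk>a < d; b < d\<rbrakk> \<Longrightarrow> elem_op a b \<in> carrier (bop V)"
  by (rule bop_finite_dim)
    (auto simp: elem_op_def e_closed ip_add ip_smult smult_l_distr[simplified] smult_assoc1[simplified])

lemma ip_elem_op:
  "\<lbrakk>x \<in> carrier V; y \<in> carrier V; a < d; b < d\<rbrakk> \<Longrightarrow> ip V (elem_op a b x) y = ip V x (e b) * ip V (e a) y"
  by (simp add: elem_op_def ip_smult e_closed)

end

text \<open>The operators \<open>A \<oplus> B\<close> with \<open>A\<close>, \<open>B\<close> of size 2 and \<open>A\<^sub>1\<^sub>1 = B\<^sub>0\<^sub>0\<close> represent the matrix-ordered
  dual of the operator system of the path on three vertices.\<close>

definition path_dual :: "'v cinner_space \<Rightarrow> (nat \<Rightarrow> 'v) \<Rightarrow> ('v \<Rightarrow> 'v) set" where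
  "path_dual V e = {f \<in> carrier (bop V).
     (\<forall>a<4. \<forall>b<4. (a < 2) \<noteq> (b < 2) \<longrightarrow> ip V (f (e b)) (e a) = 0) \<and>
     ip V (f (e 1)) (e 1) = ip V (f (e 2)) (e 2)}"

context onb
begin

lemma path_dual_operator_system:
  assumes d: "4 \<le> d"
  shows "operator_system V (path_dual V e)"
  unfolding operator_system_def VectorSpace.subspace_def
proof (intro conjI ballI)
  have ec: "e a \<in> carrier V" if "a < 4" for a using e_closed that d by simp
  show "vectorspace class_ring (bop V)" by (rule vectorspace_bop)
  show "LinearCombinations.submodule class_ring (path_dual V e) (bop V)"
    by standard (auto simp: path_dual_def bop_add_closed bop_smult_closed bop_zero_closed
        ip_bop ec bop_zero_app)
  show "\<one>\<^bsub>bop V\<^esub> \<in> path_dual V e"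
    using d by (auto simp: path_dual_def bop_one_closed bop_one_app ec ip_e)
  fix f assume f: "f \<in> path_dual V e"
  then have fb: "f \<in> carrier (bop V)" by (simp add: path_dual_def)
  then obtain g where g: "g \<in> carrier (bop V)" "adjoint_op V f g" by (rule adjoint_exists)
  have "ip V (g (e b)) (e a) = cnj (ip V (f (e a)) (e b))" if "a < 4" "b < 4" for a b
    using g ip_cnj[of "e a" "g (e b)"] ec[OF that(1)] ec[OF that(2)]
    by (simp add: adjoint_op_def bop_closed)
  then have "g \<in> path_dual V e"
    using f g by (auto simp: path_dual_def)
  then show "\<exists>g\<in>path_dual V e. adjoint_op V f g" using g by blast
qed

end

text \<open>The block on \<open>e 0\<close>, \<open>e 1\<close> belongs to the edge from
  \<open>v1\<close> to \<open>v2\<close>, the block on \<open>e 2\<close>, \<open>e 3\<close> to the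
  edge from \<open>v2\<close> to \<open>v3\<close>. The vertex \<open>v2\<close> owns
  \<open>e 1\<close> and \<open>e 2\<close>, whose diagonal entries are tied in
  \<open>T\<close>.\<close>

locale path_tensor = supp_tensor N K L \<tau> R "path_dual K e" + B: onb K 4 e
  for N :: nat and K :: "'v cinner_space" and L :: "'w cinner_space"
    and \<tau> :: "complex vec \<Rightarrow> 'v \<Rightarrow> 'w" and R :: "nat \<Rightarrow> nat \<Rightarrow> bool" and e :: "nat \<Rightarrow> 'v" +
  fixes v1 v2 v3 :: nat
  assumes v: "v1 < N" "v2 < N" "v3 < N"
    and R12: "R v1 v2" "R v2 v1" and R23: "R v2 v3" "R v3 v2" and R13: "\<not> R v1 v3"
begin

abbreviation T where "T \<equiv> path_dual K e"

lemma distinct: "v1 \<noteq> v2" "v2 \<noteq> v3" "v1 \<noteq> v3" "v2 \<noteq> v1" "v3 \<noteq> v2" "v3 \<noteq> v1"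
  using R12 R23 R13 refl_R by auto

lemma ec: "a < 4 \<Longrightarrow> e a \<in> carrier K"
  by (rule B.e_closed)

text \<open>Because of the tied diagonal entry, the projections onto \<open>e 1\<close> and
  \<open>e 2\<close> enter only through their sum.\<close>

lemma elem_T: "\<lbrakk>a < 4; b < 4; (a < 2) = (b < 2); a = b \<Longrightarrow> a \<noteq> 1 \<and> a \<noteq> 2\<rbrakk> \<Longrightarrow> B.elem_op a b \<in> T"
  "B.elem_op 1 1 \<oplus>\<^bsub>bop K\<^esub> B.elem_op 2 2 \<in> T"
  by (auto simp: path_dual_def B.elem_op_bop B.ip_elem_op ec B.ip_e K.bop_add_closed K.ip_bop)

text \<open>Twice the sum of the projections onto the lines of \<open>v\<^sub>1 \<otimes> e\<^sub>0 - v\<^sub>2 \<otimes> e\<^sub>1\<close> and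
  \<open>v\<^sub>2 \<otimes> e\<^sub>2 - v\<^sub>3 \<otimes> e\<^sub>3\<close>.\<close>

definition witness :: "'w \<Rightarrow> 'w" where
  "witness = (tens (unit_mat N v1 v1) (B.elem_op 0 0) \<oplus>\<^bsub>bop L\<^esub>
      (tens (unit_mat N v2 v2) (B.elem_op 1 1 \<oplus>\<^bsub>bop K\<^esub> B.elem_op 2 2) \<oplus>\<^bsub>bop L\<^esub>
       tens (unit_mat N v3 v3) (B.elem_op 3 3))) \<oplus>\<^bsub>bop L\<^esub>
    (-1) \<odot>\<^bsub>bop L\<^esub> ((tens (unit_mat N v1 v2) (B.elem_op 0 1) \<oplus>\<^bsub>bop L\<^esub>
       tens (unit_mat N v2 v1) (B.elem_op 1 0)) \<oplus>\<^bsub>bop L\<^esub>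
      (tens (unit_mat N v2 v3) (B.elem_op 2 3) \<oplus>\<^bsub>bop L\<^esub>
       tens (unit_mat N v3 v2) (B.elem_op 3 2)))"

lemma witness_alg: "witness \<in> alg_tensor H K L \<tau> S T"
  unfolding witness_def
  by (intro alg_add alg_smult tens_alg unit_mats elem_T refl_R R12 R23) auto

text \<open>The polarisation of a sum of two squared moduli: w = z gives positivity, and the values
  at basis tensors give \<open>sep_witness\<close>.\<close>

lemma ip_witness:
  assumes z: "z \<in> carrier L" and w: "w \<in> carrier L"
  shows "ip L (witness z) w =
      (ip K (crd z v1) (e 0) - ip K (crd z v2) (e 1)) * cnj (ip K (crd w v1) (e 0) - ip K (crd w v2) (e 1))
    + (ip K (crd z v2) (e 2) - ip K (crd z v3) (e 3)) * cnj (ip K (crd w v2) (e 2) - ip K (crd w v3) (e 3))"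
proof -
  have sw: "ip K (e a) (crd w i) = cnj (ip K (crd w i) (e a))" if "a < 4" "i < N" for a i
    using that w by (intro K.ip_cnj) (auto simp: ec)
  show ?thesis
    unfolding witness_def using v z w
    by (simp add: L.ip_bop L.bop_add_closed L.bop_smult_closed tens_closed B.elem_op_bop K.bop_add_closed
        ip_tens_unit K.ip_bop B.ip_elem_op sw) (simp add: algebra_simps)
qed

lemma witness_min: "mat 1 1 (\<lambda>_. witness) \<in> min_cone H K L \<tau> S T 1"
proof -
  have "0 \<le> ip L (witness z) z" if "z \<in> carrier L" for z
  proof -
    have "0 \<le> x * cnj x + y * cnj y" for x y :: complex
      by (simp add: less_eq_complex_def)
    then show ?thesis using that by (simp add: ip_witness del: complex_cnj_diff)
  qed
  then show ?thesis
    by (auto simp: min_cone_def pos_cone_def sq_mats_def witness_alg pos_op_mat_def)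
qed

text \<open>Up to the identification of the dual of \<open>T\<close> with the operator system of the path, \<open>sep\<close> is the
  functional of the identity map. It is nonnegative on \<open>D_max\<close> because a positive matrix over the
  path splits into one supported on \<open>v\<^sub>1, v\<^sub>2\<close> and one supported on \<open>v\<^sub>2, v\<^sub>3\<close>.\<close>

definition sep :: "('w \<Rightarrow> 'w) \<Rightarrow> complex" where
  "sep F = ip L (F (emb v1 (e 0))) (emb v1 (e 0)) + ip L (F (emb v2 (e 1))) (emb v1 (e 0))
    + ip L (F (emb v1 (e 0))) (emb v2 (e 1)) + ip L (F (emb v2 (e 1))) (emb v2 (e 1))
    + ip L (F (emb v3 (e 3))) (emb v2 (e 2)) + ip L (F (emb v2 (e 2))) (emb v3 (e 3))
    + ip L (F (emb v3 (e 3))) (emb v3 (e 3))"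

text \<open>Three diagonal terms equal to 1 and four edge terms equal to -1; the vertex
  \<open>v2\<close> is counted once, at \<open>e 1\<close>.\<close>

lemma sep_witness: "sep witness = -1"
  using v distinct by (simp add: sep_def ip_witness ec crd_emb B.ip_e)

lemma sep_one: "sep \<one>\<^bsub>bop L\<^esub> = 3"
  using v distinct by (simp add: sep_def ec L.bop_one_app ip_emb B.ip_e)

lemma sep_add: "\<lbrakk>F \<in> carrier (bop L); F' \<in> carrier (bop L)\<rbrakk> \<Longrightarrow> sep (F \<oplus>\<^bsub>bop L\<^esub> F') = sep F + sep F'"
  by (simp add: sep_def L.ip_bop ec)

lemma sep_smult: "F \<in> carrier (bop L) \<Longrightarrow> sep (c \<odot>\<^bsub>bop L\<^esub> F) = c * sep F"
  by (simp add: sep_def L.ip_bop ec algebra_simps)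

lemma sep_tens:
  assumes "t \<in> carrier (bop K)"
  shows "sep (tens A t) = A $$ (v1, v1) * ip K (t (e 0)) (e 0) + A $$ (v1, v2) * ip K (t (e 1)) (e 0)
    + A $$ (v2, v1) * ip K (t (e 0)) (e 1) + A $$ (v2, v2) * ip K (t (e 1)) (e 1)
    + A $$ (v2, v3) * ip K (t (e 3)) (e 2) + A $$ (v3, v2) * ip K (t (e 2)) (e 3)
    + A $$ (v3, v3) * ip K (t (e 3)) (e 3)"
  using assms v by (simp add: sep_def ip_tens_emb ec)

lemma sep_mat_conj:
  assumes X: "\<And>p q. \<lbrakk>p < m; q < m\<rbrakk> \<Longrightarrow> X $$ (p, q) \<in> carrier (bop L)"
  shows "sep (mat_conj L 1 m \<alpha> X $$ (0, 0)) = (\<Sum>p<m. \<Sum>q<m. \<alpha> $$ (0, p) * cnj (\<alpha> $$ (0, q)) * sep (X $$ (p, q)))"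
  unfolding sep_def using X
  by (simp add: L.mat_conj_entry(2) ec distrib_left sum.distrib)

text \<open>The kernel of \<open>P\<close> splits as \<open>M1 + M'\<close>. The part on
  \<open>v1\<close>, \<open>v2\<close> is paired with the compression of \<open>Q\<close> to
  \<open>e 0\<close>, \<open>e 1\<close>, the part on \<open>v2\<close>, \<open>v3\<close> with that
  to \<open>e 2\<close>, \<open>e 3\<close>; both pairings are nonnegative by
  \<open>psd_schur_sum\<close>. The tie in \<open>T\<close> makes the two compressions agree at
  \<open>v2\<close>, so that the pairings add up to \<open>sep\<close>.\<close>

lemma sep_D_max:
  assumes "X \<in> D_max H K L \<tau> S T 1"
  shows "0 \<le> sep (X $$ (0, 0))"
proof -
  obtain k m \<alpha> P Q where X: "X = mat_conj L 1 (k * m) \<alpha> (mat_tensor H K L \<tau> k m P Q)"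
    and P: "P \<in> pos_cone H S k" and Q: "Q \<in> pos_cone K T m"
    using assms unfolding D_max_def by blast
  obtain B where B: "\<And>p q. \<lbrakk>p < k; q < k\<rbrakk> \<Longrightarrow> B p q \<in> supp_mats N R"
    "\<And>p q. \<lbrakk>p < k; q < k\<rbrakk> \<Longrightarrow> P $$ (p, q) = mat_op N (B p q)"
    "psd ({..<k} \<times> {..<N}) (\<lambda>x y. B (fst x) (fst y) $$ (snd x, snd y))"
    by (rule pos_cone_S[OF P]) blast
  have entry: "mat_tensor H K L \<tau> k m P Q $$ (p, q)
      = tens (B (p div m) (q div m)) (Q $$ (p mod m, q mod m))" if "p < k * m" "q < k * m" for p q
    by (rule mat_tensor_entry[where k = k and m = m]) (use B(1,2) pos_cone_T(2)[OF Q] that in auto)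
  have idx: "a * m + b < k * m" if "a < k" "b < m" for a b
    using that mult_le_mono1[of "Suc a" k m] by simp
  define M where "M x y = B (fst x) (fst y) $$ (snd x, snd y)" for x y :: "nat \<times> nat"
  let ?V = "{v1, v2, v3}"
  let ?J = "{..<k} \<times> ?V"
  have fin: "finite ?J" by simp
  have M: "psd ?J M"
    unfolding M_def by (rule psd_subset[OF B(3)]) (use v in auto)
  have M13: "M (p, v1) (q, v3) = 0" if "p < k" "q < k" for p q
    using B(1)[OF that] v R13 by (simp add: M_def supp_mats_def)
  have M31: "M (p, v3) (q, v1) = 0" if "p < k" "q < k" for p q
    using psd_hermitian[OF M fin, of "(q, v1)" "(p, v3)"] M13[OF that(2,1)] that by simp
  \<comment> \<open>All indices over \<open>v1\<close> are eliminated. Since \<open>M\<close>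
    vanishes between \<open>v1\<close> and \<open>v3\<close>, the removed part does not reach
    \<open>v3\<close>, and the remainder no longer meets \<open>v1\<close>.\<close>
  obtain w M' where M': "psd ?J M'"
    "\<And>x a. \<lbrakk>x \<in> ?J; a \<in> {..<k} \<times> {v1}\<rbrakk> \<Longrightarrow> M' x a = 0 \<and> M' a x = 0"
    "\<And>x y. \<lbrakk>x \<in> ?J; y \<in> ?J\<rbrakk> \<Longrightarrow> M x y = M' x y + (\<Sum>a\<in>{..<k} \<times> {v1}. w a x * cnj (w a y))"
    "\<And>a b. \<lbrakk>a \<in> {..<k} \<times> {v1}; b \<in> {..<k} \<times> {v3}\<rbrakk> \<Longrightarrow> w a b = 0"
    by (rule psd_eliminate[OF M fin, of "{..<k} \<times> {v1}" "{..<k} \<times> {v3}"]) (use M13 in auto)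
  define M1 where "M1 x y = (\<Sum>a\<in>{..<k} \<times> {v1}. w a x * cnj (w a y))" for x y
  have M1: "psd ?J M1" unfolding M1_def by (rule psd_outer)
  \<comment> \<open>The basis vector that stands for a vertex in each block; a vertex outside the
    block gets the zero vector.\<close>
  define g1 where "g1 i = (if i = v1 then e 0 else if i = v2 then e 1 else \<zero>\<^bsub>K\<^esub>)" for i
  define g2 where "g2 i = (if i = v2 then e 2 else if i = v3 then e 3 else \<zero>\<^bsub>K\<^esub>)" for i
  have g: "g1 i \<in> carrier K" "g2 i \<in> carrier K" for i by (auto simp: g1_def g2_def ec)
  \<comment> \<open>The scalars of \<open>\<alpha>\<close> are absorbed into the test vectors, so
    the kernel is psd by \<open>psd_of_pos_op_mat\<close>.\<close>
  define NN where "NN g x y = (\<Sum>p<m. \<Sum>q<m. ip K ((Q $$ (p, q)) (cnj (\<alpha> $$ (0, fst y * m + q)) \<odot>\<^bsub>K\<^esub> g (snd y)))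
      (cnj (\<alpha> $$ (0, fst x * m + p)) \<odot>\<^bsub>K\<^esub> g (snd x)))" for g and x y :: "nat \<times> nat"
  have NN: "psd ?J (NN g1)" "psd ?J (NN g2)"
    unfolding NN_def using g by (auto intro!: K.psd_of_pos_op_mat pos_cone_T[OF Q])
  \<comment> \<open>The block that \<open>sep\<close> reads: the second for everything that touches
    \<open>v3\<close>, the first otherwise, in particular for the diagonal at
    \<open>v2\<close>.\<close>
  define G where "G i j p q = (if i = v3 \<or> j = v3 then ip K ((Q $$ (p, q)) (g2 j)) (g2 i)
      else ip K ((Q $$ (p, q)) (g1 j)) (g1 i))" for i j p q
  have NNe: "NN g (p, i) (q, j) = (\<Sum>p'<m. \<Sum>q'<m. \<alpha> $$ (0, p * m + p') * cnj (\<alpha> $$ (0, q * m + q')) *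
      ip K ((Q $$ (p', q')) (g j)) (g i))" if "g i \<in> carrier K" "g j \<in> carrier K" for g p q i j
    unfolding NN_def using that pos_cone_T(2)[OF Q]
    by (intro sum.cong refl) (auto simp: K.bop_smult K.bop_closed K.ip_smult K.ip_smult_right)
  have Q12: "ip K ((Q $$ (p, q)) (e 1)) (e 1) = ip K ((Q $$ (p, q)) (e 2)) (e 2)" if "p < m" "q < m" for p q
    using Q that by (auto simp: pos_cone_def sq_mats_def path_dual_def)
  \<comment> \<open>The only use of the tie between the entries at \<open>e 1\<close> and
    \<open>e 2\<close>.\<close>
  have NN12: "NN g1 (p, v2) (q, v2) = NN g2 (p, v2) (q, v2)" for p q
    unfolding NNe[OF g(1) g(1)] NNe[OF g(2) g(2)]
    by (intro sum.cong refl) (simp add: g1_def g2_def distinct Q12 del: One_nat_def)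
  \<comment> \<open>Away from the pair (v2, v2) at most one part of the split is nonzero, and it
    equals the entry of \<open>M\<close>. At (v2, v2) both parts contribute, with equal weights by
    \<open>NN12\<close>.\<close>
  have entry_sum: "M1 (p, i) (q, j) * NN g1 (p, i) (q, j) + M' (p, i) (q, j) * NN g2 (p, i) (q, j)
    = (\<Sum>p'<m. \<Sum>q'<m. B p q $$ (i, j) * (\<alpha> $$ (0, p * m + p') * cnj (\<alpha> $$ (0, q * m + q')) * G i j p' q'))"
    if p: "p < k" and q: "q < k" and i: "i \<in> ?V" and j: "j \<in> ?V" for p q i j
  proof -
    have sum: "M (p, i) (q, j) = M' (p, i) (q, j) + M1 (p, i) (q, j)"
      using M'(3)[of "(p, i)" "(q, j)"] p q i j by (simp add: M1_def)
    have "M1 (p, i) (q, j) * NN g1 (p, i) (q, j) + M' (p, i) (q, j) * NN g2 (p, i) (q, j)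
      = M (p, i) (q, j) * (if i = v3 \<or> j = v3 then NN g2 (p, i) (q, j) else NN g1 (p, i) (q, j))"
    proof (cases "i = v3 \<or> j = v3")
      case True
      then have "M1 (p, i) (q, j) = 0"
        unfolding M1_def using M'(4) p q by (intro sum.neutral) auto
      then show ?thesis using True sum by simp
    next
      case False
      show ?thesis
      proof (cases "i = v1 \<or> j = v1")
        case True
        then have "M' (p, i) (q, j) = 0"
          using M'(2)[of "(p, i)" "(q, j)"] M'(2)[of "(q, j)" "(p, i)"] p q i j by auto
        then show ?thesis using False sum by simp
      next
        case nf: False
        then have "i = v2" "j = v2" using False i j by auto
        then show ?thesis using False sum NN12[of p q] by (simp add: algebra_simps)
      qed
    qed
    also have "(if i = v3 \<or> j = v3 then NN g2 (p, i) (q, j) else NN g1 (p, i) (q, j))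
      = (\<Sum>p'<m. \<Sum>q'<m. \<alpha> $$ (0, p * m + p') * cnj (\<alpha> $$ (0, q * m + q')) * G i j p' q')"
      using g by (auto simp: NNe G_def)
    finally show ?thesis by (simp add: M_def sum_distrib_left)
  qed
  have "0 \<le> (\<Sum>x\<in>?J. \<Sum>y\<in>?J. M1 x y * NN g1 x y) + (\<Sum>x\<in>?J. \<Sum>y\<in>?J. M' x y * NN g2 x y)"
    using psd_schur_sum[OF M1 fin NN(1)] psd_schur_sum[OF M'(1) fin NN(2)] by (rule add_nonneg_nonneg)
  also have "\<dots> = (\<Sum>x\<in>?J. \<Sum>y\<in>?J. M1 x y * NN g1 x y + M' x y * NN g2 x y)"
    by (simp only: sum.distrib)
  also have "\<dots> = (\<Sum>p<k. \<Sum>i\<in>?V. \<Sum>q<k. \<Sum>j\<in>?V. M1 (p, i) (q, j) * NN g1 (p, i) (q, j) + M' (p, i) (q, j) * NN g2 (p, i) (q, j))"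
    by (simp only: sum.cartesian_product')
  also have "\<dots> = (\<Sum>p<k. \<Sum>i\<in>?V. \<Sum>q<k. \<Sum>j\<in>?V. \<Sum>p'<m. \<Sum>q'<m.
      B p q $$ (i, j) * (\<alpha> $$ (0, p * m + p') * cnj (\<alpha> $$ (0, q * m + q')) * G i j p' q'))"
    by (intro sum.cong refl entry_sum) auto
  also have "\<dots> = (\<Sum>p<k. \<Sum>p'<m. \<Sum>q<k. \<Sum>q'<m. \<Sum>i\<in>?V. \<Sum>j\<in>?V.
      B p q $$ (i, j) * (\<alpha> $$ (0, p * m + p') * cnj (\<alpha> $$ (0, q * m + q')) * G i j p' q'))"
    by (rule sum_reorder[symmetric])
  also have "\<dots> = (\<Sum>p<k. \<Sum>p'<m. \<Sum>q<k. \<Sum>q'<m. \<alpha> $$ (0, p * m + p') * cnj (\<alpha> $$ (0, q * m + q')) *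
      sep (mat_tensor H K L \<tau> k m P Q $$ (p * m + p', q * m + q')))"
  proof (intro sum.cong refl)
    fix p p' q q' assume "p \<in> {..<k}" "p' \<in> {..<m}" "q \<in> {..<k}" "q' \<in> {..<m}"
    then have pq: "p < k" "p' < m" "q < k" "q' < m" by auto
    \<comment> \<open>Of the nine vertex pairs these two drop out, which leaves the seven terms of
      \<open>sep_tens\<close>.\<close>
    have z: "B p q $$ (v1, v3) = 0" "B p q $$ (v3, v1) = 0"
      using M13[OF pq(1,3)] M31[OF pq(1,3)] by (auto simp: M_def)
    have "mat_tensor H K L \<tau> k m P Q $$ (p * m + p', q * m + q') = tens (B p q) (Q $$ (p', q'))"
      using entry[OF idx[OF pq(1,2)] idx[OF pq(3,4)]] pq by simp
    then show "(\<Sum>i\<in>?V. \<Sum>j\<in>?V. B p q $$ (i, j) * (\<alpha> $$ (0, p * m + p') * cnj (\<alpha> $$ (0, q * m + q')) * G i j p' q'))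
      = \<alpha> $$ (0, p * m + p') * cnj (\<alpha> $$ (0, q * m + q')) * sep (mat_tensor H K L \<tau> k m P Q $$ (p * m + p', q * m + q'))"
      using distinct pos_cone_T(2)[OF Q pq(2,4)]
      by (simp add: sep_tens G_def g1_def g2_def z) (simp add: algebra_simps)
  qed
  also have "\<dots> = (\<Sum>p<k * m. \<Sum>q<k * m. \<alpha> $$ (0, p) * cnj (\<alpha> $$ (0, q)) * sep (mat_tensor H K L \<tau> k m P Q $$ (p, q)))"
    by (simp add: sum_lessThan_mult)
  also have "\<dots> = sep (X $$ (0, 0))"
    unfolding X by (rule sep_mat_conj[symmetric]) (rule mat_tensor_pos(2)[OF P Q])
  finally show ?thesis .
qed

lemma min_neq_max: "min_cone H K L \<tau> S T 1 \<noteq> max_cone H K L \<tau> S T 1"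
proof
  assume "min_cone H K L \<tau> S T 1 = max_cone H K L \<tau> S T 1"
  then have X: "mat 1 1 (\<lambda>_. witness) \<in> max_cone H K L \<tau> S T 1"
    using witness_min by simp
  \<comment> \<open>Since \<open>sep\<close> is 3 at the unit, the perturbed value is 3 r - 1,
    negative for every r < 1/3; at r = 1/6 it is -1/2.\<close>
  let ?Y = "add_unit 1 (1 / 6) (mat 1 1 (\<lambda>_. witness))"
  have "?Y \<in> D_max H K L \<tau> S T 1" using X by (simp add: max_cone_iff)
  then have "0 \<le> sep (?Y $$ (0, 0))" by (rule sep_D_max)
  also have "sep (?Y $$ (0, 0)) = - 1 / 2"
    by (simp add: add_unit_entry sep_add sep_smult sep_one sep_witness L.bop_smult_closed
        L.bop_one_closed alg_bop[OF witness_alg])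
  finally show False by (simp add: less_eq_complex_def)
qed

end

section \<open>Finite-dimensional Hilbert spaces inside a large type\<close>

text \<open>The second factor must have its carrier in a type of which only the cardinality is
  known, so the space is transported along an injection.\<close>

definition copy_space :: "nat \<Rightarrow> (complex vec \<Rightarrow> 'w) \<Rightarrow> 'w cinner_space" where
  "copy_space m j = (let g = inv_into (carrier_vec m) j in
    \<lparr>carrier = j ` carrier_vec m, mult = (\<lambda>x y. x), one = j (0\<^sub>v m), zero = j (0\<^sub>v m),
     add = (\<lambda>x y. j (g x + g y)), smult = (\<lambda>c x. j (c \<cdot>\<^sub>v g x)), ip = (\<lambda>x y. g x \<bullet>c g y)\<rparr>)"

locale cvec_copy =
  fixes m :: nat and j :: "complex vec \<Rightarrow> 'w"
  assumes inj: "inj_on j (carrier_vec m)"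
begin

abbreviation W where "W \<equiv> copy_space m j"
abbreviation g where "g \<equiv> inv_into (carrier_vec m) j"

lemma g_j [simp]: "x \<in> carrier_vec m \<Longrightarrow> g (j x) = x"
  using inj by simp

lemma carrier_W: "carrier W = j ` carrier_vec m"
  by (simp add: copy_space_def Let_def)

lemma j_closed [simp]: "x \<in> carrier_vec m \<Longrightarrow> j x \<in> carrier W"
  by (simp add: carrier_W)

lemma W_cases:
  assumes "y \<in> carrier W" obtains x where "x \<in> carrier_vec m" "y = j x"
  using assms by (auto simp: carrier_W)

lemma g_closed: "y \<in> carrier W \<Longrightarrow> g y \<in> carrier_vec m"
  by (auto simp: carrier_W)

lemma W_simps:
  "zero W = j (0\<^sub>v m)"
  "\<lbrakk>x \<in> carrier_vec m; y \<in> carrier_vec m\<rbrakk> \<Longrightarrow> j x \<oplus>\<^bsub>W\<^esub> j y = j (x + y)"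
  "x \<in> carrier_vec m \<Longrightarrow> c \<odot>\<^bsub>W\<^esub> j x = j (c \<cdot>\<^sub>v x)"
  "\<lbrakk>x \<in> carrier_vec m; y \<in> carrier_vec m\<rbrakk> \<Longrightarrow> ip W (j x) (j y) = (\<Sum>i<m. x $ i * cnj (y $ i))"
  by (auto simp: copy_space_def Let_def cscalar_prod_sum[of _ m])

lemma vectorspace_W: "vectorspace class_ring W"
proof (rule vs_criteria, goal_cases)
  case 1
  show ?case by (rule class_field)
next
  case 4
  show ?case
  proof
    fix y assume "y \<in> carrier W"
    then obtain x where x: "x \<in> carrier_vec m" "y = j x" by (rule W_cases)
    then show "\<exists>z\<in>carrier W. y \<oplus>\<^bsub>W\<^esub> z = \<zero>\<^bsub>W\<^esub>"
      by (intro bexI[of _ "j (- x)"]) (auto simp: W_simps)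
  qed
qed (auto elim!: W_cases simp: W_simps add_smult_distrib_vec smult_add_distrib_vec
    smult_smult_assoc comm_add_vec intro!: arg_cong[of _ _ j])

lemma vnorm_W: "x \<in> carrier_vec m \<Longrightarrow> vnorm W (j x) = L2_set (\<lambda>i. cmod (x $ i)) {..<m}"
  by (simp add: vnorm_def W_simps L2_set_def complex_norm_square[symmetric] of_real_sum[symmetric]
      del: of_real_sum of_real_power)

lemma minus_W:
  assumes "x \<in> carrier_vec m" "y \<in> carrier_vec m"
  shows "j x \<ominus>\<^bsub>W\<^esub> j y = j (x - y)"
proof -
  interpret vectorspace class_ring W by (rule vectorspace_W)
  have "j x \<ominus>\<^bsub>W\<^esub> j y = j x \<oplus>\<^bsub>W\<^esub> (-1) \<odot>\<^bsub>W\<^esub> j y"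
    using smult_l_minus[of 1 "j y"] smult_one[of "j y"] assms by (simp add: a_minus_def class_ring_simps)
  also have "\<dots> = j (x + (-1) \<cdot>\<^sub>v y)" using assms by (simp add: W_simps)
  also have "x + (-1) \<cdot>\<^sub>v y = x - y" using assms by (intro eq_vecI) auto
  finally show ?thesis .
qed

lemma vdist_W:
  assumes "x \<in> carrier_vec m" "y \<in> carrier_vec m"
  shows "vdist W (j x) (j y) = L2_set (\<lambda>i. cmod (x $ i - y $ i)) {..<m}"
  using assms by (auto simp: vdist_def minus_W vnorm_W intro!: L2_set_cong)

text \<open>Completeness is an axiom of \<open>complex_hilbert\<close>, so the metric has to be set
  up before that locale can be interpreted; under \<open>g\<close> it is the Euclidean
  distance.\<close>

lemma metric_W: "Metric_space (carrier W) (vdist W)"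
proof
  fix x y z
  have vd: "vdist W x y = (if x \<in> carrier W \<and> y \<in> carrier W
      then L2_set (\<lambda>i. cmod (g x $ i - g y $ i)) {..<m} else 0)" for x y
    by (auto simp: vdist_W elim!: W_cases) (auto simp: vdist_def)
  show "0 \<le> vdist W x y" by (simp add: vd)
  show "vdist W x y = vdist W y x"
    by (simp add: vd norm_minus_commute)
  assume x: "x \<in> carrier W" and y: "y \<in> carrier W"
  show "vdist W x y = 0 \<longleftrightarrow> x = y"
  proof
    assume "vdist W x y = 0"
    then have "\<forall>i<m. g x $ i = g y $ i" using x y by (simp add: vd L2_set_eq_0_iff)
    then have "g x = g y" using g_closed[OF x] g_closed[OF y] by (intro eq_vecI) auto
    then show "x = y" using x y by (auto elim!: W_cases)
  qed (simp add: vd L2_set_eq_0_iff)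
  assume z: "z \<in> carrier W"
  have "L2_set (\<lambda>i. cmod (g x $ i - g z $ i)) {..<m}
    \<le> L2_set (\<lambda>i. cmod (g x $ i - g y $ i) + cmod (g y $ i - g z $ i)) {..<m}"
  proof (rule L2_set_mono)
    show "cmod (g x $ i - g z $ i) \<le> cmod (g x $ i - g y $ i) + cmod (g y $ i - g z $ i)" for i
      using norm_triangle_ineq[of "g x $ i - g y $ i" "g y $ i - g z $ i"] by simp
  qed simp
  also have "\<dots> \<le> L2_set (\<lambda>i. cmod (g x $ i - g y $ i)) {..<m} + L2_set (\<lambda>i. cmod (g y $ i - g z $ i)) {..<m}"
    by (rule L2_set_triangle_ineq)
  finally show "vdist W x z \<le> vdist W x y + vdist W y z" using x y z by (simp add: vd)
qed

lemma mcomplete_W: "Metric_space.mcomplete (carrier W) (vdist W)"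
proof -
  interpret Metric_space "carrier W" "vdist W" by (rule metric_W)
  show ?thesis unfolding mcomplete_def
  proof (intro allI impI)
    fix \<sigma> assume cau: "MCauchy \<sigma>"
    then have "\<sigma> n \<in> carrier W" for n by (auto simp: MCauchy_def)
    then have "\<forall>n. \<exists>x. x \<in> carrier_vec m \<and> \<sigma> n = j x" by (auto simp: carrier_W image_iff)
    then obtain X where "\<forall>n. X n \<in> carrier_vec m \<and> \<sigma> n = j (X n)"
      by (rule exE[OF choice])
    then have X: "\<And>n. X n \<in> carrier_vec m" "\<And>n. \<sigma> n = j (X n)" by auto
    have "\<exists>l. (\<lambda>n. X n $ i) \<longlonglongrightarrow> l" if i: "i < m" for i
    proof -
      have "Cauchy (\<lambda>n. X n $ i)"
        unfolding Cauchy_def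
      proof (intro allI impI)
        fix \<epsilon> :: real assume "\<epsilon> > 0"
        then obtain n0 where n0: "\<And>n n'. n0 \<le> n \<Longrightarrow> n0 \<le> n' \<Longrightarrow> vdist W (\<sigma> n) (\<sigma> n') < \<epsilon>"
          using cau unfolding MCauchy_def by meson
        have "cmod (X n $ i - X n' $ i) \<le> vdist W (\<sigma> n) (\<sigma> n')" for n n'
          unfolding X(2) vdist_W[OF X(1) X(1)]
          using i member_le_L2_set[of "{..<m}" i "\<lambda>i. cmod (X n $ i - X n' $ i)"] by simp
        then show "\<exists>n0. \<forall>n\<ge>n0. \<forall>n'\<ge>n0. dist (X n $ i) (X n' $ i) < \<epsilon>"
          using n0 unfolding dist_norm by (meson le_less_trans)
      qed
      then show ?thesis using Cauchy_convergent convergent_def by blast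
    qed
    then obtain l where l: "\<And>i. i < m \<Longrightarrow> (\<lambda>n. X n $ i) \<longlonglongrightarrow> l i" by metis
    have "limitin mtopology \<sigma> (j (vec m l)) sequentially"
      unfolding limitin_metric_dist_null
    proof (intro conjI)
      have "((\<lambda>n. \<Sum>i<m. cmod (X n $ i - l i)) \<longlongrightarrow> (\<Sum>i<m. cmod (l i - l i))) sequentially"
        using l by (intro tendsto_intros) auto
      then have lim: "((\<lambda>n. \<Sum>i<m. cmod (X n $ i - l i)) \<longlongrightarrow> 0) sequentially" by simp
      have "vdist W (\<sigma> n) (j (vec m l)) \<le> (\<Sum>i<m. cmod (X n $ i - l i))" for n
      proof -
        have "vdist W (\<sigma> n) (j (vec m l)) = L2_set (\<lambda>i. cmod (X n $ i - l i)) {..<m}"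
          unfolding X(2) by (subst vdist_W[OF X(1)]) (auto intro!: L2_set_cong)
        also have "\<dots> \<le> (\<Sum>i<m. cmod (X n $ i - l i))" by (rule L2_set_le_sum) simp
        finally show ?thesis .
      qed
      then show "((\<lambda>n. vdist W (\<sigma> n) (j (vec m l))) \<longlongrightarrow> 0) sequentially"
        by (intro Lim_null_comparison[OF _ lim]) auto
    qed (use X in auto)
    then show "\<exists>x. limitin mtopology \<sigma> x sequentially" by blast
  qed
qed

lemma complex_hilbert_W: "complex_hilbert W"
proof (intro complex_hilbert.intro complex_hilbert_axioms.intro)
  show "vectorspace class_ring W" by (rule vectorspace_W)
  show "Metric_space.mcomplete (carrier W) (vdist W)" by (rule mcomplete_W)
  fix x y z :: 'w and c
  assume x: "x \<in> carrier W"
  show "0 < ip W x x" if "x \<noteq> \<zero>\<^bsub>W\<^esub>"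
  proof -
    obtain u where u: "u \<in> carrier_vec m" "x = j u" using x by (rule W_cases)
    have ne: "u \<noteq> 0\<^sub>v m" using that u by (auto simp: W_simps)
    have "ip W x x = of_real (\<Sum>i<m. (cmod (u $ i))\<^sup>2)"
      unfolding of_real_sum complex_norm_square using u by (simp add: W_simps)
    moreover have "(\<Sum>i<m. (cmod (u $ i))\<^sup>2) > 0"
    proof (rule ccontr)
      assume "\<not> (\<Sum>i<m. (cmod (u $ i))\<^sup>2) > 0"
      then have "(\<Sum>i<m. (cmod (u $ i))\<^sup>2) = 0" by (simp add: sum_nonneg antisym_conv3 not_less order_antisym)
      then have "\<forall>i<m. u $ i = 0" by (simp add: sum_nonneg_eq_0_iff)
      then show False using ne u by (auto intro!: eq_vecI)
    qed
    ultimately show ?thesis by (simp add: less_complex_def)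
  qed
  assume y: "y \<in> carrier W"
  show "ip W (c \<odot>\<^bsub>W\<^esub> x) y = c * ip W x y"
    using x y by (auto elim!: W_cases simp: W_simps sum_distrib_left mult.assoc intro!: sum.cong)
  show "ip W y x = cnj (ip W x y)"
    using x y by (auto elim!: W_cases simp: W_simps mult.commute intro!: sum.cong)
  assume z: "z \<in> carrier W"
  show "ip W (x \<oplus>\<^bsub>W\<^esub> y) z = ip W x z + ip W y z"
  proof -
    obtain u v w where "u \<in> carrier_vec m" "x = j u" "v \<in> carrier_vec m" "y = j v"
      "w \<in> carrier_vec m" "z = j w"
      using x y z by (auto simp: carrier_W)
    then show ?thesis by (simp add: W_simps distrib_right sum.distrib)
  qed
qed

lemma ip_unit: "\<lbrakk>x \<in> carrier_vec m; i < m\<rbrakk> \<Longrightarrow> ip W (j x) (j (unit_vec m i)) = x $ i"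
  by (simp add: W_simps unit_vec_def if_distrib[of cnj] if_distrib[of "(*) _"] cong: if_cong)

lemma onb_W: "onb W m (\<lambda>i. j (unit_vec m i))"
proof -
  interpret complex_hilbert W by (rule complex_hilbert_W)
  show ?thesis
  proof
    show "j (unit_vec m i) \<in> carrier W" for i by simp
    show "ip W (j (unit_vec m i)) (j (unit_vec m k)) = (if i = k then 1 else 0)" if "i < m" "k < m" for i k
      using that by (simp add: ip_unit)
    fix x assume x: "x \<in> carrier W"
    show "x = (\<Oplus>\<^bsub>W\<^esub>i\<in>{..<m}. ip W x (j (unit_vec m i)) \<odot>\<^bsub>W\<^esub> j (unit_vec m i))"
    proof (rule ip_ext[OF x])
      show "(\<Oplus>\<^bsub>W\<^esub>i\<in>{..<m}. ip W x (j (unit_vec m i)) \<odot>\<^bsub>W\<^esub> j (unit_vec m i)) \<in> carrier W"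
        by (rule lincomb_closed') auto
      fix y assume y: "y \<in> carrier W"
      obtain u where u: "u \<in> carrier_vec m" "x = j u" using x by (rule W_cases)
      obtain v where v: "v \<in> carrier_vec m" "y = j v" using y by (rule W_cases)
      have "ip W (\<Oplus>\<^bsub>W\<^esub>i\<in>{..<m}. ip W x (j (unit_vec m i)) \<odot>\<^bsub>W\<^esub> j (unit_vec m i)) y
        = (\<Sum>i<m. ip W (ip W x (j (unit_vec m i)) \<odot>\<^bsub>W\<^esub> j (unit_vec m i)) y)"
        using y by (intro ip_finsum_left) auto
      also have "\<dots> = (\<Sum>i<m. u $ i * cnj (v $ i))"
      proof (intro sum.cong refl)
        fix i assume "i \<in> {..<m}"
        then show "ip W (ip W x (j (unit_vec m i)) \<odot>\<^bsub>W\<^esub> j (unit_vec m i)) y = u $ i * cnj (v $ i)"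
          using u v y ip_cnj[of y "j (unit_vec m i)"] by (simp add: ip_smult ip_unit)
      qed
      finally show "ip W x y = ip W (\<Oplus>\<^bsub>W\<^esub>i\<in>{..<m}. ip W x (j (unit_vec m i)) \<odot>\<^bsub>W\<^esub> j (unit_vec m i)) y"
        using u v by (simp add: W_simps)
    qed
  qed
qed

end

section \<open>A concrete tensor product of transported spaces\<close>

locale cvec_copy_tensor = A: cvec_copy d a + C: cvec_copy "N * d" b
  for N d :: nat and a :: "complex vec \<Rightarrow> 'v" and b :: "complex vec \<Rightarrow> 'w"
begin

definition kron :: "complex vec \<Rightarrow> complex vec \<Rightarrow> complex vec" where
  "kron x y = vec (N * d) (\<lambda>p. x $ (p div d) * y $ (p mod d))"

lemma kron_closed [simp]: "kron x y \<in> carrier_vec (N * d)"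
  by (simp add: kron_def)

text \<open>In finite dimension the elementary tensors already span the whole space, so the closure
  condition becomes an equality of spans.\<close>

lemma hilbert_tensor_copy:
  "hilbert_tensor (cvec_space N) A.W C.W (\<lambda>x y. b (kron x (A.g y)))" (is "hilbert_tensor _ _ _ ?t")
proof -
  interpret L: complex_hilbert C.W by (rule C.complex_hilbert_W)
  have pm: "p div d < N" "p mod d < d" if "p < N * d" for p
  proof -
    have "d > 0" using that by (cases d) auto
    then show "p div d < N" "p mod d < d" using that by (auto simp: less_mult_imp_div_less)
  qed
  have idx: "i * d + k < N * d" if "i < N" "k < d" for i k
    using that mult_le_mono1[of "Suc i" N d] by simp
  let ?G = "{?t x y |x y. x \<in> carrier (cvec_space N) \<and> y \<in> carrier A.W}"
  have G: "?G \<subseteq> carrier C.W" by auto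
  have sub: "LinearCombinations.submodule class_ring (L.span ?G) C.W"
    by (rule L.span_is_submodule[OF G])
  have "carrier C.W \<subseteq> L.span ?G"
  proof
    fix z assume "z \<in> carrier C.W"
    then obtain u where u: "u \<in> carrier_vec (N * d)" "z = b u" by (rule C.W_cases)
    \<comment> \<open>Induction on the number of coordinates kept: each step adds one multiple of a
      Kronecker product of unit vectors.\<close>
    have "b (vec (N * d) (\<lambda>q. if q < p then u $ q else 0)) \<in> L.span ?G" if "p \<le> N * d" for p
      using that
    proof (induction p)
      case 0
      have "vec (N * d) (\<lambda>q. if q < 0 then u $ q else 0) = 0\<^sub>v (N * d)" by auto
      then show ?case
        using LinearCombinations.submodule.zero_closed[OF sub] by (simp add: C.W_simps)
    next
      case (Suc p)
      let ?x = "unit_vec N (p div d)" and ?y = "unit_vec d (p mod d)"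
      have "?t ?x (a ?y) \<in> ?G"
        by (rule CollectI, rule exI[of _ ?x], rule exI[of _ "a ?y"]) auto
      then have "?t ?x (a ?y) \<in> L.span ?G" using L.in_own_span[OF G] by blast
      then have "b (vec (N * d) (\<lambda>q. if q < p then u $ q else 0)) \<oplus>\<^bsub>C.W\<^esub> (u $ p) \<odot>\<^bsub>C.W\<^esub> ?t ?x (a ?y) \<in> L.span ?G"
        using Suc LinearCombinations.submodule.m_closed[OF sub]
          LinearCombinations.submodule.smult_closed[OF sub] by simp
      also have "b (vec (N * d) (\<lambda>q. if q < p then u $ q else 0)) \<oplus>\<^bsub>C.W\<^esub> (u $ p) \<odot>\<^bsub>C.W\<^esub> ?t ?x (a ?y)
        = b (vec (N * d) (\<lambda>q. if q < p then u $ q else 0) + (u $ p) \<cdot>\<^sub>v kron ?x ?y)"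
        by (simp add: C.W_simps)
      also have "vec (N * d) (\<lambda>q. if q < p then u $ q else 0) + (u $ p) \<cdot>\<^sub>v kron ?x ?y
        = vec (N * d) (\<lambda>q. if q < Suc p then u $ q else 0)"
      proof (rule eq_vecI)
        fix q assume "q < dim_vec (vec (N * d) (\<lambda>q. if q < Suc p then u $ q else 0))"
        then have q: "q < N * d" by simp
        have "q = p" if "q div d = p div d" "q mod d = p mod d"
          using that by (metis div_mod_decomp)
        then show "(vec (N * d) (\<lambda>q. if q < p then u $ q else 0) + (u $ p) \<cdot>\<^sub>v kron ?x ?y) $ q
          = vec (N * d) (\<lambda>q. if q < Suc p then u $ q else 0) $ q"
          using q pm[OF q] pm[of p] Suc.prems by (cases "q = p") (auto simp: kron_def unit_vec_def)
      qed (simp add: kron_def)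
      finally show ?case .
    qed
    from this[of "N * d"] have "b (vec (N * d) (\<lambda>q. if q < N * d then u $ q else 0)) \<in> L.span ?G" by simp
    moreover have "vec (N * d) (\<lambda>q. if q < N * d then u $ q else 0) = u"
      using u by (intro eq_vecI) auto
    ultimately show "z \<in> L.span ?G" using u by simp
  qed
  then have "L.span ?G = carrier C.W" using L.span_is_subset2[OF G] by blast
  then have dense: "L.mtopology closure_of L.span ?G = carrier C.W"
    using closure_of_topspace[of L.mtopology] by simp
  have kron_simps: "kron (x + x') y = kron x y + kron x' y" "kron (c \<cdot>\<^sub>v x) y = c \<cdot>\<^sub>v kron x y"
    if "x \<in> carrier_vec N" "x' \<in> carrier_vec N" for x x' y c
    using that pm by (auto simp: kron_def distrib_right mult.assoc intro!: eq_vecI)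
  have kron_simps': "kron x (y + y') = kron x y + kron x y'" "kron x (c \<cdot>\<^sub>v y) = c \<cdot>\<^sub>v kron x y"
    if "y \<in> carrier_vec d" "y' \<in> carrier_vec d" for x y y' c
    using that pm by (auto simp: kron_def distrib_left mult.left_commute intro!: eq_vecI)
  show ?thesis
    unfolding hilbert_tensor_def
  proof (intro conjI ballI)
    show "complex_hilbert C.W" by (rule C.complex_hilbert_W)
    show "(\<lambda>x. ?t x y) \<in> LinearCombinations.module_hom class_ring (cvec_space N) C.W"
      if "y \<in> carrier A.W" for y
      using that by (auto simp: module_hom_def kron_simps C.W_simps)
    show "?t x \<in> LinearCombinations.module_hom class_ring A.W C.W"
      if "x \<in> carrier (cvec_space N)" for x
      using that by (auto simp: module_hom_def C.W_simps A.W_simps kron_simps' elim!: A.W_cases)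
    fix x x' y y' assume xy: "x \<in> carrier (cvec_space N)" "x' \<in> carrier (cvec_space N)"
      "y \<in> carrier A.W" "y' \<in> carrier A.W"
    obtain u where u: "u \<in> carrier_vec d" "y = a u" using xy by (auto elim!: A.W_cases)
    obtain u' where u': "u' \<in> carrier_vec d" "y' = a u'" using xy by (auto elim!: A.W_cases)
    have "ip C.W (?t x y) (?t x' y') = (\<Sum>p<N * d. kron x u $ p * cnj (kron x' u' $ p))"
      using u u' by (simp add: C.W_simps)
    also have "\<dots> = (\<Sum>i<N. \<Sum>k<d. (x $ i * cnj (x' $ i)) * (u $ k * cnj (u' $ k)))"
      unfolding sum_lessThan_mult using idx by (intro sum.cong refl) (auto simp: kron_def)
    also have "\<dots> = ip (cvec_space N) x x' * ip A.W y y'"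
      using xy u u' by (simp add: A.W_simps cscalar_prod_sum[of _ N] sum_product)
    finally show "ip C.W (?t x y) (?t x' y') = ip (cvec_space N) x x' * ip A.W y y'" .
  qed (use dense in simp)
qed

end

text \<open>A pairing of complex numbers into one complex number, applied at two levels, packs four
  coordinates into one; the cardinality assumption does the rest.\<close>

lemma cvec_embeds:
  assumes "(UNIV :: complex set) \<lesssim> (UNIV :: 'v set)"
  obtains j :: "complex vec \<Rightarrow> 'v" where "inj_on j (carrier_vec 4)"
proof -
  have "\<exists>f. bij_betw f ((UNIV :: complex set) \<times> (UNIV :: complex set)) (UNIV :: complex set)"
    unfolding card_of_ordIso using infinite_UNIV_char_0 by (rule card_of_Times_same_infinite)
  then obtain q :: "complex \<times> complex \<Rightarrow> complex" where q: "inj q"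
    by (auto simp: bij_betw_def)
  obtain h :: "complex \<Rightarrow> 'v" where h: "inj h"
    using assms unfolding lepoll_def by auto
  let ?j = "\<lambda>x :: complex vec. h (q (q (x $ 0, x $ 1), q (x $ 2, x $ 3)))"
  have "inj_on ?j (carrier_vec 4)"
  proof (rule inj_onI)
    fix x y :: "complex vec" assume xy: "x \<in> carrier_vec 4" "y \<in> carrier_vec 4" and "?j x = ?j y"
    then have "x $ 0 = y $ 0" "x $ 1 = y $ 1" "x $ 2 = y $ 2" "x $ 3 = y $ 3"
      using q h by (auto simp: inj_eq)
    moreover have "i = 0 \<or> i = 1 \<or> i = 2 \<or> i = 3" if "i < 4" for i :: nat using that by auto
    ultimately have "x $ i = y $ i" if "i < 4" for i using that by metis
    then show "x = y" using xy by (intro eq_vecI) auto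
  qed
  then show ?thesis by (rule that)
qed

section \<open>Complete components\<close>

text \<open>Two successive edges lie in one component, because reachability is symmetric;
  completeness then joins their ends. Conversely, under transitivity reachable vertices are equal or
  adjacent, and components are induced subgraphs, so they contain all these arcs.\<close>

lemma sccs_complete_iff:
  fixes G :: "nat pair_pre_digraph"
  assumes graph: "pair_graph G"
  shows "(\<forall>C \<in> pre_digraph.sccs (with_proj G). complete_digraph (card (verts C)) C) \<longleftrightarrow>
    (\<forall>i j k. adj G i j \<longrightarrow> adj G j k \<longrightarrow> adj G i k)"
proof -
  interpret pair_graph G by (rule graph)
  have sym: "(v, u) \<in> parcs G" if "(u, v) \<in> parcs G" for u v
    using that graph_symmetric[of u v] by simp
  show ?thesis
  proof
    assume L: "\<forall>C \<in> sccs. complete_digraph (card (verts C)) C"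
    show "\<forall>i j k. adj G i j \<longrightarrow> adj G j k \<longrightarrow> adj G i k"
    proof (intro allI impI)
      fix i j k assume ij: "adj G i j" and jk: "adj G j k"
      show "adj G i k"
      proof (cases "i = j \<or> j = k \<or> i = k")
        case True
        then show ?thesis using ij jk by (auto simp: adj_def)
      next
        case False
        then have a: "(i, j) \<in> parcs G" "(j, k) \<in> parcs G" using ij jk by (auto simp: adj_def)
        then have r: "i \<rightarrow>\<^sup>*\<^bsub>with_proj G\<^esub> j" "j \<rightarrow>\<^sup>*\<^bsub>with_proj G\<^esub> k" by (auto intro!: reachable_adjI)
        then have ik: "i \<rightarrow>\<^sup>*\<^bsub>with_proj G\<^esub> k" by (rule reachable_trans)
        have iv: "i \<in> pverts G" using a(1) by (rule in_arcsD1)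
        have "k \<in> scc_of i"
          using ik symmetric_reachable[OF sym_arcs ik] by (simp add: scc_of_def)
        moreover have "i \<in> scc_of i" using iv by (simp add: scc_of_def)
        moreover have "scc_of i \<in> verts ` sccs"
          using iv scc_of_in_sccs_verts[of i] by (simp add: sccs_verts_conv)
        ultimately obtain C where C: "C \<in> sccs" "i \<in> verts C" "k \<in> verts C" by auto
        then have "(i, k) \<in> arcs_ends C"
          using L False by (auto simp: complete_digraph_def)
        then have "(i, k) \<in> arcs_ends (with_proj G)"
          using C(1) by (meson induced_imp_subgraph in_sccs_imp_induced arcs_ends_mono subsetD)
        then show ?thesis by (simp add: adj_def)
      qed
    qed
  next
    assume tr: "\<forall>i j k. adj G i j \<longrightarrow> adj G j k \<longrightarrow> adj G i k"
    have reach: "adj G u v" if "u \<rightarrow>\<^sup>*\<^bsub>with_proj G\<^esub> v" for u v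
      using that
    proof (induction rule: reachable_induct)
      case base
      then show ?case by (simp add: adj_def)
    next
      case (step x y)
      then have "adj G x y" by (simp add: adj_def)
      then show ?case using step.IH tr by blast
    qed
    show "\<forall>C \<in> sccs. complete_digraph (card (verts C)) C"
    proof
      fix C assume C: "C \<in> sccs"
      then have ind: "induced_subgraph C (with_proj G)" and sc: "strongly_connected C" by auto
      have sub: "subgraph C (with_proj G)" using ind by (rule induced_imp_subgraph)
      have "graph C"
      proof -
        interpret C: sym_digraph C using ind by (rule induced_graph_imp_graph)
        interpret C: digraph C using ind by (rule digraphI_induced)
        show ?thesis by unfold_locales
      qed
      moreover have "arcs_ends C = {(u, v). (u, v) \<in> verts C \<times> verts C \<and> u \<noteq> v}"
      proof (intro equalityI subrelI)
        fix u v assume uv: "(u, v) \<in> arcs_ends C"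
        then have "(u, v) \<in> parcs G" using arcs_ends_mono[OF sub] by auto
        moreover have "u \<in> verts C" "v \<in> verts C"
          using uv sub by (auto simp: arcs_ends_def arc_to_ends_def intro: wf_digraph.head_in_verts wf_digraph.tail_in_verts)
        ultimately show "(u, v) \<in> {(u, v). (u, v) \<in> verts C \<times> verts C \<and> u \<noteq> v}"
          using no_loops by fastforce
      next
        fix u v assume "(u, v) \<in> {(u, v). (u, v) \<in> verts C \<times> verts C \<and> u \<noteq> v}"
        then have uv: "u \<in> verts C" "v \<in> verts C" "u \<noteq> v" by auto
        then have "u \<rightarrow>\<^sup>*\<^bsub>C\<^esub> v" using sc by auto
        then have "u \<rightarrow>\<^sup>*\<^bsub>with_proj G\<^esub> v" using sub by (rule pre_digraph.reachable_mono)
        then have "(u, v) \<in> parcs G" using reach uv by (auto simp: adj_def)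
        then have "(u, v) \<in> arcs C" using ind uv by (simp add: induced_subgraph_def)
        moreover have "tail C = fst" "head C = snd" using sub by (auto simp: subgraph_def compatible_def)
        ultimately show "(u, v) \<in> arcs_ends C" by (force simp: arcs_ends_def arc_to_ends_def)
      qed
      ultimately show "complete_digraph (card (verts C)) C" by (simp add: complete_digraph_def)
    qed
  qed
qed

section \<open>Nuclearity\<close>

theorem theorem6p1:
  fixes G :: "nat pair_pre_digraph" and n :: nat
  assumes graph: "pair_graph G" and verts: "pverts G = {0..<n}"
    and universe: "(UNIV :: complex set) \<lesssim> (UNIV :: 'v set)"
  shows "min_max_nuclear TYPE('v) (cvec_space n) (graph_op_system n G) \<longleftrightarrow>
    (\<forall>C \<in> pre_digraph.sccs (with_proj G). complete_digraph (card (verts C)) C)"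
proof -
  interpret pair_graph G by (rule graph)
  have arcs_n: "parcs G \<subseteq> {0..<n} \<times> {0..<n}"
    using verts in_arcsD1 in_arcsD2 by fastforce
  have gs: "graph_op_system n G = mat_op n ` supp_mats n (adj G)"
    by (simp add: graph_op_system_def graph_mats_eq[OF arcs_n])
  have sym: "adj G j i" if "adj G i j" for i j
    using that graph_symmetric[of i j] by (auto simp: adj_def)
  show ?thesis
    unfolding sccs_complete_iff[OF graph]
  proof
    assume nuc: "min_max_nuclear TYPE('v) (cvec_space n) (graph_op_system n G)"
    show "\<forall>i j k. adj G i j \<longrightarrow> adj G j k \<longrightarrow> adj G i k"
    proof (rule ccontr)
      assume "\<not> (\<forall>i j k. adj G i j \<longrightarrow> adj G j k \<longrightarrow> adj G i k)"
      then obtain v1 v2 v3 where v: "adj G v1 v2" "adj G v2 v3" "\<not> adj G v1 v3" by blast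
      then have "(v1, v2) \<in> parcs G" "(v2, v3) \<in> parcs G" by (auto simp: adj_def)
      then have vn: "v1 < n" "v2 < n" "v3 < n" using arcs_n by auto
      obtain a :: "complex vec \<Rightarrow> 'v" where a: "inj_on a (carrier_vec 4)"
        using cvec_embeds[OF universe] by blast
      \<comment> \<open>The tensor product must live in \<open>complex vec \<times> 'v\<close>; the
        first component alone carries the 4n-dimensional space, and the second is a
        constant.\<close>
      let ?b = "\<lambda>x :: complex vec. (x, undefined :: 'v)"
      interpret Q: cvec_copy_tensor n 4 a ?b
        by (intro cvec_copy_tensor.intro cvec_copy.intro a) (auto simp: inj_on_def)
      define \<tau> where "\<tau> = (\<lambda>x y. ?b (Q.kron x (Q.A.g y)))"
      have ht: "hilbert_tensor (cvec_space n) Q.A.W Q.C.W \<tau>"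
        unfolding \<tau>_def by (rule Q.hilbert_tensor_copy)
      let ?e = "\<lambda>i. a (unit_vec 4 i)"
      have onb: "onb Q.A.W 4 ?e" by (rule Q.A.onb_W)
      have os: "operator_system Q.A.W (path_dual Q.A.W ?e)"
        by (rule onb.path_dual_operator_system[OF onb]) simp
      have pt: "path_tensor n Q.A.W Q.C.W \<tau> (adj G) ?e v1 v2 v3"
        by (intro path_tensor.intro supp_tensor.intro cvec_tensor.intro cvec_tensor_axioms.intro
            supp_tensor_axioms.intro path_tensor_axioms.intro Q.A.complex_hilbert_W Q.C.complex_hilbert_W
            ht onb os vn v sym[OF v(1)] sym[OF v(2)]) (simp add: adj_def)
      show False
        using path_tensor.min_neq_max[OF pt] nuc[unfolded min_max_nuclear_def gs, rule_format,
            OF conjI[OF Q.A.complex_hilbert_W conjI[OF os ht]]] by blast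
    qed
  next
    assume tr: "\<forall>i j k. adj G i j \<longrightarrow> adj G j k \<longrightarrow> adj G i k"
    show "min_max_nuclear TYPE('v) (cvec_space n) (graph_op_system n G)"
      unfolding min_max_nuclear_def gs
    proof (intro allI impI, elim conjE)
      fix K :: "'v cinner_space" and T and L :: "(complex vec \<times> 'v) cinner_space" and \<tau> m
      assume K: "complex_hilbert K" and T: "operator_system K T"
        and ht: "hilbert_tensor (cvec_space n) K L \<tau>"
      then have "complex_hilbert L" by (simp add: hilbert_tensor_def)
      then have "supp_tensor n K L \<tau> (adj G) T"
        by (intro supp_tensor.intro cvec_tensor.intro cvec_tensor_axioms.intro
            supp_tensor_axioms.intro K T ht) (simp_all add: adj_def)
      then show "min_cone (cvec_space n) K L \<tau> (mat_op n ` supp_mats n (adj G)) T m =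
          max_cone (cvec_space n) K L \<tau> (mat_op n ` supp_mats n (adj G)) T m"
        by (rule supp_tensor.min_eq_max) (use tr sym in blast)+
    qed
  qed
qed

end
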